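(* Fix a point $P\in\mathbb P$ and a coordinate $u$ with its pole at $P$. Let $z_1,z_2\in\mathbb P\setminus P$, $z_2\ne z_1$, let $\mathtt v\in\mathbf W^{z_1}$, and set $\hat S(z)=\hat e^3(z)+3\hat e^2(z)\hat i(z)+3\hat e(z)\hat i^2(z)+\hat i^3(z)$. Then, as $z_2\to z_1$, $$\Bigl[2\,\hat T(z_2)\hat b(z_1)-\frac{2}{(u(z_2)-u(z_1))^2}\,\hat b(z_1)-\frac{2}{u(z_2)-u(z_1)}\,\hat b'(z_1)\Bigr]\mathtt v\ \longrightarrow\ \bigl[\hat S(z_1)+\hat b''(z_1)\bigr]\mathtt v ,$$ where $\hat b'$ and $\hat b''$ are the first and second derivatives of the field $\hat b$ with respect to the vector field $d/du$.
   Context: $\mathbb P$ is a complex projective line; $K$ its canonical bundle, $K_z$ the fibre at $z$. A coordinate is a meromorphic function $u$ on $\mathbb P$ with exactly one pole, which is simple; $du_z\in K_z$ is the value of $du$ at $z$. $\mathbf K$ is the space of meromorphic 1-forms on $\mathbb P$ with all residues zero, $\mathbf K^z\subset\mathbf K$ the subspace of forms regular at $z$; $\mathbf W=S^*\mathbf K$, $\mathbf W^z=S^*\mathbf K^z$ are the symmetric algebras. Fields: $e(z):\mathbf W\to\mathbf W\otimes K_z$ is multiplication by $e_z=-\frac{du}{(u-u(z))^2}\otimes du_z$. $i(z):\mathbf W^z\to\mathbf W^z\otimes K_z$ is the derivation with $i(z)\mathbf 1=0$ and $i(z)\alpha=-\alpha(z)$ for $\alpha\in\mathbf K^z$. $b(z)=i(z)+e(z):\mathbf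 W^z\to\mathbf W\otimes K_z$. $T(z)=\tfrac12\{i(z)\circ i(z)+e(z)\circ e(z)+2e(z)\circ i(z)\}:\mathbf W^z\to\mathbf W\otimes K_z^2$. With the coordinate $u$ chosen, one writes $e(z)=\hat e(z)du_z$, $i(z)=\hat i(z)du_z$, $b(z)=\hat b(z)du_z$, $T(z)=\hat T(z)du_z^2$; the derivatives of $\hat b$ are taken with respect to the variable $u(z)$. Limits: for $\mathtt v\in\mathbf W^{z_1}$ the expressions are defined for $z_2\ne z_1$ in a Zariski neighbourhood of $z_1$ (depending on $\mathtt v$). The degree $m$ component of the expression is a symmetric polydifferential in $m$ auxiliary points depending rationally on those points and on $u(z_2)$; the limit statement means that each component has no pole along $z_2=z_1$ and that its restriction to $z_2=z_1$ is the corresponding component of the right side. *)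

theory Defs
  imports
    "HOL-Complex_Analysis.Complex_Analysis"
    "HOL-Combinatorics.Multiset_Permutations"
    "HOL-Library.Poly_Mapping"
begin

section \<open>The complex projective line\<close>

datatype pline = Fin complex | Inf

text \<open>A holomorphic parametrisation of a neighbourhood of \<open>p\<close>, centred at \<open>p\<close>.\<close>

fun chart :: "pline \<Rightarrow> complex \<Rightarrow> pline" where
  "chart (Fin a) t = Fin (a + t)"
| "chart Inf t = (if t = 0 then Inf else Fin (1 / t))"

text \<open>
  Meromorphic functions are total: the value at a pole is 0 (the convention of
  \<open>nicely_meromorphic_on\<close>), and removable singularities are removed.
\<close>

definition mero_fun :: "(pline \<Rightarrow> complex) \<Rightarrow> bool" where
  "mero_fun f \<longleftrightarrow> (\<forall>p. (f \<circ> chart p) nicely_meromorphic_on {0})"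

definition coordinate :: "(pline \<Rightarrow> complex) \<Rightarrow> pline \<Rightarrow> bool" where
  "coordinate u P \<longleftrightarrow> mero_fun u \<and> {p. is_pole (u \<circ> chart p) 0} = {P}
     \<and> zorder (u \<circ> chart P) 0 = -1"


section \<open>Meromorphic 1-forms\<close>

text \<open>
  A 1-form \<open>\<alpha>\<close> is represented by its values: \<open>\<alpha> p\<close> is the coefficient of the value at \<open>p\<close> with
  respect to the basis \<open>dt\<close> of the cotangent line at \<open>p\<close>, where \<open>t\<close> is the parameter of
  \<open>chart p\<close>; that is, \<open>dw\<close> at the finite points and \<open>d(1/w)\<close> at \<open>Inf\<close>, with \<open>w\<close> the affine
  variable.  Then \<open>form_local \<alpha> p\<close> is the coefficient of \<open>\<alpha>\<close> in the parameter of
  \<open>chart p\<close>, using \<open>d(1/t) = - dt / t^2\<close>.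
\<close>

fun form_local :: "(pline \<Rightarrow> complex) \<Rightarrow> pline \<Rightarrow> complex \<Rightarrow> complex" where
  "form_local \<alpha> (Fin a) t = \<alpha> (Fin (a + t))"
| "form_local \<alpha> Inf t = (if t = 0 then \<alpha> Inf else - \<alpha> (Fin (1 / t)) / t\<^sup>2)"

definition mero_form :: "(pline \<Rightarrow> complex) \<Rightarrow> bool" where
  "mero_form \<alpha> \<longleftrightarrow> (\<forall>p. form_local \<alpha> p nicely_meromorphic_on {0})"

typedef kform = "{\<alpha>. mero_form \<alpha> \<and> (\<forall>p. residue (form_local \<alpha> p) 0 = 0)}"
  morphisms form_val Abs_kform
proof -
  have *: "form_local (\<lambda>_. 0) p = (\<lambda>_. 0)" for p
    by (cases p) auto
  have "(\<lambda>_. 0 :: complex) nicely_meromorphic_on {0}"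
    by (intro analytic_on_imp_nicely_meromorphic_on) auto
  then have "(\<lambda>_. 0) \<in> {\<alpha>. mero_form \<alpha> \<and> (\<forall>p. residue (form_local \<alpha> p) 0 = 0)}"
    by (simp add: mero_form_def * residue_const)
  then show ?thesis by blast
qed

definition regular :: "kform \<Rightarrow> pline \<Rightarrow> bool" where
  "regular \<alpha> p \<longleftrightarrow> \<not> is_pole (form_local (form_val \<alpha>) p) 0"

definition lin_comb :: "complex \<Rightarrow> kform \<Rightarrow> complex \<Rightarrow> kform \<Rightarrow> kform \<Rightarrow> bool" where
  "lin_comb a \<alpha> b \<beta> \<gamma> \<longleftrightarrow>
     (\<forall>p. regular \<alpha> p \<and> regular \<beta> p \<longrightarrow>
        form_val \<gamma> p = a * form_val \<alpha> p + b * form_val \<beta> p)"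

text \<open>The coefficients of \<open>du\<close>; only meaningful where \<open>u\<close> has no pole.\<close>

definition du :: "(pline \<Rightarrow> complex) \<Rightarrow> pline \<Rightarrow> complex" where
  "du u p = deriv (u \<circ> chart p) 0"

text \<open>Away from the pole of \<open>u\<close>: the value of \<open>\<alpha>\<close> at \<open>p\<close> in units of \<open>du\<close>.\<close>

definition coef :: "(pline \<Rightarrow> complex) \<Rightarrow> kform \<Rightarrow> pline \<Rightarrow> complex" where
  "coef u \<alpha> p = form_val \<alpha> p / du u p"

text \<open>
  The form \<open>- du / (u - u(z))^2\<close>; \<open>remove_sings\<close> supplies its value at the pole of \<open>u\<close>.
\<close>

definition e_form :: "(pline \<Rightarrow> complex) \<Rightarrow> pline \<Rightarrow> kform" where
  "e_form u z = Abs_kform (\<lambda>p.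
     remove_sings (form_local (\<lambda>q. - du u q / (u q - u z)\<^sup>2) p) 0)"


section \<open>The symmetric algebra\<close>

text \<open>
  The symmetric algebra of the space of forms is the polynomial ring with one variable for each
  form, modulo the ideal generated by the linear relations between forms.
\<close>

type_synonym free_alg = "kform multiset \<Rightarrow>\<^sub>0 complex"

definition gen :: "kform \<Rightarrow> free_alg" where
  "gen \<alpha> = Poly_Mapping.single {#\<alpha>#} 1"

definition scal :: "complex \<Rightarrow> free_alg" where
  "scal c = Poly_Mapping.single 0 c"

inductive_set lin_ideal :: "free_alg set" where
  zero: "0 \<in> lin_ideal"
| rel: "lin_comb a \<alpha> b \<beta> \<gamma> \<Longrightarrow> gen \<gamma> - scal a * gen \<alpha> - scal b * gen \<beta> \<in> lin_ideal"
| add: "p \<in> lin_ideal \<Longrightarrow> q \<in> lin_ideal \<Longrightarrow> p + q \<in> lin_ideal"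
| mult: "q \<in> lin_ideal \<Longrightarrow> p * q \<in> lin_ideal"

definition lin_equiv :: "free_alg \<Rightarrow> free_alg \<Rightarrow> bool" where
  "lin_equiv p q \<longleftrightarrow> p - q \<in> lin_ideal"

lemma lin_ideal_uminus: "p \<in> lin_ideal \<Longrightarrow> - p \<in> lin_ideal"
  using lin_ideal.mult[of p "-1"] by simp

lemma lin_ideal_diff: "p \<in> lin_ideal \<Longrightarrow> q \<in> lin_ideal \<Longrightarrow> p - q \<in> lin_ideal"
  using lin_ideal.add[of p "- q"] lin_ideal_uminus by simp

lemma equivp_lin_equiv: "equivp lin_equiv"
proof (rule equivpI)
  show "reflp lin_equiv"
    by (auto simp: reflp_def lin_equiv_def intro: lin_ideal.zero)
  show "symp lin_equiv"
    unfolding symp_def lin_equiv_def using lin_ideal_uminus by fastforce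
  show "transp lin_equiv"
    unfolding transp_def lin_equiv_def using lin_ideal.add by fastforce
qed

quotient_type W = free_alg / lin_equiv
  morphisms rep_W W_of
  by (rule equivp_lin_equiv)

lemma lookup_mult_empty:
  fixes p q :: free_alg
  shows "Poly_Mapping.lookup (p * q) {#} = Poly_Mapping.lookup p {#} * Poly_Mapping.lookup q {#}"
proof -
  have "Poly_Mapping.lookup p l * Sum_any (\<lambda>k. Poly_Mapping.lookup q k when {#} = l + k) =
        (Poly_Mapping.lookup p {#} * Poly_Mapping.lookup q {#} when l = {#})" for l
    by (cases "l = {#}") auto
  then show ?thesis
    by (simp add: lookup_mult)
qed

lemma lin_ideal_lookup_empty: "p \<in> lin_ideal \<Longrightarrow> Poly_Mapping.lookup p {#} = 0"
  by (induction rule: lin_ideal.induct)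
    (auto simp: lookup_add lookup_minus lookup_mult_empty gen_def lookup_single)

instantiation W :: comm_ring_1
begin

lift_definition zero_W :: W is 0 .
lift_definition one_W :: W is 1 .

lift_definition plus_W :: "W \<Rightarrow> W \<Rightarrow> W" is "(+)"
proof -
  fix p p' q q' :: free_alg
  assume "lin_equiv p p'" "lin_equiv q q'"
  then have "(p - p') + (q - q') \<in> lin_ideal"
    unfolding lin_equiv_def by (rule lin_ideal.add)
  then show "lin_equiv (p + q) (p' + q')"
    unfolding lin_equiv_def by (simp add: algebra_simps)
qed

lift_definition uminus_W :: "W \<Rightarrow> W" is uminus
  unfolding lin_equiv_def using lin_ideal_uminus by fastforce

lift_definition minus_W :: "W \<Rightarrow> W \<Rightarrow> W" is "(-)"
proof -
  fix p p' q q' :: free_alg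
  assume "lin_equiv p p'" "lin_equiv q q'"
  then have "(p - p') - (q - q') \<in> lin_ideal"
    unfolding lin_equiv_def by (rule lin_ideal_diff)
  then show "lin_equiv (p - q) (p' - q')"
    unfolding lin_equiv_def by (simp add: algebra_simps)
qed

lift_definition times_W :: "W \<Rightarrow> W \<Rightarrow> W" is "(*)"
proof -
  fix p p' q q' :: free_alg
  assume "lin_equiv p p'" "lin_equiv q q'"
  then have "q * (p - p') + p' * (q - q') \<in> lin_ideal"
    unfolding lin_equiv_def by (intro lin_ideal.add lin_ideal.mult)
  then show "lin_equiv (p * q) (p' * q')"
    unfolding lin_equiv_def by (simp add: algebra_simps)
qed

instance
proof
  show "(0::W) \<noteq> 1"
  proof (transfer, rule notI)
    assume "lin_equiv 0 1"
    then have "Poly_Mapping.lookup (0 - 1 :: free_alg) {#} = 0"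
      unfolding lin_equiv_def by (rule lin_ideal_lookup_empty)
    then show False
      by (simp add: lookup_minus lookup_one)
  qed
qed (transfer; simp add: algebra_simps equivp_reflp[OF equivp_lin_equiv])+

end

definition iota :: "kform \<Rightarrow> W" where
  "iota \<alpha> = W_of (gen \<alpha>)"

definition cW :: "complex \<Rightarrow> W" where
  "cW c = W_of (scal c)"

text \<open>
  \<open>W_reg A\<close> is the symmetric algebra of the space of forms regular at all points of \<open>A\<close>, as a
  subalgebra of \<open>W\<close>.
\<close>

definition free_reg :: "pline set \<Rightarrow> free_alg set" where
  "free_reg A = {p. \<forall>M \<in> Poly_Mapping.keys p. \<forall>\<alpha> \<in># M. \<forall>x \<in> A. regular \<alpha> x}"

definition W_reg :: "pline set \<Rightarrow> W set" where
  "W_reg A = W_of ` free_reg A"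


section \<open>The fields\<close>

text \<open>
  All fields are written in the basis \<open>du\<close> of the cotangent line at \<open>z\<close>.  Operators defined on
  \<open>W_reg {z}\<close> only are total functions, arbitrary off that subalgebra.
\<close>

definition e_hat :: "(pline \<Rightarrow> complex) \<Rightarrow> pline \<Rightarrow> W \<Rightarrow> W" where
  "e_hat u z w = iota (e_form u z) * w"

definition is_i_hat :: "(pline \<Rightarrow> complex) \<Rightarrow> pline \<Rightarrow> (W \<Rightarrow> W) \<Rightarrow> bool" where
  "is_i_hat u z D \<longleftrightarrow>
     (\<forall>v \<in> W_reg {z}. D v \<in> W_reg {z}) \<and>
     (\<forall>v \<in> W_reg {z}. \<forall>w \<in> W_reg {z}. D (v + w) = D v + D w) \<and>
     (\<forall>c. \<forall>v \<in> W_reg {z}. D (cW c * v) = cW c * D v) \<and>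
     (\<forall>v \<in> W_reg {z}. \<forall>w \<in> W_reg {z}. D (v * w) = D v * w + v * D w) \<and>
     D 1 = 0 \<and>
     (\<forall>\<alpha>. regular \<alpha> z \<longrightarrow> D (iota \<alpha>) = - cW (coef u \<alpha> z))"

definition i_hat :: "(pline \<Rightarrow> complex) \<Rightarrow> pline \<Rightarrow> W \<Rightarrow> W" where
  "i_hat u z = (SOME D. is_i_hat u z D)"

definition b_hat :: "(pline \<Rightarrow> complex) \<Rightarrow> pline \<Rightarrow> W \<Rightarrow> W" where
  "b_hat u z w = i_hat u z w + e_hat u z w"

definition T_hat :: "(pline \<Rightarrow> complex) \<Rightarrow> pline \<Rightarrow> W \<Rightarrow> W" where
  "T_hat u z w = cW (1 / 2) *
     (i_hat u z (i_hat u z w) + e_hat u z (e_hat u z w) + 2 * e_hat u z (i_hat u z w))"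

definition S_hat :: "(pline \<Rightarrow> complex) \<Rightarrow> pline \<Rightarrow> W \<Rightarrow> W" where
  "S_hat u z w = (e_hat u z ^^ 3) w + 3 * (e_hat u z ^^ 2) (i_hat u z w)
     + 3 * e_hat u z ((i_hat u z ^^ 2) w) + (i_hat u z ^^ 3) w"


section \<open>Polydifferentials\<close>

text \<open>
  The degree \<open>m\<close> component of an element of \<open>W\<close> as a symmetric polydifferential in \<open>m\<close> points,
  in units of \<open>du\<close> at each of the points: the product of \<open>\<alpha>\<^sub>1, \<dots>, \<alpha>\<^sub>m\<close> goes to the average, over
  the permutations \<open>s\<close>, of the products of the \<open>\<alpha>\<^bsub>s i\<^esub>(x\<^sub>i)\<close>.  The points form a list of length \<open>m\<close>.
\<close>

definition free_polydiff :: "(pline \<Rightarrow> complex) \<Rightarrow> free_alg \<Rightarrow> pline list \<Rightarrow> complex" where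
  "free_polydiff u p xs =
     (\<Sum>M \<in> {M \<in> Poly_Mapping.keys p. size M = length xs}. Poly_Mapping.lookup p M *
        (\<Sum>as \<in> permutations_of_multiset M. \<Prod>i < length xs. coef u (as ! i) (xs ! i))
        / of_nat (card (permutations_of_multiset M)))"

text \<open>Meaningful for \<open>w \<in> W_reg (set xs)\<close> and points other than the pole of \<open>u\<close>.\<close>

definition polydiff :: "(pline \<Rightarrow> complex) \<Rightarrow> W \<Rightarrow> pline list \<Rightarrow> complex" where
  "polydiff u w xs = (THE c. \<exists>p \<in> free_reg (set xs). w = W_of p \<and> c = free_polydiff u p xs)"


section \<open>Derivatives and limits of families in the symmetric algebra\<close>

text \<open>
  The derivative of order \<open>k\<close> at \<open>z\<close>, with respect to \<open>u(z)\<close>, of a \<open>W\<close>-valued function is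
  taken componentwise: for each \<open>m\<close> and generic points, differentiate the polydifferential.
\<close>

definition point_at :: "(pline \<Rightarrow> complex) \<Rightarrow> pline \<Rightarrow> complex \<Rightarrow> pline" where
  "point_at u P t = inv_into (UNIV - {P}) u t"

definition has_W_deriv ::
  "(pline \<Rightarrow> complex) \<Rightarrow> pline \<Rightarrow> nat \<Rightarrow> (pline \<Rightarrow> W) \<Rightarrow> pline \<Rightarrow> W \<Rightarrow> bool" where
  "has_W_deriv u P k F z G \<longleftrightarrow>
     (\<forall>m. \<exists>A. finite A \<and> (\<forall>xs. length xs = m \<and> set xs \<inter> A = {} \<longrightarrow>
        G \<in> W_reg (set xs) \<and>
        (\<forall>\<^sub>F t in nhds (u z). F (point_at u P t) \<in> W_reg (set xs)) \<and>
        (\<lambda>t. polydiff u (F (point_at u P t)) xs) analytic_on {u z} \<and>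
        (deriv ^^ k) (\<lambda>t. polydiff u (F (point_at u P t)) xs) (u z) = polydiff u G xs))"

definition W_deriv ::
  "(pline \<Rightarrow> complex) \<Rightarrow> pline \<Rightarrow> nat \<Rightarrow> (pline \<Rightarrow> W) \<Rightarrow> pline \<Rightarrow> W" where
  "W_deriv u P k F z = (SOME G. has_W_deriv u P k F z G)"

definition b_hat_deriv ::
  "(pline \<Rightarrow> complex) \<Rightarrow> pline \<Rightarrow> nat \<Rightarrow> pline \<Rightarrow> W \<Rightarrow> W" where
  "b_hat_deriv u P k z v = W_deriv u P k (\<lambda>y. b_hat u y v) z"

text \<open>
  Evaluation of a polynomial whose monomials are exponent vectors, the variable with index \<open>i\<close>
  being replaced by \<open>ys ! i\<close>.
\<close>

definition mpoly_eval :: "((nat \<Rightarrow>\<^sub>0 nat) \<Rightarrow>\<^sub>0 complex) \<Rightarrow> complex list \<Rightarrow> complex" where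
  "mpoly_eval N ys =
     (\<Sum>k \<in> Poly_Mapping.keys N. Poly_Mapping.lookup N k *
        (\<Prod>i < length ys. ys ! i ^ Poly_Mapping.lookup k i))"

text \<open>
  Each component of \<open>F z\<^sub>2\<close> is a rational function \<open>N / D\<close> of \<open>u(z\<^sub>2)\<close> and the coordinates of the
  points, without pole along \<open>z\<^sub>2 = z\<^sub>1\<close> (the denominator does not vanish identically there),
  whose restriction to \<open>z\<^sub>2 = z\<^sub>1\<close> is the component of \<open>G\<close>.  The finite set \<open>A\<close> absorbs the points
  \<open>z\<^sub>1\<close> and \<open>P\<close>, the complement of the Zariski neighbourhood of \<open>z\<^sub>1\<close> on which \<open>F\<close> is
  defined, and the poles.
\<close>

definition W_tendsto ::
  "(pline \<Rightarrow> complex) \<Rightarrow> (pline \<Rightarrow> W) \<Rightarrow> pline \<Rightarrow> W \<Rightarrow> bool" where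
  "W_tendsto u F z1 G \<longleftrightarrow>
     (\<forall>m. \<exists>N D A. finite A \<and>
        (\<exists>ys. length ys = m \<and> mpoly_eval D (u z1 # ys) \<noteq> 0) \<and>
        (\<forall>z2 xs. z2 \<notin> A \<and> length xs = m \<and> set xs \<inter> insert z2 A = {} \<longrightarrow>
           F z2 \<in> W_reg (set xs) \<and>
           polydiff u (F z2) xs * mpoly_eval D (u z2 # map u xs) = mpoly_eval N (u z2 # map u xs)) \<and>
        (\<forall>xs. length xs = m \<and> set xs \<inter> A = {} \<longrightarrow>
           G \<in> W_reg (set xs) \<and>
           polydiff u G xs * mpoly_eval D (u z1 # map u xs) = mpoly_eval N (u z1 # map u xs)))"

end

theory Submission
  imports Defs
begin

text \<open>
  Write \<open>h = u(z2) - u(z1)\<close>.  The form \<open>e(z1)\<close> is regular at \<open>z2\<close> and \<open>i(z2)\<close> maps it to the constant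
  \<open>1 / h\<^sup>2\<close>.  Since \<open>i(z2)\<close> is a derivation, expanding \<open>2 T(z2) b(z1) v\<close> gives terms without this
  contraction and terms with it.  The latter add up to \<open>(2 / h\<^sup>2) b(z2) v\<close>.  The former have no pole
  at \<open>z2 = z1\<close> and their value there is \<open>S(z1) v\<close>.  So the expression of the statement is a regular
  part plus \<open>2 / h\<^sup>2\<close> times \<open>b(z2) v - b(z1) v - h b'(z1) v\<close>.  By Taylor's formula this second term
  tends to \<open>b''(z1) v\<close> (\<open>T_hat_b_hat_eq\<close>, \<open>operator_product_expansion\<close>).

  The limit is one of rational functions, component by component, and three things make this precise.

  A coordinate is a Moebius transformation and meromorphic functions on the sphere are rational
  (\<open>coordinate_is_moebius\<close>, \<open>meromorphic_on_sphere_imp_rational\<close>), so the coefficients of a form are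
  rational functions of \<open>u\<close>, with a denominator that vanishes only at poles (\<open>ucoef_rational\<close>).

  The value of a form at \<open>z\<close>, as the constant term of a Laurent expansion, is a linear functional on
  all forms.  It extends to a derivation of the whole symmetric algebra, which induces \<open>i(z)\<close>
  (\<open>i_hat_eq_ins\<close>).  Iterating such derivations at the points \<open>x\<^sub>1, \<dots>, x\<^sub>m\<close> computes the component of
  degree \<open>m\<close> (\<open>polydiff_eq_contract\<close>).  This makes the components well defined and linear and gives
  them a Leibniz rule.

  Families \<open>F(z)\<close> of elements whose components are rational functions without pole at \<open>z = z1\<close> are
  closed under sums and under multiplication by rational scalars and by families of degree 1, such as
  \<open>e(z)\<close>.  By induction on \<open>v\<close>, the families \<open>i(z) v\<close> and \<open>i(z) i(z) v\<close> are of this kind, and \<open>b(z) v\<close>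
  has a Taylor expansion of order 2 whose remainder is (\<open>rational_family_ins\<close>, \<open>b_hat_jet\<close>).  The
  coefficients of this expansion are the derivatives of \<open>b\<close> (\<open>jet_has_W_deriv\<close>).
\<close>

section \<open>Meromorphic functions on the sphere\<close>

lemma analytic_on_poly:
  assumes "g analytic_on A"
  shows "(\<lambda>s. poly q (g s)) analytic_on A"
  by (induction q) (auto intro!: analytic_intros assms)

lemma holomorphic_on_cball_tendsto:
  assumes "g holomorphic_on cball p r" "r > 0"
  shows "g \<midarrow>p\<rightarrow> g p"
proof -
  have "g holomorphic_on ball p r"
    using assms(1) by (rule holomorphic_on_subset) auto
  then have "isCont g p"
    using assms(2) by (intro analytic_at_imp_isCont) (auto simp: analytic_on_open holomorphic_on_imp_analytic_at)
  then show ?thesis by (simp add: isContD)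
qed

text \<open>
  A bound on the order of the pole, in a form that applies both at a finite pole and, with the
  variable \<open>1 / t\<close>, at infinity.
\<close>

lemma meromorphic_times_power_tendsto:
  assumes "f meromorphic_on {p}"
  shows "\<exists>N c. ((\<lambda>w. (w - p) ^ N * f w) \<longlongrightarrow> c) (at p)"
proof (cases "\<exists>\<^sub>F w in at p. f w \<noteq> 0")
  case False
  then have "\<forall>\<^sub>F w in at p. f w = 0"
    by (simp add: frequently_def)
  then have "((\<lambda>w. (w - p) ^ 0 * f w) \<longlongrightarrow> 0) (at p)"
    by (simp add: tendsto_eventually)
  then show ?thesis by blast
next
  case True
  have "isolated_singularity_at f p" "not_essential f p"
    using assms by (auto simp: meromorphic_at_iff)
  from zorder_exist[OF this True] obtain r where r: "r > 0"
      "zor_poly f p holomorphic_on cball p r"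
      "\<And>w. w \<in> cball p r - {p} \<Longrightarrow> f w = zor_poly f p w * (w - p) powi zorder f p"
    by blast
  define N where "N = nat (- zorder f p)"
  define M where "M = nat (zorder f p)"
  have lim: "zor_poly f p \<midarrow>p\<rightarrow> zor_poly f p p"
    by (rule holomorphic_on_cball_tendsto[OF r(2,1)])
  have "((\<lambda>w. zor_poly f p w * (w - p) ^ M) \<longlongrightarrow> zor_poly f p p * (p - p) ^ M) (at p)"
    by (intro tendsto_intros lim)
  moreover have "\<forall>\<^sub>F w in at p. (w - p) ^ N * f w = zor_poly f p w * (w - p) ^ M"
  proof -
    have "\<forall>\<^sub>F w in at p. w \<in> cball p r - {p}"
      using r(1) eventually_at_ball'[of r p UNIV] by (auto elim!: eventually_mono)
    then show ?thesis
    proof eventually_elim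
      case (elim w)
      then have "(w - p) ^ N * (w - p) powi zorder f p = (w - p) ^ M"
        by (cases "zorder f p \<ge> 0") (auto simp: N_def M_def power_int_def field_simps)
      then show ?case
        using r(3)[OF elim] by (simp add: mult_ac)
    qed
  qed
  ultimately have "((\<lambda>w. (w - p) ^ N * f w) \<longlongrightarrow> zor_poly f p p * (p - p) ^ M) (at p)"
    using tendsto_cong by fast
  then show ?thesis by blast
qed

lemma polynomial_growth_from_infinity:
  assumes "((\<lambda>t. t ^ N * f (1 / t)) \<longlongrightarrow> c) (at 0)"
  obtains A B where "\<And>z::complex. A \<le> norm z \<Longrightarrow> norm (f z :: complex) \<le> B * norm z ^ N"
proof -
  have "\<forall>\<^sub>F t in at 0. norm (t ^ N * f (1 / t)) < norm c + 1"
    using tendsto_norm[OF assms] by (rule order_tendstoD) simp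
  then obtain r where r: "r > 0" "\<And>t. t \<noteq> 0 \<Longrightarrow> norm t < r \<Longrightarrow> norm (t ^ N * f (1 / t)) < norm c + 1"
    by (auto simp: eventually_at)
  show ?thesis
  proof (rule that[of "2 / r" "norm c + 1"])
    fix z :: complex assume z: "2 / r \<le> norm z"
    then have nz: "norm z > 0"
      using r(1) by (smt (verit) divide_pos_pos)
    have "norm (1 / z) < r"
      using z r(1) nz by (simp add: norm_divide field_simps)
    then have "norm ((1 / z) ^ N * f z) < norm c + 1"
      using r(2)[of "1 / z"] nz by auto
    then show "norm (f z) \<le> (norm c + 1) * norm z ^ N"
      using nz by (simp add: norm_mult norm_power norm_divide field_simps)
  qed
qed

text \<open>
  Liouville: the limit says that \<open>f\<close> grows at most like the power \<open>N\<close> of the variable.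
\<close>

lemma entire_meromorphic_at_infinity_is_poly:
  assumes "f analytic_on UNIV" "((\<lambda>t. t ^ N * f (1 / t)) \<longlongrightarrow> c) (at 0)"
  obtains n where "degree n \<le> N" "\<And>z. f z = poly n z"
proof -
  obtain A B where AB: "\<And>z::complex. A \<le> norm z \<Longrightarrow> norm (f z) \<le> B * norm z ^ N"
    using polynomial_growth_from_infinity[OF assms(2)] by metis
  define n where "n = (\<Sum>k\<le>N. monom ((deriv ^^ k) f 0 / fact k) k)"
  have "f z = poly n z" for z
    using Liouville_polynomial[OF analytic_imp_holomorphic[OF assms(1)] AB]
    by (simp add: n_def poly_sum poly_monom)
  moreover have "degree n \<le> N"
    unfolding n_def by (intro degree_sum_le) (auto intro: degree_monom_le order_trans)
  ultimately show ?thesis by (rule that[rotated])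
qed

text \<open>
  The singular points are isolated, also at infinity, so there are finitely many by compactness.
  Multiplication by a polynomial \<open>d\<close> that vanishes at them to high enough order leaves an entire
  function that is meromorphic at infinity, hence a polynomial.  As \<open>d\<close> vanishes at no regular point, the
  quotient gives the value of \<open>f\<close> at all of them; this matters later at \<open>z1\<close>.
\<close>

theorem meromorphic_on_sphere_imp_rational:
  assumes mero: "f meromorphic_on UNIV" and inf: "(\<lambda>t. f (1 / t)) meromorphic_on {0}"
  obtains n d where "\<And>s. f analytic_on {s} \<Longrightarrow> poly d s \<noteq> 0"
    "\<And>s. f analytic_on {s} \<Longrightarrow> f s = poly n s / poly d s" "d \<noteq> 0" "finite {s. \<not> f analytic_on {s}}"
proof -
  define S where "S = {s. \<not> f analytic_on {s}}"
  have fin: "finite S"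
  proof -
    have "\<forall>\<^sub>F t in at 0. (\<lambda>t. f (1 / t)) analytic_on {t}"
      using inf by (simp only: meromorphic_at_iff isolated_singularity_at_altdef)
    then obtain r where r: "r > 0" "\<And>t. t \<noteq> 0 \<Longrightarrow> norm t < r \<Longrightarrow> (\<lambda>t. f (1 / t)) analytic_on {t}"
      by (auto simp: eventually_at)
    have "S \<subseteq> cball 0 (1 / r)"
    proof
      fix s assume "s \<in> S"
      show "s \<in> cball 0 (1 / r)"
      proof (rule ccontr)
        assume "s \<notin> cball 0 (1 / r)"
        then have s: "norm s > 1 / r" by simp
        then have s0: "s \<noteq> 0" using r(1) by auto
        have "norm (1 / s) < r"
          using s r(1) s0 by (simp add: norm_divide field_simps)
        then have "(\<lambda>t. f (1 / t)) analytic_on {1 / s}"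
          using r(2) s0 by auto
        then have "((\<lambda>t. f (1 / t)) \<circ> (\<lambda>z. 1 / z)) analytic_on {s}"
          by (intro analytic_on_compose_gen[of _ _ _ "{1/s}"] analytic_intros) (use s0 in auto)
        then have "f analytic_on {s}" by (simp add: o_def)
        with \<open>s \<in> S\<close> show False
          by (simp add: S_def)
      qed
    qed
    moreover have "S sparse_in UNIV"
      using meromorphic_on_imp_analytic_cosparse[OF mero] by (simp add: S_def eventually_cosparse)
    ultimately show ?thesis
      by (metis S_def compact_cball inf.absorb_iff2 inf_commute sparse_in_compact_finite sparse_in_subset subset_UNIV)
  qed
  have "\<forall>p. \<exists>N c. ((\<lambda>w. (w - p) ^ N * f w) \<longlongrightarrow> c) (at p)"
    using meromorphic_times_power_tendsto mero meromorphic_on_subset by blast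
  then obtain k c where k: "\<And>p. ((\<lambda>w. (w - p) ^ k p * f w) \<longlongrightarrow> c p) (at p)"
    by metis
  define d where "d = (\<Prod>p\<in>S. [:- p, 1:] ^ k p)"
  have d_nz: "poly d s \<noteq> 0" if "s \<notin> S" for s
    using that fin by (auto simp: d_def poly_prod)
  define g where "g = remove_sings (\<lambda>s. f s * poly d s)"
  have mero_fd: "(\<lambda>s. f s * poly d s) meromorphic_on UNIV"
    by (intro meromorphic_intros mero analytic_on_imp_meromorphic_on[OF analytic_on_poly] analytic_intros)
  have lim_fd: "\<exists>c. ((\<lambda>s. f s * poly d s) \<longlongrightarrow> c) (at p)" for p
  proof (cases "p \<in> S")
    case False
    then have "f \<midarrow>p\<rightarrow> f p"
      using analytic_at_imp_isCont[of f p] by (simp add: S_def isContD)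
    then show ?thesis
      by (intro exI[of _ "f p * poly d p"] tendsto_mult tendsto_poly[OF tendsto_ident_at])
  next
    case True
    define e where "e = (\<Prod>p\<in>S - {p}. [:- p, 1:] ^ k p)"
    have "d = [:- p, 1:] ^ k p * e"
      using True fin by (simp add: d_def e_def prod.remove)
    then have "f s * poly d s = ((s - p) ^ k p * f s) * poly e s" for s
      by (simp add: mult_ac)
    then have "(\<lambda>s. f s * poly d s) = (\<lambda>s. ((s - p) ^ k p * f s) * poly e s)"
      by blast
    moreover have "((\<lambda>s. ((s - p) ^ k p * f s) * poly e s) \<longlongrightarrow> c p * poly e p) (at p)"
      by (intro tendsto_mult k tendsto_poly[OF tendsto_ident_at])
    ultimately show ?thesis by metis
  qed
  have g_an: "g analytic_on UNIV"
    unfolding g_def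
  proof (rule nicely_meromorphic_without_singularities[OF remove_sings_nicely_meromorphic[OF mero_fd]])
    show "\<forall>z\<in>UNIV. \<not> is_pole (remove_sings (\<lambda>s. f s * poly d s)) z"
    proof
      fix z
      have "isolated_singularity_at (\<lambda>s. f s * poly d s) z"
        using mero_fd by (metis meromorphic_on_isolated_singularity UNIV_I meromorphic_on_subset subset_UNIV)
      moreover have "\<not> is_pole (\<lambda>s. f s * poly d s) z"
        using lim_fd[of z] by (metis at_neq_bot is_pole_def not_tendsto_and_filterlim_at_infinity)
      ultimately show "\<not> is_pole (remove_sings (\<lambda>s. f s * poly d s)) z"
        by simp
    qed
  qed
  have g_eq: "g s = f s * poly d s" if "s \<notin> S" for s
  proof -
    have "f analytic_on {s}"
      using that by (simp add: S_def)
    then have "(\<lambda>s. f s * poly d s) analytic_on {s}"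
      by (intro analytic_on_mult analytic_on_poly analytic_on_ident)
    then show ?thesis by (simp add: g_def)
  qed
  have "(\<lambda>t. g (1 / t)) meromorphic_on {0}"
  proof -
    obtain b where b: "\<And>s. s \<in> S \<Longrightarrow> norm s \<le> b"
      using finite_imp_bounded[OF fin] by (auto simp: bounded_iff)
    have "\<forall>\<^sub>F s in at_infinity. s \<notin> S"
      by (rule eventually_at_infinityI[of "b + 1"]) (use b in force)
    then have "\<forall>\<^sub>F t in at 0. 1 / t \<notin> S"
      using filterlim_inverse_at_infinity[where 'a = complex]
      by (auto simp: filterlim_iff inverse_eq_divide)
    then have "\<forall>\<^sub>F t in at 0. g (1 / t) = f (1 / t) * poly d (1 / t)"
      by eventually_elim (simp add: g_eq)
    moreover have "(\<lambda>t. f (1 / t) * poly d (1 / t)) meromorphic_on {0}"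
      unfolding poly_altdef
      by (intro meromorphic_intros inf meromorphic_on_divide meromorphic_on_id)
    ultimately show ?thesis
      using meromorphic_on_cong[of "{0}"] by fastforce
  qed
  from meromorphic_times_power_tendsto[OF this] obtain N c' where
    "((\<lambda>t. t ^ N * g (1 / t)) \<longlongrightarrow> c') (at 0)" by auto
  then obtain n where n: "\<And>z. g z = poly n z"
    using entire_meromorphic_at_infinity_is_poly[OF g_an] by metis
  show ?thesis
  proof (rule that[of d n])
    show "d \<noteq> 0"
      by (simp add: d_def fin)
    show "poly d s \<noteq> 0" if "f analytic_on {s}" for s
      using d_nz that by (simp add: S_def)
    show "f s = poly n s / poly d s" if "f analytic_on {s}" for s
      using g_eq[of s] n[of s] d_nz[of s] that by (simp add: S_def field_simps)
    show "finite {s. \<not> f analytic_on {s}}"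
      using fin by (simp add: S_def)
  qed
qed

section \<open>Coordinates are Moebius transformations\<close>

lemma nicely_meromorphic_on_shift_0:
  "f nicely_meromorphic_on {z} \<longleftrightarrow> (\<lambda>t. f (z + t)) nicely_meromorphic_on {0}"
proof -
  have "f \<midarrow>z\<rightarrow> f z \<longleftrightarrow> (\<lambda>t. f (z + t)) \<midarrow>0\<rightarrow> f z"
    using LIM_offset_zero[of f "f z" z] LIM_offset_zero_cancel[of f z "f z"] by blast
  moreover have "is_pole f z \<longleftrightarrow> is_pole (\<lambda>t. f (z + t)) 0"
    by (rule is_pole_shift_0)
  moreover have "f meromorphic_on {z} \<longleftrightarrow> (\<lambda>t. f (z + t)) meromorphic_on {0}"
    by (simp add: meromorphic_on_def)
  ultimately show ?thesis
    by (simp add: nicely_meromorphic_on_def)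
qed

lemma simple_pole_tendsto:
  assumes "isolated_singularity_at f p" "is_pole f p" "zorder f p = -1"
  obtains r where "r \<noteq> 0" "((\<lambda>w. (w - p) * f w) \<longlongrightarrow> r) (at p)"
proof -
  obtain e where e: "e > 0" "f holomorphic_on ball p e - {p}"
    using assms(1) analytic_imp_holomorphic unfolding isolated_singularity_at_def by blast
  obtain r where r: "r > 0" "zor_poly f p p \<noteq> 0" "zor_poly f p holomorphic_on cball p r"
    using zorder_exist_pole[OF e(2) _ _ assms(2)] e(1) by auto
  have "zor_poly f p \<midarrow>p\<rightarrow> zor_poly f p p"
    by (rule holomorphic_on_cball_tendsto[OF r(3,1)])
  moreover have "\<forall>\<^sub>F w in at p. zor_poly f p w = (w - p) * f w"
    using zor_poly_pole_eq[OF assms(1,2)] assms(3) by (simp add: mult.commute)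
  ultimately have "((\<lambda>w. (w - p) * f w) \<longlongrightarrow> zor_poly f p p) (at p)"
    by (rule Lim_transform_eventually)
  with r(2) show ?thesis by (rule that)
qed

text \<open>
  The leading coefficient is identified because it is the value, or the residue, of the coordinate at
  infinity.
\<close>

lemma entire_linear_growth_is_affine:
  assumes "f analytic_on UNIV" "((\<lambda>t. t * f (1 / t)) \<longlongrightarrow> c) (at 0)"
  obtains c0 where "\<And>z. f z = c * z + c0"
proof -
  obtain n where n: "degree n \<le> 1" "\<And>z. f z = poly n z"
    using entire_meromorphic_at_infinity_is_poly[OF assms(1), of 1 c] assms(2) by auto
  obtain c0 m where m: "n = pCons c0 m"
    by (cases n) auto
  have "degree m = 0"
    using n(1) by (auto simp: m split: if_splits)
  then obtain c1 where "m = [:c1:]"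
    by (auto elim: degree_eq_zeroE)
  then have f: "f z = c1 * z + c0" for z
    using n(2)[of z] by (simp add: m)
  have "((\<lambda>t. c1 + c0 * t) \<longlongrightarrow> c1 + c0 * 0) (at 0)"
    by (intro tendsto_intros)
  moreover have "\<forall>\<^sub>F t in at 0. c1 + c0 * t = t * f (1 / t)"
    by (auto simp: eventually_at_filter f field_simps)
  ultimately have "((\<lambda>t. t * f (1 / t)) \<longlongrightarrow> c1 + c0 * 0) (at 0)"
    by (rule Lim_transform_eventually)
  then have "c = c1 + c0 * 0"
    using assms(2) tendsto_unique[OF at_neq_bot] by blast
  with f show ?thesis
    by (intro that[of c0]) simp
qed

text \<open>
  The conventions \<open>x / 0 = 0\<close> and ``the value at a pole is 0'' agree, so that these formulas hold at
  all points, including the pole \<open>P\<close> of \<open>u\<close>.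
\<close>

locale moebius_coordinate =
  fixes u :: "pline \<Rightarrow> complex" and P :: pline and a b c d :: complex
  assumes det: "a * d - b * c \<noteq> 0"
    and u_Fin: "u (Fin w) = (a * w + b) / (c * w + d)"
    and u_Inf: "u Inf = a / c"
    and P_eq: "P = (if c = 0 then Inf else Fin (- d / c))"

text \<open>
  If the pole is at infinity, then \<open>u\<close> is entire of linear growth.  If it is at a finite \<open>p\<close>, the same
  holds for \<open>(w - p) u(w)\<close>, because \<open>u\<close> is finite at infinity.  The simple pole makes the determinant
  nonzero.
\<close>

theorem coordinate_is_moebius:
  assumes coord: "coordinate u P"
  obtains a b c d where "moebius_coordinate u P a b c d"
proof -
  define h where "h = (\<lambda>w. u (Fin w))"
  have chart_Fin: "u \<circ> chart (Fin w) = (\<lambda>t. h (w + t))" for w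
    by (auto simp: h_def)
  have chart_Inf: "u \<circ> chart Inf = (\<lambda>t. if t = 0 then u Inf else h (1 / t))"
    by (auto simp: h_def)
  have ev_Inf: "\<forall>\<^sub>F t in at 0. (u \<circ> chart Inf) t = h (1 / t)"
    by (auto simp: chart_Inf eventually_at_filter)
  have mero: "(u \<circ> chart p) nicely_meromorphic_on {0}" for p
    using coord by (simp add: coordinate_def mero_fun_def)
  have pole: "is_pole (u \<circ> chart p) 0 \<longleftrightarrow> p = P" for p
    using coord by (auto simp: coordinate_def)
  have iso: "isolated_singularity_at (u \<circ> chart p) 0" for p
    using mero[of p] by (simp add: nicely_meromorphic_on_def meromorphic_at_iff)
  have ord: "zorder (u \<circ> chart P) 0 = -1"
    using coord by (simp add: coordinate_def)
  have nice: "h nicely_meromorphic_on {w}" for w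
    using mero[of "Fin w"] by (simp only: nicely_meromorphic_on_shift_0[of h w] chart_Fin)
  have an: "h analytic_on {w}" if "Fin w \<noteq> P" for w
  proof (rule nicely_meromorphic_on_imp_analytic_at[OF nice])
    show "\<not> is_pole h w"
      using pole[of "Fin w"] that by (simp only: is_pole_shift_0[of h w] chart_Fin) auto
  qed auto
  obtain r where r: "r \<noteq> 0" "((\<lambda>t. (t - 0) * (u \<circ> chart P) t) \<longlongrightarrow> r) (at 0)"
    using simple_pole_tendsto[OF iso[of P] _ ord] pole by blast
  have lim0: "(\<lambda>t. t * (u \<circ> chart P) t) \<midarrow>0\<rightarrow> r"
    using r(2) by simp
  have at_P: "u P = 0"
  proof -
    have "is_pole (u \<circ> chart P) 0" using pole by blast
    then have "(u \<circ> chart P) 0 = 0"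
      using mero[of P] by (metis insertI1 remove_sings_at_pole remove_sings_eqI nicely_meromorphic_on_def)
    then show ?thesis by (cases P) auto
  qed
  show ?thesis
  proof (cases P)
    case Inf
    have "(\<lambda>t. t * h (1 / t)) \<midarrow>0\<rightarrow> r"
    proof (rule Lim_transform_eventually[OF lim0])
      show "\<forall>\<^sub>F t in at 0. t * (u \<circ> chart P) t = t * h (1 / t)"
        using ev_Inf unfolding Inf by eventually_elim (simp only:)
    qed
    moreover have "h analytic_on UNIV"
      using an Inf analytic_on_analytic_at by blast
    ultimately obtain c0 where h: "\<And>z. h z = r * z + c0"
      using entire_linear_growth_is_affine by blast
    have "moebius_coordinate u P r c0 0 1"
      by unfold_locales (use h at_P Inf r(1) in \<open>auto simp: h_def\<close>)
    then show ?thesis by (rule that)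
  next
    case (Fin p)
    define G where "G = remove_sings (\<lambda>w. (w - p) * h w)"
    have lim_p: "(\<lambda>w. (w - p) * h w) \<midarrow>p\<rightarrow> r"
      by (rule LIM_offset_zero_cancel) (use lim0 in \<open>simp add: Fin chart_Fin del: chart.simps\<close>)
    have G_eq: "G w = (w - p) * h w" if "w \<noteq> p" for w
      unfolding G_def
      by (intro remove_sings_at_analytic analytic_intros an) (use that Fin in auto)
    have iso_h: "isolated_singularity_at (\<lambda>w. (w - p) * h w) w" for w
      using nice[of w] 
      by (intro meromorphic_on_isolated_singularity[of _ w] meromorphic_intros)
        (auto simp: nicely_meromorphic_on_def)
    have "G analytic_on {w}" for w
    proof (cases "w = p")
      case True
      then show ?thesis
        unfolding G_def using remove_sings_analytic_at[OF iso_h lim_p] by simp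
    next
      case False
      then show ?thesis
        unfolding G_def by (intro remove_sings_analytic_on analytic_intros an) (use Fin in auto)
    qed
    then have "G analytic_on UNIV"
      using analytic_on_analytic_at by blast
    moreover have "(\<lambda>t. t * G (1 / t)) \<midarrow>0\<rightarrow> u Inf"
    proof -
      have "\<not> is_pole (u \<circ> chart Inf) 0"
        using pole[of Inf] Fin by auto
      then have "(u \<circ> chart Inf) \<midarrow>0\<rightarrow> (u \<circ> chart Inf) 0"
        using mero[of Inf] by (auto simp: nicely_meromorphic_on_def)
      then have "(\<lambda>t. h (1 / t)) \<midarrow>0\<rightarrow> u Inf"
        using Lim_transform_eventually[OF _ ev_Inf] by (simp add: chart_Inf)
      then have "(\<lambda>t. (1 - p * t) * h (1 / t)) \<midarrow>0\<rightarrow> (1 - p * 0) * u Inf"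
        by (intro tendsto_intros)
      then have "(\<lambda>t. (1 - p * t) * h (1 / t)) \<midarrow>0\<rightarrow> u Inf"
        by simp
      moreover have "\<forall>\<^sub>F t in at 0. (1 - p * t) * h (1 / t) = t * G (1 / t)"
      proof -
        have "(\<lambda>t. 1 - p * t) \<midarrow>0\<rightarrow> 1 - p * 0"
          by (intro tendsto_intros)
        then have "\<forall>\<^sub>F t in at 0. 1 - p * t \<noteq> 0"
          by (rule tendsto_imp_eventually_ne) simp
        moreover have "\<forall>\<^sub>F t in at 0. t \<noteq> (0::complex)"
          by (auto simp: eventually_at_filter)
        ultimately show ?thesis
        proof eventually_elim
          case (elim t)
          then have "1 / t \<noteq> p" by (auto simp: field_simps)
          then show ?case
            using elim by (simp add: G_eq field_simps)
        qed
      qed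
      ultimately show ?thesis
        using Lim_transform_eventually by fastforce
    qed
    ultimately obtain c0 where G: "\<And>z. G z = u Inf * z + c0"
      using entire_linear_growth_is_affine by blast
    have "G p = r"
      unfolding G_def using lim_p by (rule remove_sings_eqI)
    then have det: "u Inf * (- p) - c0 * 1 \<noteq> 0"
      using r(1) G[of p] by (auto simp: algebra_simps add_eq_0_iff2)
    have "u (Fin w) = (u Inf * w + c0) / (1 * w + - p)" for w
    proof (cases "w = p")
      case True then show ?thesis using at_P Fin by simp
    next
      case False
      then show ?thesis using G_eq[of w] G[of w] by (simp add: h_def field_simps)
    qed
    then have "moebius_coordinate u P (u Inf) c0 1 (- p)"
      by unfold_locales (use det Fin in auto)
    then show ?thesis by (rule that)
  qed
qed

section \<open>Forms near a point\<close>

text \<open>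
  The coefficient of order 0 of the Laurent expansion of \<open>f\<close> at \<open>s\<close>.  It extends the evaluation at \<open>s\<close>
  from functions regular at \<open>s\<close> to all meromorphic functions and stays linear.
\<close>

definition laurent_const :: "(complex \<Rightarrow> complex) \<Rightarrow> complex \<Rightarrow> complex" where
  "laurent_const f s = residue (\<lambda>t. f t / (t - s)) s"

lemma laurent_const_analytic:
  assumes "f analytic_on {s}"
  shows "laurent_const f s = f s"
proof -
  obtain A where "open A" "s \<in> A" "f holomorphic_on A"
    using assms by (auto simp: analytic_at)
  then show ?thesis
    unfolding laurent_const_def by (rule residue_simple)
qed

lemma laurent_const_lin_comb:
  assumes "f meromorphic_on {s}" "g meromorphic_on {s}"
    and "\<forall>\<^sub>F t in at s. h t = x * f t + y * g t"
  shows "laurent_const h s = x * laurent_const f s + y * laurent_const g s"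
proof -
  let ?F = "\<lambda>t. f t / (t - s)" and ?G = "\<lambda>t. g t / (t - s)"
  have "?F meromorphic_on {s}" "?G meromorphic_on {s}"
    by (intro meromorphic_intros assms)+
  then have "isolated_singularity_at ?F s" "isolated_singularity_at ?G s"
    by (auto simp: meromorphic_at_iff)
  then obtain q r where "q > 0" "?F analytic_on ball s q - {s}" "r > 0" "?G analytic_on ball s r - {s}"
    by (auto simp: isolated_singularity_at_def)
  moreover define e where "e = min q r"
  ultimately have hol: "?F holomorphic_on ball s e - {s}" "?G holomorphic_on ball s e - {s}"
      and pos: "e > 0"
    by (auto intro!: analytic_imp_holomorphic elim!: analytic_on_subset)
  have "\<forall>\<^sub>F t in at s. h t / (t - s) = x * ?F t + y * ?G t"
    using assms(3) by eventually_elim (simp add: add_divide_distrib)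
  then have "laurent_const h s = residue (\<lambda>t. x * ?F t + y * ?G t) s"
    unfolding laurent_const_def by (intro residue_cong) auto
  also have "\<dots> = residue (\<lambda>t. x * ?F t) s + residue (\<lambda>t. y * ?G t) s"
    by (rule residue_add[OF open_ball _ holomorphic_on_mult[OF holomorphic_on_const hol(1)]
          holomorphic_on_mult[OF holomorphic_on_const hol(2)]]) (use pos in simp)
  also have "residue (\<lambda>t. x * ?F t) s = x * laurent_const f s"
    unfolding laurent_const_def by (rule residue_lmul[OF _ _ hol(1)]) (use pos in auto)
  also have "residue (\<lambda>t. y * ?G t) s = y * laurent_const g s"
    unfolding laurent_const_def by (rule residue_lmul[OF _ _ hol(2)]) (use pos in auto)
  finally show ?thesis .
qed

text \<open>
  The local shape of the forms \<open>du / (u - e) ^ k\<close>.  At a pole (\<open>B = 0\<close>) the residue vanishes because a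
  constant times a power of \<open>(C t + D) / (A t)\<close> is a primitive on the punctured plane, so the integral over a circle is 0.
\<close>

lemma moebius_power_residue:
  fixes A B C D K :: complex
  assumes det: "D * A - C * B \<noteq> 0" and k: "k \<ge> 2" and K: "K \<noteq> 0"
  defines "f \<equiv> \<lambda>t. K * (C * t + D) ^ (k - 2) / (A * t + B) ^ k"
  shows "f nicely_meromorphic_on {0}" "residue f 0 = 0" "B \<noteq> 0 \<Longrightarrow> f analytic_on {0}"
proof -
  show an: "f analytic_on {0}" if "B \<noteq> 0"
    unfolding f_def by (intro analytic_intros) (use that in auto)
  have "f nicely_meromorphic_on {0} \<and> residue f 0 = 0"
  proof (cases "B = 0")
    case False
    then obtain S where "open S" "0 \<in> S" "f holomorphic_on S"
      using an by (auto simp: analytic_at)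
    then have "residue f 0 = 0"
      by (rule residue_holo)
    with an False show ?thesis
      by (auto intro: analytic_on_imp_nicely_meromorphic_on)
  next
    case True
    have A: "A \<noteq> 0" and D: "D \<noteq> 0" using det True by auto
    have hol: "f holomorphic_on UNIV - {0}"
      unfolding f_def by (intro holomorphic_intros) (use True A in auto)
    have "is_pole (\<lambda>t. (K * (C * t + D) ^ (k - 2) / A ^ k) / t ^ k) 0"
      by (rule is_pole_basic'[of _ UNIV]) (use K A D k in \<open>auto intro!: holomorphic_intros\<close>)
    then have pole: "is_pole f 0"
      by (simp add: f_def True power_mult_distrib)
    have "f meromorphic_on {0}"
      unfolding f_def by (intro meromorphic_intros meromorphic_on_divide meromorphic_on_id)
    moreover have "f 0 = 0"
      using k by (simp add: f_def True power_0_left)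
    ultimately have "f nicely_meromorphic_on {0}"
      using pole by (simp add: nicely_meromorphic_on_def)
    moreover have "residue f 0 = 0"
    proof -
      \<comment> \<open>A primitive, using that the derivative of \<open>(C t + D) / (A t)\<close> is \<open>- D A / (A t)\<^sup>2\<close>.\<close>
      define F where "F = (\<lambda>t. - K / ((of_nat k - 1) * (D * A)) * ((C * t + D) / (A * t)) ^ (k - 1))"
      have F: "(F has_field_derivative f t) (at t within UNIV - {0})" if "t \<in> UNIV - {0}" for t
      proof -
        have t: "t \<noteq> 0" using that by simp
        define q where "q = (C * t + D) / (A * t)"
        have k1: "of_nat k - 1 = (of_nat (k - 1) :: complex)" "of_nat (k - 1) \<noteq> (0::complex)"
          using k by (auto simp: of_nat_diff)
        have dq: "((\<lambda>t. (C * t + D) / (A * t)) has_field_derivative (- (D * A) / (A * t) ^ 2)) (at t)"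
          by (rule derivative_eq_intros refl | use t A in \<open>simp add: power2_eq_square field_simps\<close>)+
        have "(F has_field_derivative (- K / ((of_nat k - 1) * (D * A)) *
            (of_nat (k - 1) * (- (D * A) / (A * t) ^ 2) * q ^ (k - 1 - 1)))) (at t)"
          unfolding F_def q_def
          by (rule DERIV_cmult, rule DERIV_chain'[OF dq, of "\<lambda>x. x ^ (k - 1)", THEN DERIV_cong])
             (auto intro!: derivative_eq_intros)
        also have "- K / ((of_nat k - 1) * (D * A)) *
            (of_nat (k - 1) * (- (D * A) / (A * t) ^ 2) * q ^ (k - 1 - 1)) = K * q ^ (k - 2) / (A * t) ^ 2"
        proof -
          have "- K / (n * X) * (n * (- X / Y) * Q) = K * Q / Y" if "n \<noteq> 0" "X \<noteq> 0" for n X Y Q :: complex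
            using that by simp
          moreover have "k - 1 - 1 = k - 2" by simp
          ultimately show ?thesis
            unfolding k1(1) using k1(2) A D by (metis mult_eq_0_iff)
        qed
        also have "\<dots> = f t"
        proof -
          have "(A * t) ^ k = (A * t) ^ (k - 2) * (A * t) ^ 2"
            using k by (metis le_add_diff_inverse2 power_add)
          then show ?thesis
            by (simp add: f_def q_def True power_divide)
        qed
        finally show ?thesis
          by (rule has_field_derivative_at_within)
      qed
      have "(f has_contour_integral 2 * pi * \<i> * residue f 0) (circlepath 0 1)"
        by (rule base_residue[OF _ _ _ hol]) auto
      moreover have "(f has_contour_integral (F (pathfinish (circlepath 0 1)) - F (pathstart (circlepath 0 1)))) (circlepath 0 1)"
        by (rule contour_integral_primitive[of "UNIV - {0}"]) (use F in auto)
      ultimately show ?thesis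
        using has_contour_integral_unique by fastforce
    qed
    ultimately show ?thesis by blast
  qed
  then show "f nicely_meromorphic_on {0}" "residue f 0 = 0" by auto
qed

lemma form_local_meromorphic: "form_local (form_val \<alpha>) p nicely_meromorphic_on {0}"
  using form_val[of \<alpha>] by (simp add: mero_form_def)

lemma form_local_meromorphic': "form_local (form_val \<alpha>) p meromorphic_on {0}"
  using form_local_meromorphic[of \<alpha> p] by (simp add: nicely_meromorphic_on_def)

lemma form_local_0: "form_local \<alpha> p 0 = \<alpha> p"
  by (cases p) auto

lemma form_local_analytic:
  "regular \<alpha> p \<Longrightarrow> form_local (form_val \<alpha>) p analytic_on {0}"
  unfolding regular_def by (rule nicely_meromorphic_on_imp_analytic_at[OF form_local_meromorphic]) auto

text \<open>
  The coefficient of the form in the affine variable is meromorphic on the sphere, so it has finitely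
  many singular points.
\<close>

lemma finite_not_regular: "finite {p. \<not> regular \<alpha> p}"
proof -
  define h where "h = (\<lambda>w. form_val \<alpha> (Fin w))"
  have shift: "form_local (form_val \<alpha>) (Fin w) = (\<lambda>t. h (w + t))" for w
    by (auto simp: h_def)
  have "h nicely_meromorphic_on {w}" for w
    using form_local_meromorphic[of \<alpha> "Fin w"] by (simp only: nicely_meromorphic_on_shift_0[of h w] shift)
  then have h: "h meromorphic_on UNIV"
    using meromorphic_on_meromorphic_at[of h UNIV] by (auto simp: nicely_meromorphic_on_def)
  have "(\<lambda>t. - (t ^ 2) * form_local (form_val \<alpha>) Inf t) meromorphic_on {0}"
    by (intro meromorphic_on_mult meromorphic_on_uminus meromorphic_on_power meromorphic_on_id form_local_meromorphic')
  also have "?this \<longleftrightarrow> (\<lambda>t. h (1 / t)) meromorphic_on {0}"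
    by (rule meromorphic_on_cong) (auto simp: eventually_at_filter h_def)
  finally have "finite {s. \<not> h analytic_on {s}}"
    using meromorphic_on_sphere_imp_rational[OF h] by blast
  moreover have "{p. \<not> regular \<alpha> p} \<subseteq> insert Inf (Fin ` {s. \<not> h analytic_on {s}})"
  proof
    fix p assume p: "p \<in> {p. \<not> regular \<alpha> p}"
    show "p \<in> insert Inf (Fin ` {s. \<not> h analytic_on {s}})"
    proof (cases p)
      case (Fin w)
      then have "is_pole h w"
        using p by (simp add: regular_def shift is_pole_shift_0[of h w])
      then show ?thesis
        using Fin analytic_at_imp_no_pole by blast
    qed auto
  qed
  ultimately show ?thesis
    by (meson finite.insertI finite_imageI finite_subset)
qed

section \<open>Forms in terms of a coordinate\<close>

lemma isCont_imp_eventually_nonzero: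
  fixes f :: "complex \<Rightarrow> complex"
  assumes "isCont f s" "f s \<noteq> 0"
  shows "\<forall>\<^sub>F t in nhds s. f t \<noteq> 0"
  using tendsto_imp_eventually_ne[OF isContD[OF assms(1)] assms(2)] assms(2)
  by (simp add: eventually_nhds_conv_at)

lemma form_local_compose_meromorphic:
  assumes "\<phi> analytic_on {s}" "\<phi> s = 0" "\<eta> analytic_on {s}"
  shows "(\<lambda>t. form_local (form_val \<alpha>) p (\<phi> t) * \<eta> t) meromorphic_on {s}"
  by (intro meromorphic_on_mult meromorphic_on_compose[OF form_local_meromorphic' assms(1)]
      analytic_on_imp_meromorphic_on assms(3)) (use assms(2) in simp)

context moebius_coordinate
begin

text \<open>
  The inverse of \<open>u\<close> on the complement of \<open>P\<close>.
\<close>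

definition psi :: "complex \<Rightarrow> pline" where
  "psi s = (if a - c * s = 0 then Inf else Fin ((d * s - b) / (a - c * s)))"

lemma psi_Inf:
  assumes "a - c * s = 0"
  shows "psi s = Inf"
  unfolding psi_def by (rule if_P[OF assms])

lemma denom_psi:
  assumes "a - c * s \<noteq> 0"
  shows "c * ((d * s - b) / (a - c * s)) + d = (a * d - b * c) / (a - c * s)"
  using assms by (simp add: field_simps)

lemma u_psi: "u (psi s) = s"
proof (cases "a - c * s = 0")
  case True
  then have a: "a = c * s" by simp
  then have "c \<noteq> 0" using det by auto
  then have "a / c = s" by (simp add: a)
  then show ?thesis by (simp only: psi_Inf[OF True] u_Inf)
next
  case False
  have num: "a * ((d * s - b) / (a - c * s)) + b = s * ((a * d - b * c) / (a - c * s))"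
    using False by (simp add: field_simps)
  have "psi s = Fin ((d * s - b) / (a - c * s))"
    using False by (simp add: psi_def)
  then show ?thesis
    using False det by (simp only: u_Fin denom_psi[OF False] num) simp
qed

lemma psi_ne_P: "psi s \<noteq> P"
proof (cases "a - c * s = 0")
  case True
  then have "c \<noteq> 0" using det by auto
  then show ?thesis by (simp add: psi_Inf[OF True] P_eq)
next
  case False
  show ?thesis
  proof
    assume "psi s = P"
    then have "c \<noteq> 0" "(d * s - b) / (a - c * s) = - d / c"
      using False by (auto simp: psi_def P_eq split: if_splits)
    then have "c * ((d * s - b) / (a - c * s)) + d = 0" by simp
    then show False
      using denom_psi[OF False] det False by simp
  qed
qed

lemma Fin_ne_P: "Fin w \<noteq> P \<longleftrightarrow> c * w + d \<noteq> 0"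
  using det by (auto simp: P_eq field_simps add_eq_0_iff2)

lemma Inf_ne_P: "Inf \<noteq> P \<longleftrightarrow> c \<noteq> 0"
  by (auto simp: P_eq)

lemma psi_u:
  assumes "z \<noteq> P"
  shows "psi (u z) = z"
proof (cases z)
  case (Fin w)
  then have w: "c * w + d \<noteq> 0" using assms Fin_ne_P by simp
  have "a - c * u z = (a * d - b * c) / (c * w + d)" "d * u z - b = w * (a * d - b * c) / (c * w + d)"
    using w by (simp_all add: Fin u_Fin field_simps)
  then show ?thesis
    using w det by (simp add: psi_def Fin)
next
  case Inf
  then show ?thesis using assms Inf_ne_P by (simp add: psi_def u_Inf)
qed

lemma du_Fin:
  assumes "c * w + d \<noteq> 0"
  shows "du u (Fin w) = (a * d - b * c) / (c * w + d)\<^sup>2"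
proof -
  have "((\<lambda>t. (a * (w + t) + b) / (c * (w + t) + d)) has_field_derivative
      (a * (c * w + d) - (a * w + b) * c) / (c * w + d)\<^sup>2) (at 0)"
    by (rule derivative_eq_intros refl | use assms in \<open>simp add: power2_eq_square\<close>)+
  moreover have "u \<circ> chart (Fin w) = (\<lambda>t. (a * (w + t) + b) / (c * (w + t) + d))"
    by (auto simp: u_Fin)
  moreover have "a * (c * w + d) - (a * w + b) * c = a * d - b * c"
    by (simp add: algebra_simps)
  ultimately show ?thesis
    unfolding du_def by (simp add: DERIV_imp_deriv)
qed

lemma du_Inf:
  assumes "c \<noteq> 0"
  shows "du u Inf = - (a * d - b * c) / c\<^sup>2"
proof -
  have "((\<lambda>t. (a + b * t) / (c + d * t)) has_field_derivative (b * c - a * d) / c\<^sup>2) (at 0)"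
    by (rule derivative_eq_intros refl | use assms in \<open>simp add: power2_eq_square\<close>)+
  moreover have "u \<circ> chart Inf = (\<lambda>t. (a + b * t) / (c + d * t))"
  proof
    fix t
    show "(u \<circ> chart Inf) t = (a + b * t) / (c + d * t)"
    proof (cases "t = 0")
      case False
      then have "(a / t + b) / (c / t + d) = ((a / t + b) * t) / ((c / t + d) * t)" by simp
      then show ?thesis using False by (simp add: u_Fin algebra_simps)
    qed (simp add: u_Inf)
  qed
  ultimately show ?thesis
    unfolding du_def by (simp add: DERIV_imp_deriv)
qed

definition coef_fun :: "kform \<Rightarrow> complex \<Rightarrow> complex" where
  "coef_fun \<alpha> s = coef u \<alpha> (psi s)"

lemma coef_fun_eq:
  assumes "a - c * s \<noteq> 0"
  shows "coef_fun \<alpha> s = form_val \<alpha> (Fin ((d * s - b) / (a - c * s))) * (a * d - b * c) / (a - c * s)\<^sup>2"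
proof -
  define w where "w = (d * s - b) / (a - c * s)"
  have w: "c * w + d = (a * d - b * c) / (a - c * s)"
    unfolding w_def by (rule denom_psi[OF assms])
  then have "c * w + d \<noteq> 0" using det assms by simp
  then have "coef_fun \<alpha> s = form_val \<alpha> (Fin w) / ((a * d - b * c) / (c * w + d)\<^sup>2)"
    using assms by (simp add: coef_fun_def coef_def psi_def du_Fin flip: w_def)
  also have "\<dots> = form_val \<alpha> (Fin w) * (a * d - b * c) / (a - c * s)\<^sup>2"
  proof -
    have "F / (D / (D / x)\<^sup>2) = F * D / x\<^sup>2" if "D \<noteq> 0" for F D x :: complex
      using that by (simp add: power2_eq_square)
    then show ?thesis unfolding w using det by blast
  qed
  finally show ?thesis by (simp add: w_def)
qed

text \<open>
  Near any finite value \<open>s0\<close> of the coordinate, passing from the parameter of the chart to \<open>u\<close> is an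
  analytic change of variables, the same for all forms.  The two cases are a finite point and the point
  at infinity.  Equality is claimed at \<open>s0\<close> itself too, so that values at regular points are kept.
\<close>

lemma coef_fun_local:
  obtains \<phi> \<eta> where "\<phi> analytic_on {s0}" "\<eta> analytic_on {s0}" "\<phi> s0 = 0"
    "\<And>\<alpha>. \<forall>\<^sub>F s in nhds s0. coef_fun \<alpha> s = form_local (form_val \<alpha>) (psi s0) (\<phi> s) * \<eta> s"
proof (cases "a - c * s0 = 0")
  case False
  define w0 where "w0 = (d * s0 - b) / (a - c * s0)"
  show ?thesis
  proof (rule that[of "\<lambda>s. (d * s - b) / (a - c * s) - w0" "\<lambda>s. (a * d - b * c) / (a - c * s)\<^sup>2"])
    have "isCont (\<lambda>s. a - c * s) s0" by (intro continuous_intros)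
    then have ev: "\<forall>\<^sub>F s in nhds s0. a - c * s \<noteq> 0"
      by (rule isCont_imp_eventually_nonzero) (use False in simp)
    show "\<forall>\<^sub>F s in nhds s0. coef_fun \<alpha> s = form_local (form_val \<alpha>) (psi s0)
        ((d * s - b) / (a - c * s) - w0) * ((a * d - b * c) / (a - c * s)\<^sup>2)" for \<alpha>
      using ev by eventually_elim (use False in \<open>simp add: coef_fun_eq psi_def flip: w0_def\<close>)
  qed (use False in \<open>auto intro!: analytic_intros simp: w0_def\<close>)
next
  case True
  then have c: "c \<noteq> 0" and s0: "s0 = a / c" using det by (auto simp: field_simps)
  have ds: "d * s0 - b = (a * d - b * c) / c" using c by (simp add: s0 field_simps)
  then have ds0: "d * s0 - b \<noteq> 0" using det c by simp
  show ?thesis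
  proof (rule that[of "\<lambda>s. (a - c * s) / (d * s - b)" "\<lambda>s. - (a * d - b * c) / (d * s - b)\<^sup>2"])
    have "isCont (\<lambda>s. d * s - b) s0" by (intro continuous_intros)
    then have ev: "\<forall>\<^sub>F s in nhds s0. d * s - b \<noteq> 0"
      by (rule isCont_imp_eventually_nonzero) (use ds0 in simp)
    show "\<forall>\<^sub>F s in nhds s0. coef_fun \<alpha> s = form_local (form_val \<alpha>) (psi s0)
        ((a - c * s) / (d * s - b)) * (- (a * d - b * c) / (d * s - b)\<^sup>2)" for \<alpha>
      using ev
    proof eventually_elim
      case (elim s)
      have psi: "psi s0 = Inf" by (rule psi_Inf[OF True])
      show ?case
      proof (cases "a - c * s = 0")
        case True
        then have s: "s = s0" using c by (simp add: s0 field_simps)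
        have "F / (- D / c\<^sup>2) = F * (- D / (D / c)\<^sup>2)" if "D \<noteq> 0" for F D :: complex
          using that c by (simp add: power2_eq_square)
        note * = this[OF det]
        show ?thesis
          unfolding s coef_fun_def coef_def psi du_Inf[OF c] ds \<open>a - c * s0 = 0\<close>
          using * by (simp only: div_0 form_local_0)
      next
        case False
        show ?thesis
        proof -
          have scaling: "F * D / x\<^sup>2 = - F / (x / y)\<^sup>2 * (- D / y\<^sup>2)" if "y \<noteq> 0" for F D x y :: complex
            using that by (simp add: power2_eq_square)
          have ne: "(a - c * s) / (d * s - b) \<noteq> 0"
            using False elim by simp
          have inv: "1 / ((a - c * s) / (d * s - b)) = (d * s - b) / (a - c * s)"
            by simp
          show ?thesis
            unfolding psi coef_fun_eq[OF False] form_local.simps if_not_P[OF ne] inv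
            by (rule scaling[OF elim])
        qed
      qed
    qed
  qed (use True ds0 in \<open>auto intro!: analytic_intros\<close>)
qed

lemma coef_fun_meromorphic: "coef_fun \<alpha> meromorphic_on {s}"
proof -
  obtain \<phi> \<eta> where *: "\<phi> analytic_on {s}" "\<eta> analytic_on {s}" "\<phi> s = 0"
    "\<forall>\<^sub>F t in nhds s. coef_fun \<alpha> t = form_local (form_val \<alpha>) (psi s) (\<phi> t) * \<eta> t"
    using coef_fun_local[of s] by metis
  have "(\<lambda>t. form_local (form_val \<alpha>) (psi s) (\<phi> t) * \<eta> t) meromorphic_on {s}"
    by (rule form_local_compose_meromorphic[OF *(1,3,2)])
  also have "?this \<longleftrightarrow> coef_fun \<alpha> meromorphic_on {s}"
    using *(4) by (intro meromorphic_on_cong) (auto simp: eventually_at_filter elim!: eventually_mono)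
  finally show ?thesis .
qed

lemma coef_fun_analytic:
  assumes "regular \<alpha> (psi s)"
  shows "coef_fun \<alpha> analytic_on {s}"
proof -
  obtain \<phi> \<eta> where *: "\<phi> analytic_on {s}" "\<eta> analytic_on {s}" "\<phi> s = 0"
    "\<forall>\<^sub>F t in nhds s. coef_fun \<alpha> t = form_local (form_val \<alpha>) (psi s) (\<phi> t) * \<eta> t"
    using coef_fun_local[of s] by metis
  have "(form_local (form_val \<alpha>) (psi s) \<circ> \<phi>) analytic_on {s}"
    by (rule analytic_on_compose[OF *(1)]) (use *(3) form_local_analytic[OF assms] in simp)
  then have "(\<lambda>t. form_local (form_val \<alpha>) (psi s) (\<phi> t) * \<eta> t) analytic_on {s}"
    by (intro analytic_on_mult *(2)) (simp add: o_def)
  then show ?thesis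
    using analytic_at_cong[OF *(4) refl] by simp
qed

text \<open>
  Large values of \<open>u\<close> correspond to points near \<open>P\<close>, which is \<open>- d / c\<close> or infinity.
\<close>

lemma coef_fun_meromorphic_at_infinity: "(\<lambda>t. coef_fun \<alpha> (1 / t)) meromorphic_on {0}"
proof -
  have ne0: "\<forall>\<^sub>F t in at 0. t \<noteq> (0::complex)" by (simp add: eventually_at_filter)
  have lin_ne: "\<forall>\<^sub>F t in at 0. x + y * t \<noteq> 0" if "x \<noteq> 0" for x y :: complex
  proof -
    have "(\<lambda>t. x + y * t) \<midarrow>0\<rightarrow> x + y * 0" by (intro tendsto_intros)
    then show ?thesis by (rule tendsto_imp_eventually_ne) (use that in simp)
  qed
  show ?thesis
  proof (cases "c = 0")
    case False
    define \<phi> where "\<phi> = (\<lambda>t. (d - b * t) / (a * t - c) - (- d / c))"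
    have "\<phi> analytic_on {0}"
      unfolding \<phi>_def by (intro analytic_intros) (use False in auto)
    moreover have "\<phi> 0 = 0" by (simp add: \<phi>_def)
    ultimately have "(\<lambda>t. form_local (form_val \<alpha>) (Fin (- d / c)) (\<phi> t) * ((a * d - b * c) * t\<^sup>2 / (a * t - c)\<^sup>2)) meromorphic_on {0}"
      by (rule form_local_compose_meromorphic) (use False in \<open>auto intro!: analytic_intros\<close>)
    also have "?this \<longleftrightarrow> (\<lambda>t. coef_fun \<alpha> (1 / t)) meromorphic_on {0}"
    proof (rule meromorphic_on_cong)
      have "\<forall>\<^sub>F t in at 0. - c + a * t \<noteq> 0" by (rule lin_ne) (use False in simp)
      then have "\<forall>\<^sub>F t in at 0. form_local (form_val \<alpha>) (Fin (- d / c)) (\<phi> t) * ((a * d - b * c) * t\<^sup>2 / (a * t - c)\<^sup>2) =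
          coef_fun \<alpha> (1 / t)"
        using ne0
      proof eventually_elim
        case (elim t)
        then have ne: "a * t - c \<noteq> 0" by (simp add: algebra_simps)
        have eq: "a - c * (1 / t) = (a * t - c) / t" "d * (1 / t) - b = (d - b * t) / t"
          using elim by (simp_all add: field_simps)
        then have "a - c * (1 / t) \<noteq> 0" using ne elim by simp
        from coef_fun_eq[OF this, of \<alpha>] show ?case
          unfolding eq using elim ne by (simp add: \<phi>_def power_divide)
      qed
      then show "\<forall>\<^sub>F t in at z. form_local (form_val \<alpha>) (Fin (- d / c)) (\<phi> t) * ((a * d - b * c) * t\<^sup>2 / (a * t - c)\<^sup>2) =
          coef_fun \<alpha> (1 / t)" if "z \<in> {0}" for z
        using that by (simp del: form_local.simps)
    qed auto
    finally show ?thesis .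
  next
    case True
    then have a: "a \<noteq> 0" and d: "d \<noteq> 0" using det by auto
    define \<phi> where "\<phi> = (\<lambda>t. a * t / (d - b * t))"
    have \<phi>: "\<phi> analytic_on {0}"
      unfolding \<phi>_def by (intro analytic_intros) (use d in auto)
    have \<phi>0: "\<phi> 0 = 0" by (simp add: \<phi>_def)
    have "(\<lambda>t. form_local (form_val \<alpha>) Inf (\<phi> t) * (- ((\<phi> t)\<^sup>2 * (d / a)))) meromorphic_on {0}"
      by (rule form_local_compose_meromorphic[OF \<phi> \<phi>0]) (use a \<phi> in \<open>auto intro!: analytic_intros\<close>)
    also have "?this \<longleftrightarrow> (\<lambda>t. coef_fun \<alpha> (1 / t)) meromorphic_on {0}"
    proof (rule meromorphic_on_cong)
      have "\<forall>\<^sub>F t in at 0. d + (- b) * t \<noteq> 0" using lin_ne[of d "- b"] d by blast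
      then have "\<forall>\<^sub>F t in at 0. form_local (form_val \<alpha>) Inf (\<phi> t) * (- ((\<phi> t)\<^sup>2 * (d / a))) =
          coef_fun \<alpha> (1 / t)"
        using ne0
      proof eventually_elim
        case (elim t)
        then have ne: "d - b * t \<noteq> 0" "\<phi> t \<noteq> 0" using a by (auto simp: \<phi>_def)
        have eq: "(d * (1 / t) - b) / (a - c * (1 / t)) = 1 / \<phi> t"
          using elim a ne True by (simp add: field_simps \<phi>_def)
        have "a - c * (1 / t) \<noteq> 0" using True a by simp
        from coef_fun_eq[OF this, of \<alpha>] show ?case
          unfolding eq using elim ne a True by (simp add: power2_eq_square)
      qed
      then show "\<forall>\<^sub>F t in at z. form_local (form_val \<alpha>) Inf (\<phi> t) * (- ((\<phi> t)\<^sup>2 * (d / a))) =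
          coef_fun \<alpha> (1 / t)" if "z \<in> {0}" for z
        using that by (simp del: form_local.simps)
    qed auto
    finally show ?thesis .
  qed
qed

text \<open>
  In the affine variable, \<open>C du / (u - e) ^ k\<close> is an explicit quotient of powers of linear functions
  (\<open>\<beta>\<close> below); for \<open>k \<ge> 2\<close> it has no pole at \<open>P\<close>.  The division conventions give \<open>\<beta>\<close> the value 0 at
  its pole, so it is literally a representative of a form.
\<close>

lemma pform_moebius:
  fixes e :: complex
  assumes k: "k \<ge> 2" and C: "C \<noteq> 0"
  defines "\<kappa> \<equiv> Abs_kform (\<lambda>p. remove_sings (form_local (\<lambda>q. C * du u q / (u q - e) ^ k) p) 0)"
  assumes z: "z \<noteq> P" "u z \<noteq> e"
  shows "regular \<kappa> z" "coef u \<kappa> z = C / (u z - e) ^ k"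
proof -
  define A where "A = a - e * c"
  define B where "B = b - e * d"
  define K where "K = C * (a * d - b * c)"
  have K: "K \<noteq> 0" using C det by (simp add: K_def)
  have detAB: "d * A - c * B \<noteq> 0"
    using det by (simp add: A_def B_def algebra_simps)
  \<comment> \<open>The form in the affine variable, and its expressions \<open>R p\<close> in the charts.\<close>
  define \<beta> where "\<beta> p = (case p of Fin w \<Rightarrow> K * (c * w + d) ^ (k - 2) / (A * w + B) ^ k
     | Inf \<Rightarrow> - K * c ^ (k - 2) / A ^ k)" for p
  define R where "R = (\<lambda>p t. case p of 
      Fin w \<Rightarrow> K * (c * t + (c * w + d)) ^ (k - 2) / (A * t + (A * w + B)) ^ k
    | Inf \<Rightarrow> - K * (d * t + c) ^ (k - 2) / (B * t + A) ^ k)"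
  have local_\<beta>: "form_local \<beta> p = R p" for p
  proof
    fix t show "form_local \<beta> p t = R p t"
    proof (cases p)
      case (Fin w) then show ?thesis by (simp add: \<beta>_def R_def algebra_simps)
    next
      case Inf
      show ?thesis
      proof (cases "t = 0")
        case True then show ?thesis by (simp add: \<beta>_def R_def Inf)
      next
        case False
        obtain m where m: "k = m + 2" using k by (metis add.commute le_Suc_ex)
        have "c * (1 / t) + d = (d * t + c) / t" "A * (1 / t) + B = (B * t + A) / t"
          using False by (simp_all add: field_simps)
        then show ?thesis
          using False by (simp add: \<beta>_def R_def Inf m power_divide power_add power2_eq_square)
      qed
    qed
  qed
  have R: "R p nicely_meromorphic_on {0}" "residue (R p) 0 = 0" for p
  proof -
    have "R p nicely_meromorphic_on {0} \<and> residue (R p) 0 = 0"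
    proof (cases p)
      case (Fin w)
      have "(c * w + d) * A - c * (A * w + B) \<noteq> 0" using detAB by (simp add: algebra_simps)
      from moebius_power_residue(1,2)[OF this k K] show ?thesis
        by (simp add: R_def Fin)
    next
      case Inf
      have "c * B - d * A \<noteq> 0" using detAB by (simp add: algebra_simps)
      from moebius_power_residue(1,2)[OF this k, of "- K"] K show ?thesis
        by (simp add: R_def Inf)
    qed
    then show "R p nicely_meromorphic_on {0}" "residue (R p) 0 = 0" by auto
  qed
  have quotient: "C * (D / X\<^sup>2) / (Y / X) ^ k = C * D * X ^ (k - 2) / Y ^ k" if "X \<noteq> 0" for D X Y :: complex
  proof -
    have "X ^ k = X ^ (k - 2) * X\<^sup>2"
      using k by (metis le_add_diff_inverse2 power_add)
    then show ?thesis
      using that by (simp add: power_divide)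
  qed
  have \<beta>_eq: "C * du u q / (u q - e) ^ k = \<beta> q" if "q \<noteq> P" for q
  proof (cases q)
    case (Fin w)
    then have w: "c * w + d \<noteq> 0" using that Fin_ne_P by simp
    have ue: "u q - e = (A * w + B) / (c * w + d)"
      using w by (simp add: Fin u_Fin A_def B_def field_simps)
    show ?thesis
      unfolding ue using quotient[OF w] w by (simp add: Fin \<beta>_def K_def du_Fin)
  next
    case Inf
    then have c: "c \<noteq> 0" using that Inf_ne_P by simp
    have ue: "u q - e = A / c" using c by (simp add: Inf u_Inf A_def field_simps)
    show ?thesis
      unfolding ue by (simp only: Inf \<beta>_def K_def du_Inf[OF c] pline.case quotient[OF c] mult_minus_right)
  qed
  have ev: "\<forall>\<^sub>F t in at 0. form_local (\<lambda>q. C * du u q / (u q - e) ^ k) p t = R p t" for p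
  proof (cases p)
    case (Fin w)
    have "\<forall>\<^sub>F t in at 0. Fin (w + t) \<noteq> P"
    proof (cases P)
      case (Fin p0)
      then show ?thesis
        using eventually_neq_at_within[of "p0 - w" 0 UNIV] by (auto elim!: eventually_mono)
    qed auto
    then show ?thesis
    proof eventually_elim
      case (elim t)
      then show ?case
        using \<beta>_eq[OF elim] by (simp add: Fin flip: local_\<beta>)
    qed
  next
    case Inf
    have "\<forall>\<^sub>F t in at 0. Fin (1 / t) \<noteq> P"
    proof (cases P)
      case (Fin p0)
      show ?thesis
        using eventually_neq_at_within[of "1 / p0" 0 UNIV] by eventually_elim (auto simp: Fin)
    qed auto
    moreover have "\<forall>\<^sub>F t in at 0. t \<noteq> (0::complex)" by (simp add: eventually_at_filter)
    ultimately show ?thesis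
    proof eventually_elim
      case (elim t)
      then show ?case
        using \<beta>_eq[OF elim(1)] by (simp add: Inf flip: local_\<beta>)
    qed
  qed
  have "remove_sings (form_local (\<lambda>q. C * du u q / (u q - e) ^ k) p) 0 = \<beta> p" for p
  proof -
    have "remove_sings (form_local (\<lambda>q. C * du u q / (u q - e) ^ k) p) 0 = remove_sings (R p) 0"
      using ev by (intro remove_sings_cong) auto
    also have "\<dots> = R p 0"
      using R(1)[of p] by (auto simp: nicely_meromorphic_on_def)
    also have "\<dots> = \<beta> p"
      by (simp add: form_local_0 flip: local_\<beta>)
    finally show ?thesis .
  qed
  then have \<kappa>: "\<kappa> = Abs_kform \<beta>"
    by (simp add: \<kappa>_def)
  have "form_val \<kappa> = \<beta>"
    unfolding \<kappa> by (rule Abs_kform_inverse) (use R in \<open>simp add: mero_form_def local_\<beta>\<close>)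
  note val = this
  have "R z analytic_on {0}"
  proof (cases z)
    case (Fin w)
    have ne: "A * w + B \<noteq> 0"
    proof
      assume "A * w + B = 0"
      moreover have "c * w + d \<noteq> 0" using z(1) Fin Fin_ne_P by simp
      ultimately have "u z = e"
        by (simp add: Fin u_Fin A_def B_def field_simps)
      with z(2) show False by blast
    qed
    have "(c * w + d) * A - c * (A * w + B) \<noteq> 0" using detAB by (simp add: algebra_simps)
    from moebius_power_residue(3)[OF this k K ne] show ?thesis
      by (simp add: R_def Fin)
  next
    case Inf
    have ne: "A \<noteq> 0"
      using z(1,2) Inf_ne_P by (auto simp: Inf u_Inf A_def field_simps)
    have "c * B - d * A \<noteq> 0" using detAB by (simp add: algebra_simps)
    from moebius_power_residue(3)[OF this k _ ne, of "- K"] K show ?thesis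
      by (simp add: R_def Inf)
  qed
  then show "regular \<kappa> z"
    using analytic_at_imp_no_pole by (simp add: regular_def val local_\<beta>)
  have "du u z \<noteq> 0"
    using z(1) det du_Fin du_Inf Fin_ne_P Inf_ne_P by (cases z) auto
  then show "coef u \<kappa> z = C / (u z - e) ^ k"
    unfolding coef_def val using \<beta>_eq[OF z(1)] by (simp add: field_simps)
qed

end

section \<open>Values of forms\<close>

text \<open>
  The Moebius parameters enter only the proofs of the following basic facts: \<open>u\<close> is injective,
  coefficients of forms are rational functions of \<open>u\<close>, and the forms \<open>C du / (u - e) ^ k\<close> exist.
  Everything else rests on these facts.
\<close>

locale coordinate_line =
  fixes u :: "pline \<Rightarrow> complex" and P :: pline
  assumes coord: "coordinate u P"
begin

lemma moebius: obtains a b c d where "moebius_coordinate u P a b c d"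
  using coordinate_is_moebius[OF coord] by blast

lemma coordinate_inj: "x \<noteq> P \<Longrightarrow> y \<noteq> P \<Longrightarrow> u x = u y \<longleftrightarrow> x = y"
proof -
  assume "x \<noteq> P" "y \<noteq> P"
  obtain a b c d where "moebius_coordinate u P a b c d" using moebius by blast
  then interpret moebius_coordinate u P a b c d .
  show ?thesis using psi_u \<open>x \<noteq> P\<close> \<open>y \<noteq> P\<close> by metis
qed

lemma inj_on_coordinate: "inj_on u (UNIV - {P})"
  using coordinate_inj by (auto simp: inj_on_def)

lemma point_at_coordinate: "z \<noteq> P \<Longrightarrow> point_at u P (u z) = z"
  unfolding point_at_def using inj_on_coordinate by (auto intro: inv_into_f_f)

lemma point_at_moebius:
  assumes "moebius_coordinate u P a b c d"
  shows "point_at u P = moebius_coordinate.psi a b c d"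
proof
  fix s
  interpret moebius_coordinate u P a b c d by fact
  show "point_at u P s = psi s"
    using point_at_coordinate[OF psi_ne_P, of s] by (simp add: u_psi)
qed

lemma coordinate_point_at: "u (point_at u P s) = s" "point_at u P s \<noteq> P"
proof -
  obtain a b c d where "moebius_coordinate u P a b c d" using moebius by blast
  then interpret moebius_coordinate u P a b c d .
  show "u (point_at u P s) = s" "point_at u P s \<noteq> P"
    using point_at_moebius[OF moebius_coordinate_axioms] u_psi psi_ne_P by auto
qed

text \<open>
  The coefficient of a form with respect to \<open>du\<close>, as a function of the value of \<open>u\<close>.
\<close>

definition ucoef :: "kform \<Rightarrow> complex \<Rightarrow> complex" where
  "ucoef \<alpha> s = coef u \<alpha> (point_at u P s)"

lemma ucoef_coordinate: "z \<noteq> P \<Longrightarrow> ucoef \<alpha> (u z) = coef u \<alpha> z"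
  by (simp add: ucoef_def point_at_coordinate)

lemma ucoef_moebius:
  assumes "moebius_coordinate u P a b c d"
  shows "ucoef = moebius_coordinate.coef_fun u a b c d"
proof (intro ext)
  fix \<alpha> s
  interpret moebius_coordinate u P a b c d by fact
  show "ucoef \<alpha> s = coef_fun \<alpha> s"
    by (simp add: ucoef_def coef_fun_def point_at_moebius[OF assms])
qed

lemma ucoef_meromorphic: "ucoef \<alpha> meromorphic_on {s}"
proof -
  obtain a b c d where "moebius_coordinate u P a b c d" using moebius by blast
  then interpret moebius_coordinate u P a b c d .
  show ?thesis
    unfolding ucoef_moebius[OF moebius_coordinate_axioms] by (rule coef_fun_meromorphic)
qed

lemma ucoef_analytic:
  assumes "regular \<alpha> z" "z \<noteq> P"
  shows "ucoef \<alpha> analytic_on {u z}"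
proof -
  obtain a b c d where "moebius_coordinate u P a b c d" using moebius by blast
  then interpret moebius_coordinate u P a b c d .
  show ?thesis
    unfolding ucoef_moebius[OF moebius_coordinate_axioms]
    by (rule coef_fun_analytic) (use assms in \<open>simp add: psi_u\<close>)
qed

theorem ucoef_rational:
  obtains n q where "q \<noteq> 0" "\<And>z. z \<noteq> P \<Longrightarrow> regular \<alpha> z \<Longrightarrow> poly q (u z) \<noteq> 0"
    "\<And>z. z \<noteq> P \<Longrightarrow> regular \<alpha> z \<Longrightarrow> coef u \<alpha> z = poly n (u z) / poly q (u z)"
proof -
  obtain a b c d where "moebius_coordinate u P a b c d" using moebius by blast
  then interpret moebius_coordinate u P a b c d .
  have inf: "(\<lambda>t. ucoef \<alpha> (1 / t)) meromorphic_on {0}"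
    unfolding ucoef_moebius[OF moebius_coordinate_axioms] by (rule coef_fun_meromorphic_at_infinity)
  have "ucoef \<alpha> meromorphic_on UNIV"
    using ucoef_meromorphic meromorphic_on_meromorphic_at[of "ucoef \<alpha>" UNIV] by blast
  from meromorphic_on_sphere_imp_rational[OF this inf] obtain n q where
    "q \<noteq> 0" "\<And>s. ucoef \<alpha> analytic_on {s} \<Longrightarrow> poly q s \<noteq> 0"
    "\<And>s. ucoef \<alpha> analytic_on {s} \<Longrightarrow> ucoef \<alpha> s = poly n s / poly q s" by metis
  then show ?thesis
    by (intro that[of q n]) (use ucoef_analytic ucoef_coordinate in force)+
qed

text \<open>
  The value of a form at \<open>z\<close> in units of \<open>du\<close>, extended linearly to forms with a pole at \<open>z\<close>.  The
  extension is what allows the derivations below to act on all of \<open>W\<close>, where the relations between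
  forms may involve forms that are singular at \<open>z\<close>.
\<close>

definition value_at :: "pline \<Rightarrow> kform \<Rightarrow> complex" where
  "value_at z \<alpha> = laurent_const (ucoef \<alpha>) (u z)"

lemma value_at_regular:
  "z \<noteq> P \<Longrightarrow> regular \<alpha> z \<Longrightarrow> value_at z \<alpha> = coef u \<alpha> z"
  by (simp add: value_at_def laurent_const_analytic ucoef_analytic ucoef_coordinate)

text \<open>
  A relation between forms holds pointwise away from finitely many points, hence for Laurent
  coefficients.
\<close>

lemma value_at_lin_comb:
  assumes "lin_comb x \<alpha> y \<beta> \<gamma>"
  shows "value_at z \<gamma> = x * value_at z \<alpha> + y * value_at z \<beta>"
  unfolding value_at_def
proof (rule laurent_const_lin_comb)
  define N where "N = u ` ({p. \<not> regular \<alpha> p} \<union> {p. \<not> regular \<beta> p})"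
  have "finite N"
    unfolding N_def by (intro finite_imageI finite_UnI finite_not_regular)
  then have "\<forall>\<^sub>F t in at (u z). t \<notin> N"
    using islimpt_finite islimpt_iff_eventually by blast
  then show "\<forall>\<^sub>F t in at (u z). ucoef \<gamma> t = x * ucoef \<alpha> t + y * ucoef \<beta> t"
  proof eventually_elim
    case (elim t)
    then have "regular \<alpha> (point_at u P t)" "regular \<beta> (point_at u P t)"
      using coordinate_point_at(1)[of t] unfolding N_def by (metis (mono_tags, lifting) UnI1 UnI2 image_eqI mem_Collect_eq)+
    then have "form_val \<gamma> (point_at u P t) = x * form_val \<alpha> (point_at u P t) + y * form_val \<beta> (point_at u P t)"
      using assms by (simp add: lin_comb_def)
    then show ?case
      by (simp add: ucoef_def coef_def add_divide_distrib)
  qed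
qed (rule ucoef_meromorphic)+

definition pform :: "complex \<Rightarrow> nat \<Rightarrow> complex \<Rightarrow> kform" where
  "pform C k e = Abs_kform (\<lambda>p. remove_sings (form_local (\<lambda>q. C * du u q / (u q - e) ^ k) p) 0)"

lemma pform:
  assumes "k \<ge> 2" "C \<noteq> 0" "z \<noteq> P" "u z \<noteq> e"
  shows "regular (pform C k e) z" "coef u (pform C k e) z = C / (u z - e) ^ k"
proof -
  obtain a b c d where "moebius_coordinate u P a b c d" using moebius by blast
  then interpret moebius_coordinate u P a b c d .
  show "regular (pform C k e) z" "coef u (pform C k e) z = C / (u z - e) ^ k"
    unfolding pform_def by (rule pform_moebius[OF assms])+
qed

lemma e_form_eq_pform: "e_form u z = pform (-1) 2 (u z)"
  by (simp add: e_form_def pform_def)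

lemma e_form:
  assumes "x \<noteq> P" "z \<noteq> P" "x \<noteq> z"
  shows "regular (e_form u z) x" "coef u (e_form u z) x = - 1 / (u x - u z)\<^sup>2"
proof -
  have "u x \<noteq> u z" using assms coordinate_inj by blast
  then show "regular (e_form u z) x" "coef u (e_form u z) x = - 1 / (u x - u z)\<^sup>2"
    unfolding e_form_eq_pform using pform[of 2 "-1" x "u z"] assms by auto
qed

end

section \<open>Derivations of the symmetric algebra\<close>

text \<open>
  Linearity is compatibility with the relations that are divided out in \<open>W\<close>.
\<close>

definition linear_functional :: "(kform \<Rightarrow> complex) \<Rightarrow> bool" where
  "linear_functional \<phi> \<longleftrightarrow> (\<forall>a \<alpha> b \<beta> \<gamma>. lin_comb a \<alpha> b \<beta> \<gamma> \<longrightarrow> \<phi> \<gamma> = a * \<phi> \<alpha> + b * \<phi> \<beta>)"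

definition der_monom :: "(kform \<Rightarrow> complex) \<Rightarrow> kform multiset \<Rightarrow> free_alg" where
  "der_monom \<phi> M = (\<Sum>\<alpha>\<in>#M. Poly_Mapping.single (M - {#\<alpha>#}) (\<phi> \<alpha>))"

definition free_der :: "(kform \<Rightarrow> complex) \<Rightarrow> free_alg \<Rightarrow> free_alg" where
  "free_der \<phi> p = (\<Sum>M\<in>Poly_Mapping.keys p. scal (Poly_Mapping.lookup p M) * der_monom \<phi> M)"

lemma scal_simps: "scal 0 = 0" "scal 1 = 1" "scal (x + y) = scal x + scal y" "scal (x * y) = scal x * scal y"
  "scal (- x) = - scal x" "scal (x - y) = scal x - scal y"
  by (simp_all add: scal_def single_add mult_single single_uminus single_diff single_one)

lemma scal_mult_single: "scal x * Poly_Mapping.single M y = Poly_Mapping.single M (x * y)"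
  by (simp add: scal_def mult_single)

lemma poly_mapping_sum_monomials:
  "(p :: 'a \<Rightarrow>\<^sub>0 'b::comm_monoid_add) = (\<Sum>M\<in>Poly_Mapping.keys p. Poly_Mapping.single M (Poly_Mapping.lookup p M))"
proof (rule poly_mapping_eqI)
  fix k
  show "Poly_Mapping.lookup p k = Poly_Mapping.lookup (\<Sum>M\<in>Poly_Mapping.keys p. Poly_Mapping.single M (Poly_Mapping.lookup p M)) k"
    by (simp add: lookup_sum lookup_single when_def in_keys_iff sum.delta)
qed

text \<open>
  The extension of a function of monomials and coefficients, additive in the coefficients, is additive
  on polynomials.
\<close>

lemma sum_keys_add:
  fixes g :: "'a \<Rightarrow> 'b::comm_monoid_add \<Rightarrow> 'c::comm_monoid_add"
  assumes g0: "\<And>M. g M 0 = 0" and gadd: "\<And>M x y. g M (x + y) = g M x + g M y"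
  shows "(\<Sum>M\<in>Poly_Mapping.keys (p + q). g M (Poly_Mapping.lookup (p + q) M)) =
    (\<Sum>M\<in>Poly_Mapping.keys p. g M (Poly_Mapping.lookup p M)) + (\<Sum>M\<in>Poly_Mapping.keys q. g M (Poly_Mapping.lookup q M))"
proof -
  let ?K = "Poly_Mapping.keys p \<union> Poly_Mapping.keys q"
  have ext: "(\<Sum>M\<in>Poly_Mapping.keys r. g M (Poly_Mapping.lookup r M)) = (\<Sum>M\<in>?K. g M (Poly_Mapping.lookup r M))"
    if "Poly_Mapping.keys r \<subseteq> ?K" for r
    by (rule sum.mono_neutral_left) (use that in \<open>auto simp: in_keys_iff g0\<close>)
  have "(\<Sum>M\<in>Poly_Mapping.keys (p + q). g M (Poly_Mapping.lookup (p + q) M)) = (\<Sum>M\<in>?K. g M (Poly_Mapping.lookup (p + q) M))"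
    using keys_add[of p q] by (intro ext) auto
  also have "\<dots> = (\<Sum>M\<in>?K. g M (Poly_Mapping.lookup p M)) + (\<Sum>M\<in>?K. g M (Poly_Mapping.lookup q M))"
    by (simp add: lookup_add gadd sum.distrib)
  finally show ?thesis by (simp add: ext)
qed

lemma free_der_add: "free_der \<phi> (p + q) = free_der \<phi> p + free_der \<phi> q"
  unfolding free_der_def
  by (rule sum_keys_add[of "\<lambda>M x. scal x * der_monom \<phi> M"]) (simp_all add: scal_simps distrib_right)

lemma free_der_0: "free_der \<phi> 0 = 0"
  by (simp add: free_der_def)

lemma free_der_sum: "free_der \<phi> (sum f A) = (\<Sum>x\<in>A. free_der \<phi> (f x))"
  by (induction A rule: infinite_finite_induct) (simp_all add: free_der_0 free_der_add)

lemma free_der_single: "free_der \<phi> (Poly_Mapping.single M x) = scal x * der_monom \<phi> M"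
  by (cases "x = 0") (simp_all add: free_der_def scal_simps)

lemma der_monom_add:
  "der_monom \<phi> (M + N) = der_monom \<phi> M * Poly_Mapping.single N 1 + Poly_Mapping.single M 1 * der_monom \<phi> N"
proof -
  have "(\<Sum>\<alpha>\<in>#M. Poly_Mapping.single (M + N - {#\<alpha>#}) (\<phi> \<alpha>)) = 
      (\<Sum>\<alpha>\<in>#M. Poly_Mapping.single (M - {#\<alpha>#}) (\<phi> \<alpha>) * Poly_Mapping.single N 1)"
    by (intro arg_cong[of _ _ sum_mset] image_mset_cong) (simp add: mult_single)
  moreover have "(\<Sum>\<alpha>\<in>#N. Poly_Mapping.single (M + N - {#\<alpha>#}) (\<phi> \<alpha>)) = 
      (\<Sum>\<alpha>\<in>#N. Poly_Mapping.single M 1 * Poly_Mapping.single (N - {#\<alpha>#}) (\<phi> \<alpha>))"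
    by (intro arg_cong[of _ _ sum_mset] image_mset_cong) (simp add: mult_single)
  ultimately show ?thesis
    by (simp add: der_monom_def sum_mset_distrib_left sum_mset_distrib_right)
qed

lemma free_der_mult: "free_der \<phi> (p * q) = free_der \<phi> p * q + p * free_der \<phi> q"
proof -
  have single: "free_der \<phi> (Poly_Mapping.single M x * Poly_Mapping.single N y) =
     free_der \<phi> (Poly_Mapping.single M x) * Poly_Mapping.single N y + Poly_Mapping.single M x * free_der \<phi> (Poly_Mapping.single N y)" for M N x y
  proof -
    have eq: "Poly_Mapping.single M x = scal x * Poly_Mapping.single M 1" for M x
      by (simp add: scal_mult_single)
    have "free_der \<phi> (Poly_Mapping.single M x * Poly_Mapping.single N y) =
        scal x * scal y * (der_monom \<phi> M * Poly_Mapping.single N 1 + Poly_Mapping.single M 1 * der_monom \<phi> N)"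
      by (simp add: mult_single free_der_single der_monom_add scal_simps)
    also have "\<dots> = (scal x * der_monom \<phi> M) * (scal y * Poly_Mapping.single N 1)
        + (scal x * Poly_Mapping.single M 1) * (scal y * der_monom \<phi> N)"
      by (simp add: algebra_simps)
    finally show ?thesis
      by (simp only: free_der_single flip: eq)
  qed
  let ?s = "\<lambda>p M. Poly_Mapping.single M (Poly_Mapping.lookup p M)"
  have p: "p = sum (?s p) (Poly_Mapping.keys p)" and q: "q = sum (?s q) (Poly_Mapping.keys q)"
    by (rule poly_mapping_sum_monomials)+
  have "free_der \<phi> (p * q) = (\<Sum>M\<in>Poly_Mapping.keys p. \<Sum>N\<in>Poly_Mapping.keys q. free_der \<phi> (?s p M * ?s q N))"
    by (subst p, subst q) (simp add: sum_product free_der_sum)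
  also have "\<dots> = (\<Sum>M\<in>Poly_Mapping.keys p. \<Sum>N\<in>Poly_Mapping.keys q. free_der \<phi> (?s p M) * ?s q N)
      + (\<Sum>M\<in>Poly_Mapping.keys p. \<Sum>N\<in>Poly_Mapping.keys q. ?s p M * free_der \<phi> (?s q N))"
    by (simp add: single sum.distrib)
  also have "\<dots> = free_der \<phi> (sum (?s p) (Poly_Mapping.keys p)) * sum (?s q) (Poly_Mapping.keys q) +
       sum (?s p) (Poly_Mapping.keys p) * free_der \<phi> (sum (?s q) (Poly_Mapping.keys q))"
    by (simp only: free_der_sum sum_product)
  also have "\<dots> = free_der \<phi> p * q + p * free_der \<phi> q"
    using p q by metis
  finally show ?thesis .
qed

lemma free_der_gen: "free_der \<phi> (gen \<alpha>) = scal (\<phi> \<alpha>)"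
  by (simp add: gen_def free_der_single der_monom_def scal_simps) (simp add: scal_def)

lemma free_der_scal: "free_der \<phi> (scal x) = 0"
  by (simp add: scal_def free_der_single der_monom_def)

lemma free_der_uminus: "free_der \<phi> (- p) = - free_der \<phi> p"
  using free_der_add[of \<phi> p "- p"] by (simp add: free_der_0 eq_neg_iff_add_eq_0 add.commute)

lemma free_der_diff: "free_der \<phi> (p - q) = free_der \<phi> p - free_der \<phi> q"
  using free_der_add[of \<phi> p "- q"] by (simp add: free_der_uminus)

text \<open>
  A derivation maps each linear relation to a constant, which is 0 by linearity of \<open>\<phi>\<close>.
\<close>

lemma free_der_lin_ideal:
  assumes "linear_functional \<phi>" "p \<in> lin_ideal"
  shows "free_der \<phi> p \<in> lin_ideal"
  using assms(2)
proof induction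
  case (rel a \<alpha> b \<beta> \<gamma>)
  then have "\<phi> \<gamma> = a * \<phi> \<alpha> + b * \<phi> \<beta>"
    using assms(1) by (simp add: linear_functional_def)
  then have "free_der \<phi> (gen \<gamma> - scal a * gen \<alpha> - scal b * gen \<beta>) = 0"
    by (simp add: free_der_diff free_der_mult free_der_gen free_der_scal scal_simps)
  then show ?case by (simp add: lin_ideal.zero)
qed (auto simp: free_der_0 free_der_add free_der_mult intro: lin_ideal.intros)

text \<open>
  The derivation of the symmetric algebra that extends the functional \<open>\<phi>\<close> on forms.  It is well
  defined on \<open>W\<close> when \<open>\<phi>\<close> is linear.
\<close>

definition der :: "(kform \<Rightarrow> complex) \<Rightarrow> W \<Rightarrow> W" where
  "der \<phi> w = W_of (free_der \<phi> (rep_W w))"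

lemma W_of_eq_iff: "W_of p = W_of q \<longleftrightarrow> p - q \<in> lin_ideal"
  using W.abs_eq_iff[of p q] by (simp add: lin_equiv_def)

lemma W_of_rep_W: "W_of (rep_W w) = w"
  using Quotient3_W by (rule Quotient3_abs_rep)

lemma W_of_cases: obtains p where "w = W_of p"
  using W_of_rep_W[of w] by metis

lemma W_of_simps: "W_of 0 = 0" "W_of 1 = 1" "W_of (p + q) = W_of p + W_of q" "W_of (p * q) = W_of p * W_of q"
    "W_of (- p) = - W_of p" "W_of (p - q) = W_of p - W_of q"
  by (simp_all add: zero_W.abs_eq one_W.abs_eq plus_W.abs_eq times_W.abs_eq uminus_W.abs_eq minus_W.abs_eq)

lemma der_W_of:
  assumes "linear_functional \<phi>"
  shows "der \<phi> (W_of p) = W_of (free_der \<phi> p)"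
proof -
  have "rep_W (W_of p) - p \<in> lin_ideal"
    using W_of_rep_W[of "W_of p"] by (simp add: W_of_eq_iff)
  from free_der_lin_ideal[OF assms this] show ?thesis
    by (simp add: der_def W_of_eq_iff free_der_diff)
qed

lemma cW_simps: "cW 0 = 0" "cW 1 = 1" "cW (x + y) = cW x + cW y" "cW (x * y) = cW x * cW y"
  "cW (- x) = - cW x" "cW (x - y) = cW x - cW y"
  by (simp_all add: cW_def scal_simps W_of_simps)

lemma der_simps:
  assumes "linear_functional \<phi>"
  shows der_add: "der \<phi> (v + w) = der \<phi> v + der \<phi> w"
    and der_mult: "der \<phi> (v * w) = der \<phi> v * w + v * der \<phi> w"
    and der_cW: "der \<phi> (cW x) = 0"
    and der_iota: "der \<phi> (iota \<alpha>) = cW (\<phi> \<alpha>)"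
proof -
  obtain p q where "v = W_of p" "w = W_of q" by (metis W_of_cases)
  then show "der \<phi> (v + w) = der \<phi> v + der \<phi> w" "der \<phi> (v * w) = der \<phi> v * w + v * der \<phi> w"
    by (simp_all add: der_W_of[OF assms] free_der_add free_der_mult W_of_simps flip: W_of_simps(3,4))
qed (simp_all add: cW_def iota_def der_W_of[OF assms] free_der_scal free_der_gen W_of_simps)

lemma der_cW_mult: "linear_functional \<phi> \<Longrightarrow> der \<phi> (cW x * w) = cW x * der \<phi> w"
  by (simp add: der_mult der_cW)

lemma der_0: "linear_functional \<phi> \<Longrightarrow> der \<phi> 0 = 0"
  using der_cW[of \<phi> 0] by (simp add: cW_simps)

lemma der_1: "linear_functional \<phi> \<Longrightarrow> der \<phi> 1 = 0"
  using der_cW[of \<phi> 1] by (simp add: cW_simps)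

section \<open>Elements regular on a set\<close>

lemma free_reg_intros:
  "0 \<in> free_reg A" "scal x \<in> free_reg A" 
  "(\<And>x. x \<in> A \<Longrightarrow> regular \<alpha> x) \<Longrightarrow> gen \<alpha> \<in> free_reg A"
  by (auto simp: free_reg_def scal_def gen_def split: if_splits)

lemma free_reg_add: "p \<in> free_reg A \<Longrightarrow> q \<in> free_reg A \<Longrightarrow> p + q \<in> free_reg A"
  using keys_add[of p q] by (fastforce simp: free_reg_def)

lemma free_reg_mult: "p \<in> free_reg A \<Longrightarrow> q \<in> free_reg A \<Longrightarrow> p * q \<in> free_reg A"
  using keys_mult[of p q] by (fastforce simp: free_reg_def)

lemma W_reg_add: "v \<in> W_reg A \<Longrightarrow> w \<in> W_reg A \<Longrightarrow> v + w \<in> W_reg A"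
  unfolding W_reg_def by (auto simp flip: W_of_simps intro!: imageI free_reg_add)

lemma W_reg_mult: "v \<in> W_reg A \<Longrightarrow> w \<in> W_reg A \<Longrightarrow> v * w \<in> W_reg A"
  unfolding W_reg_def by (auto simp flip: W_of_simps intro!: imageI free_reg_mult)

lemma W_reg_cW: "cW x \<in> W_reg A"
  unfolding W_reg_def cW_def by (intro imageI free_reg_intros)

lemma W_reg_iota: "(\<And>x. x \<in> A \<Longrightarrow> regular \<alpha> x) \<Longrightarrow> iota \<alpha> \<in> W_reg A"
  unfolding W_reg_def iota_def by (auto intro!: free_reg_intros)

lemma W_reg_0: "0 \<in> W_reg A" and W_reg_1: "1 \<in> W_reg A"
  using W_reg_cW[of 0 A] W_reg_cW[of 1 A] by (simp_all add: cW_simps)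

lemma W_reg_uminus: "v \<in> W_reg A \<Longrightarrow> - v \<in> W_reg A"
  using W_reg_mult[OF W_reg_cW[of "-1"], of v A] by (simp add: cW_simps)

lemma W_reg_diff: "v \<in> W_reg A \<Longrightarrow> w \<in> W_reg A \<Longrightarrow> v - w \<in> W_reg A"
  using W_reg_add[OF _ W_reg_uminus, of v A w] by simp

lemma W_reg_numeral: "numeral n \<in> W_reg A"
proof -
  have "cW (of_nat m) = of_nat m" for m
    by (induction m) (simp_all add: cW_simps)
  from this[of "numeral n"] show ?thesis
    using W_reg_cW[of "numeral n" A] by simp
qed

lemmas W_reg_intros = W_reg_0 W_reg_1 W_reg_numeral W_reg_cW W_reg_add W_reg_mult W_reg_uminus W_reg_diff W_reg_iota

lemma W_reg_induct [consumes 1, case_names one scale add mult]: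
  assumes "w \<in> W_reg A"
    and one: "Q 1"
    and scale: "\<And>c w. w \<in> W_reg A \<Longrightarrow> Q w \<Longrightarrow> Q (cW c * w)"
    and add: "\<And>v w. v \<in> W_reg A \<Longrightarrow> w \<in> W_reg A \<Longrightarrow> Q v \<Longrightarrow> Q w \<Longrightarrow> Q (v + w)"
    and mult: "\<And>\<alpha> w. (\<And>x. x \<in> A \<Longrightarrow> regular \<alpha> x) \<Longrightarrow> w \<in> W_reg A \<Longrightarrow> Q w \<Longrightarrow> Q (iota \<alpha> * w)"
  shows "Q w"
proof -
  obtain p where p: "p \<in> free_reg A" "w = W_of p"
    using assms(1) by (auto simp: W_reg_def)
  have monom: "W_of (Poly_Mapping.single M 1) \<in> W_reg A \<and> Q (W_of (Poly_Mapping.single M 1))"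
    if "\<forall>\<alpha>\<in>#M. \<forall>x\<in>A. regular \<alpha> x" for M
    using that
  proof (induction M)
    case empty
    have "Poly_Mapping.single {#} (1::complex) = 1" by (metis single_one zero_multiset_def)
    then show ?case by (simp add: W_of_simps one W_reg_1)
  next
    case (add \<alpha> M)
    have "W_of (Poly_Mapping.single (add_mset \<alpha> M) 1) = iota \<alpha> * W_of (Poly_Mapping.single M 1)"
      by (simp add: iota_def gen_def mult_single flip: W_of_simps)
    with add mult[of \<alpha>] show ?case
      by (auto intro!: W_reg_intros)
  qed
  have zero: "Q 0"
    using scale[OF W_reg_1 one, of 0] by (simp add: cW_simps)
  have "W_of (\<Sum>M\<in>K. Poly_Mapping.single M (Poly_Mapping.lookup p M)) \<in> W_reg A \<and>
      Q (W_of (\<Sum>M\<in>K. Poly_Mapping.single M (Poly_Mapping.lookup p M)))"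
    if "K \<subseteq> Poly_Mapping.keys p" for K
    using finite_subset[OF that finite_keys] that
  proof (induction K rule: finite_induct)
    case empty
    then show ?case by (simp add: W_of_simps zero W_reg_0)
  next
    case (insert M K)
    have M: "W_of (Poly_Mapping.single M 1) \<in> W_reg A \<and> Q (W_of (Poly_Mapping.single M 1))"
      by (rule monom) (use insert.prems p(1) in \<open>auto simp: free_reg_def\<close>)
    have "W_of (Poly_Mapping.single M (Poly_Mapping.lookup p M)) = cW (Poly_Mapping.lookup p M) * W_of (Poly_Mapping.single M 1)"
      by (simp add: cW_def scal_mult_single flip: W_of_simps)
    with M insert show ?case
      by (auto simp: W_of_simps intro!: W_reg_intros add scale)
  qed
  from this[of "Poly_Mapping.keys p"] show ?thesis
    using p(2) by (simp flip: poly_mapping_sum_monomials)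
qed

lemma der_W_reg:
  assumes "linear_functional \<phi>" "w \<in> W_reg A"
  shows "der \<phi> w \<in> W_reg A"
  using assms(2)
  by (induction rule: W_reg_induct)
    (auto simp: der_1 der_add der_mult der_cW der_iota assms(1) intro!: W_reg_intros)

text \<open>
  Only finitely many forms occur in \<open>w\<close>, each with finitely many poles.  This is where the Zariski
  neighbourhoods of the statement come from.
\<close>

lemma W_reg_cofinite:
  obtains A where "finite A" "\<And>B. B \<inter> A = {} \<Longrightarrow> w \<in> W_reg B"
proof -
  obtain p where p: "w = W_of p" using W_of_cases by blast
  define A where "A = (\<Union>M\<in>Poly_Mapping.keys p. \<Union>\<alpha>\<in>set_mset M. {x. \<not> regular \<alpha> x})"
  have "finite A"
    unfolding A_def by (intro finite_UN_I finite_keys finite_set_mset finite_not_regular)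
  moreover have "w \<in> W_reg B" if "B \<inter> A = {}" for B
    unfolding p W_reg_def using that by (intro imageI) (auto simp: free_reg_def A_def)
  ultimately show ?thesis by (rule that)
qed

section \<open>Interior products and polydifferentials\<close>

text \<open>
  The component of degree 0.
\<close>

definition aug :: "W \<Rightarrow> complex" where
  "aug w = Poly_Mapping.lookup (rep_W w) {#}"

lemma aug_W_of: "aug (W_of p) = Poly_Mapping.lookup p {#}"
proof -
  have "rep_W (W_of p) - p \<in> lin_ideal"
    using W_of_rep_W[of "W_of p"] by (simp add: W_of_eq_iff)
  from lin_ideal_lookup_empty[OF this] show ?thesis
    by (simp add: aug_def lookup_minus)
qed

lemma aug_simps: "aug (v + w) = aug v + aug w" "aug (v * w) = aug v * aug w" "aug (cW x) = x" "aug (iota \<alpha>) = 0"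
  "aug (v - w) = aug v - aug w"
proof -
  obtain p q where *: "v = W_of p" "w = W_of q" by (metis W_of_cases)
  show "aug (v + w) = aug v + aug w" "aug (v * w) = aug v * aug w" "aug (v - w) = aug v - aug w"
    unfolding * W_of_simps(3,4,6)[symmetric] aug_W_of by (simp_all add: lookup_add lookup_mult_empty lookup_minus)
qed (simp_all add: cW_def iota_def aug_W_of scal_def gen_def lookup_single flip: zero_multiset_def)

definition del_nth :: "nat \<Rightarrow> 'a list \<Rightarrow> 'a list" where
  "del_nth j xs = take j xs @ drop (Suc j) xs"

lemma del_nth_simps: "del_nth 0 (x # xs) = xs" "del_nth (Suc j) (x # xs) = x # del_nth j xs"
  by (simp_all add: del_nth_def)

lemma length_del_nth: "j < length xs \<Longrightarrow> length (del_nth j xs) = length xs - 1"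
  by (simp add: del_nth_def)

lemma set_del_nth: "set (del_nth j xs) \<subseteq> set xs"
  using set_take_subset[of j xs] set_drop_subset[of "Suc j" xs] by (auto simp: del_nth_def)

lemma map_del_nth: "map f (del_nth j xs) = del_nth j (map f xs)"
  by (simp add: del_nth_def take_map drop_map)

lemma sum_mset_eq_sum_count:
  fixes f :: "'a \<Rightarrow> complex"
  shows "(\<Sum>x\<in>#M. f x) = (\<Sum>x\<in>set_mset M. of_nat (count M x) * f x)"
proof (induction M)
  case (add y M)
  have "(\<Sum>x\<in>set_mset (add_mset y M). of_nat (count (add_mset y M) x) * f x) =
      (\<Sum>x\<in>set_mset (add_mset y M). of_nat (count M x) * f x + (if x = y then f y else 0))"
    by (intro sum.cong) (auto simp: algebra_simps)
  also have "\<dots> = (\<Sum>x\<in>set_mset (add_mset y M). of_nat (count M x) * f x) + f y"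
    by (simp add: sum.distrib)
  also have "(\<Sum>x\<in>set_mset (add_mset y M). of_nat (count M x) * f x) = (\<Sum>x\<in>set_mset M. of_nat (count M x) * f x)"
    by (rule sum.mono_neutral_right) (auto simp: not_in_iff)
  finally show ?case using add by simp
qed simp

lemma sum_permutations_of_multiset_Cons:
  assumes "M \<noteq> {#}"
  shows "(\<Sum>as\<in>permutations_of_multiset M. g as) =
     (\<Sum>\<alpha>\<in>set_mset M. \<Sum>as\<in>permutations_of_multiset (M - {#\<alpha>#}). g (\<alpha> # as))"
proof -
  have "(\<Sum>as\<in>permutations_of_multiset M. g as) =
     (\<Sum>\<alpha>\<in>set_mset M. \<Sum>as\<in>(#) \<alpha> ` permutations_of_multiset (M - {#\<alpha>#}). g as)"
    unfolding permutations_of_multiset_nonempty[OF assms] by (rule sum.UNION_disjoint) auto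
  then show ?thesis
    by (simp add: sum.reindex)
qed

context coordinate_line
begin

lemma linear_value_at: "linear_functional (value_at z)"
  unfolding linear_functional_def using value_at_lin_comb by blast

lemma linear_minus_value_at: "linear_functional (\<lambda>\<alpha>. - value_at z \<alpha>)"
  unfolding linear_functional_def using value_at_lin_comb by (simp add: algebra_simps)

definition ins :: "pline \<Rightarrow> W \<Rightarrow> W" where
  "ins z = der (\<lambda>\<alpha>. - value_at z \<alpha>)"

lemmas ins_simps =
  der_add[OF linear_minus_value_at, of z for z, folded ins_def]
  der_mult[OF linear_minus_value_at, of z for z, folded ins_def]
  der_cW[OF linear_minus_value_at, of z for z, folded ins_def]
  der_iota[OF linear_minus_value_at, of z for z, folded ins_def]
  der_0[OF linear_minus_value_at, of z for z, folded ins_def]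
  der_1[OF linear_minus_value_at, of z for z, folded ins_def]

lemma ins_W_reg: "w \<in> W_reg A \<Longrightarrow> ins z w \<in> W_reg A"
  unfolding ins_def by (rule der_W_reg[OF linear_minus_value_at])

text \<open>
  The defining properties of \<open>i_hat\<close> determine it on the subalgebra generated by the forms regular at
  \<open>z\<close>, and \<open>ins z\<close> has them.
\<close>

lemma i_hat_eq_ins:
  assumes "z \<noteq> P" "w \<in> W_reg {z}"
  shows "i_hat u z w = ins z w"
proof -
  have "is_i_hat u z (ins z)"
    unfolding is_i_hat_def
    by (auto simp: ins_simps ins_W_reg value_at_regular assms(1) cW_simps)
  then have D: "is_i_hat u z (i_hat u z)"
    unfolding i_hat_def by (rule someI[of "is_i_hat u z"])
  from assms(2) show ?thesis
  proof (induction rule: W_reg_induct)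
    case one
    then show ?case using D by (simp add: is_i_hat_def ins_simps)
  next
    case (scale c w)
    then show ?case using D by (simp add: is_i_hat_def ins_simps)
  next
    case (add v w)
    then show ?case using D by (simp add: is_i_hat_def ins_simps)
  next
    case (mult \<alpha> w)
    then have "iota \<alpha> \<in> W_reg {z}" by (auto intro: W_reg_iota)
    then show ?case using D mult by (simp add: is_i_hat_def ins_simps value_at_regular assms(1) cW_simps)
  qed
qed

text \<open>
  Up to the factor \<open>1 / m!\<close>, contraction with \<open>m\<close> points reads off the polydifferential of degree \<open>m\<close>:
  on a product of \<open>m\<close> forms the iterated derivation gives the sum over all bijections between forms and
  points.
\<close>

primrec contract :: "pline list \<Rightarrow> W \<Rightarrow> complex" where
  "contract [] w = aug w"
| "contract (x # xs) w = contract xs (der (value_at x) w)"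

lemma contract_add: "contract xs (v + w) = contract xs v + contract xs w"
  by (induction xs arbitrary: v w) (simp_all add: aug_simps der_add[OF linear_value_at])

lemma contract_cW_mult: "contract xs (cW c * w) = c * contract xs w"
  by (induction xs arbitrary: w) (simp_all add: aug_simps der_cW_mult[OF linear_value_at])

lemma contract_0: "contract xs 0 = 0"
  using contract_cW_mult[of xs 0 0] by (simp add: cW_simps)

lemma contract_1: "contract xs 1 = (if xs = [] then 1 else 0)"
  using aug_simps(3)[of 1] by (cases xs) (simp_all add: der_1[OF linear_value_at] contract_0 cW_simps)

lemma contract_uminus: "contract xs (- w) = - contract xs w"
  using contract_cW_mult[of xs "-1" w] by (simp add: cW_simps)

lemma contract_diff: "contract xs (v - w) = contract xs v - contract xs w"
  using contract_add[of xs v "- w"] by (simp add: contract_uminus)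

lemma contract_sum: "contract xs (sum f A) = (\<Sum>a\<in>A. contract xs (f a))"
  by (induction A rule: infinite_finite_induct) (simp_all add: contract_0 contract_add)

lemma contract_sum_mset: "contract xs (\<Sum>a\<in>#M. f a) = (\<Sum>a\<in>#M. contract xs (f a))"
  by (induction M) (simp_all add: contract_0 contract_add)

lemma W_of_sum_mset: "W_of (\<Sum>a\<in>#M. f a) = (\<Sum>a\<in>#M. W_of (f a))"
  by (induction M) (simp_all add: W_of_simps)

lemma W_of_sum: "W_of (sum f A) = (\<Sum>a\<in>A. W_of (f a))"
  by (induction A rule: infinite_finite_induct) (simp_all add: W_of_simps)

lemma W_of_single: "W_of (Poly_Mapping.single M c) = cW c * W_of (Poly_Mapping.single M 1)"
  by (simp add: cW_def scal_mult_single flip: W_of_simps)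

text \<open>
  Averages over the permutations of a multiset are averages over all permutations.  By induction: the
  first derivation picks a form \<open>\<alpha>\<close> with multiplicity \<open>count M \<alpha>\<close>, and \<open>card (perms M) * count M \<alpha> =
  size M * card (perms (M - {\<alpha>}))\<close>.
\<close>

lemma contract_monomial:
  "contract xs (W_of (Poly_Mapping.single M 1)) = (if size M = length xs then
     fact (length xs) * (\<Sum>as\<in>permutations_of_multiset M. \<Prod>i<length xs. value_at (xs ! i) (as ! i))
       / of_nat (card (permutations_of_multiset M)) else 0)"
proof (induction xs arbitrary: M)
  case Nil
  then show ?case
    by (simp add: aug_W_of lookup_single when_def)
next
  case (Cons x xs)
  let ?S = "\<lambda>M. \<Sum>as\<in>permutations_of_multiset M. \<Prod>i<length xs. value_at (xs ! i) (as ! i)"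
  let ?c = "\<lambda>M. of_nat (card (permutations_of_multiset M)) :: complex"
  have c_nz: "?c M \<noteq> 0" for M
    by (simp add: card_eq_0_iff)
  have "der (value_at x) (W_of (Poly_Mapping.single M 1)) =
      (\<Sum>\<alpha>\<in>#M. cW (value_at x \<alpha>) * W_of (Poly_Mapping.single (M - {#\<alpha>#}) 1))"
    by (simp add: der_W_of[OF linear_value_at] free_der_single scal_simps der_monom_def W_of_sum_mset W_of_single[of _ "value_at x _"])
  then have eq: "contract (x # xs) (W_of (Poly_Mapping.single M 1)) =
      (\<Sum>\<alpha>\<in>#M. value_at x \<alpha> * contract xs (W_of (Poly_Mapping.single (M - {#\<alpha>#}) 1)))"
    by (simp add: contract_sum_mset contract_cW_mult)
  show ?case
  proof (cases "size M = length (x # xs)")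
    case False
    then have "contract xs (W_of (Poly_Mapping.single (M - {#\<alpha>#}) 1)) = 0" if "\<alpha> \<in># M" for \<alpha>
      using that size_Diff_singleton[OF that] size_eq_0_iff_empty[of M] by (cases "size M") (auto simp: Cons.IH)
    then have "(\<Sum>\<alpha>\<in>#M. value_at x \<alpha> * contract xs (W_of (Poly_Mapping.single (M - {#\<alpha>#}) 1))) = (\<Sum>\<alpha>\<in>#M. 0)"
      by (intro arg_cong[of _ _ sum_mset] image_mset_cong) simp
    with False show ?thesis by (simp only: eq) simp
  next
    case True
    then have M: "M \<noteq> {#}" by auto
    have summand: "of_nat (count M \<alpha>) * (value_at x \<alpha> * contract xs (W_of (Poly_Mapping.single (M - {#\<alpha>#}) 1))) =
        fact (length (x # xs)) * (value_at x \<alpha> * ?S (M - {#\<alpha>#})) / ?c M" if "\<alpha> \<in># M" for \<alpha>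
    proof -
      have "of_nat (card (permutations_of_multiset M) * count M \<alpha>) =
          (of_nat (size M * card (permutations_of_multiset (M - {#\<alpha>#}))) :: complex)"
        using card_permutations_of_multiset_remove_aux[OF that] by simp
      then have "?c M * of_nat (count M \<alpha>) = of_nat (length (x # xs)) * ?c (M - {#\<alpha>#})"
        by (simp only: of_nat_mult True)
      then have cnt: "of_nat (count M \<alpha>) = of_nat (length (x # xs)) * ?c (M - {#\<alpha>#}) / ?c M"
        using c_nz[of M] by (metis nonzero_eq_divide_eq mult.commute)
      have "size (M - {#\<alpha>#}) = length xs"
        using True that by (simp add: size_Diff_singleton)
      then have "contract xs (W_of (Poly_Mapping.single (M - {#\<alpha>#}) 1)) =
          fact (length xs) * ?S (M - {#\<alpha>#}) / ?c (M - {#\<alpha>#})"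
        by (simp add: Cons.IH)
      then show ?thesis
        unfolding cnt using c_nz[of M] c_nz[of "M - {#\<alpha>#}"] by (simp add: field_simps)
    qed
    have "contract (x # xs) (W_of (Poly_Mapping.single M 1)) =
       (\<Sum>\<alpha>\<in>set_mset M. fact (length (x # xs)) * (value_at x \<alpha> * ?S (M - {#\<alpha>#})) / ?c M)"
      unfolding eq sum_mset_eq_sum_count by (intro sum.cong refl summand) auto
    also have "\<dots> = fact (length (x # xs)) * (\<Sum>\<alpha>\<in>set_mset M. value_at x \<alpha> * ?S (M - {#\<alpha>#})) / ?c M"
      by (simp only: sum_divide_distrib sum_distrib_left)
    also have "(\<Sum>\<alpha>\<in>set_mset M. value_at x \<alpha> * ?S (M - {#\<alpha>#})) =
        (\<Sum>as\<in>permutations_of_multiset M. \<Prod>i<length (x # xs). value_at ((x # xs) ! i) (as ! i))"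
      unfolding sum_permutations_of_multiset_Cons[OF M]
      unfolding length_Cons prod.lessThan_Suc_shift by (simp add: sum_distrib_left)
    finally show ?thesis
      using True by simp
  qed
qed

lemma free_polydiff_eq_contract:
  assumes "p \<in> free_reg (set xs)" "P \<notin> set xs"
  shows "free_polydiff u p xs = contract xs (W_of p) / fact (length xs)"
proof -
  let ?c = "\<lambda>M. of_nat (card (permutations_of_multiset M)) :: complex"
  have "contract xs (W_of p) = (\<Sum>M\<in>Poly_Mapping.keys p. Poly_Mapping.lookup p M * contract xs (W_of (Poly_Mapping.single M 1)))"
    by (subst poly_mapping_sum_monomials[of p])
      (simp add: W_of_sum contract_sum W_of_single[of _ "Poly_Mapping.lookup p _"] contract_cW_mult)
  also have "\<dots> = (\<Sum>M\<in>{M\<in>Poly_Mapping.keys p. size M = length xs}. Poly_Mapping.lookup p M * contract xs (W_of (Poly_Mapping.single M 1)))"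
    by (rule sum.mono_neutral_right) (auto simp: contract_monomial)
  also have "\<dots> = (\<Sum>M\<in>{M\<in>Poly_Mapping.keys p. size M = length xs}. fact (length xs) * (Poly_Mapping.lookup p M *
        (\<Sum>as \<in> permutations_of_multiset M. \<Prod>i < length xs. coef u (as ! i) (xs ! i)) / ?c M))"
  proof (intro sum.cong refl)
    fix M assume "M \<in> {M\<in>Poly_Mapping.keys p. size M = length xs}"
    then have M: "M \<in> Poly_Mapping.keys p" "size M = length xs" by auto
    have "value_at (xs ! i) (as ! i) = coef u (as ! i) (xs ! i)"
      if "as \<in> permutations_of_multiset M" "i < length xs" for as i
    proof (rule value_at_regular)
      have "as ! i \<in># M"
        using that M(2) permutations_of_multisetD[OF that(1)] by (metis nth_mem set_mset_mset size_mset)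
      then show "regular (as ! i) (xs ! i)"
        using assms(1) M(1) that(2) by (auto simp: free_reg_def)
      show "xs ! i \<noteq> P" using assms(2) that(2) by auto
    qed
    then have "(\<Sum>as \<in> permutations_of_multiset M. \<Prod>i < length xs. value_at (xs ! i) (as ! i)) =
        (\<Sum>as \<in> permutations_of_multiset M. \<Prod>i < length xs. coef u (as ! i) (xs ! i))"
      by (intro sum.cong prod.cong) auto
    then show "Poly_Mapping.lookup p M * contract xs (W_of (Poly_Mapping.single M 1)) =
       fact (length xs) * (Poly_Mapping.lookup p M *
        (\<Sum>as \<in> permutations_of_multiset M. \<Prod>i < length xs. coef u (as ! i) (xs ! i)) / ?c M)"
      using M(2) by (simp add: contract_monomial)
  qed
  also have "\<dots> = fact (length xs) * free_polydiff u p xs"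
    by (simp add: free_polydiff_def sum_distrib_left)
  finally show ?thesis by simp
qed

text \<open>
  Contraction is defined on \<open>W\<close>; therefore the component does not depend on the representative, and it
  is linear in \<open>w\<close>.
\<close>

theorem polydiff_eq_contract:
  assumes "w \<in> W_reg (set xs)" "P \<notin> set xs"
  shows "polydiff u w xs = contract xs w / fact (length xs)"
  unfolding polydiff_def
proof (rule the_equality)
  from assms(1) show "\<exists>p\<in>free_reg (set xs). w = W_of p \<and> contract xs w / fact (length xs) = free_polydiff u p xs"
    using free_polydiff_eq_contract[OF _ assms(2)] by (auto simp: W_reg_def)
qed (use free_polydiff_eq_contract[OF _ assms(2)] in auto)

text \<open>
  The Leibniz rule: exactly one of the points is used up by the factor \<open>\<omega>\<close> of degree 1.
\<close>

lemma contract_mult_linear: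
  assumes "\<And>x. x \<in> set xs \<Longrightarrow> der (value_at x) \<omega> = cW (\<kappa> x)" "aug \<omega> = 0"
  shows "contract xs (\<omega> * w) = (\<Sum>j<length xs. \<kappa> (xs ! j) * contract (del_nth j xs) w)"
  using assms(1)
proof (induction xs arbitrary: w)
  case Nil
  then show ?case by (simp add: aug_simps assms(2))
next
  case (Cons x xs)
  have "contract (x # xs) (\<omega> * w) = \<kappa> x * contract xs w + contract xs (\<omega> * der (value_at x) w)"
    using Cons.prems[of x] by (simp add: der_mult[OF linear_value_at] contract_add contract_cW_mult)
  also have "contract xs (\<omega> * der (value_at x) w) = (\<Sum>j<length xs. \<kappa> (xs ! j) * contract (del_nth j xs) (der (value_at x) w))"
    by (rule Cons.IH) (use Cons.prems in auto)
  finally show ?case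
    by (simp add: sum.lessThan_Suc_shift del_nth_simps del: sum.lessThan_Suc)
qed

end

section \<open>Polynomial functions\<close>

definition monom_eval :: "complex list \<Rightarrow> (nat \<Rightarrow>\<^sub>0 nat) \<Rightarrow> complex" where
  "monom_eval ys k = (\<Prod>i < length ys. ys ! i ^ Poly_Mapping.lookup k i)"

lemma mpoly_eval_alt: "mpoly_eval N ys = (\<Sum>k\<in>Poly_Mapping.keys N. Poly_Mapping.lookup N k * monom_eval ys k)"
  by (simp add: mpoly_eval_def monom_eval_def)

lemma mpoly_eval_add: "mpoly_eval (p + q) ys = mpoly_eval p ys + mpoly_eval q ys"
  unfolding mpoly_eval_alt
  by (rule sum_keys_add[of "\<lambda>k x. x * monom_eval ys k"]) (simp_all add: distrib_right)

lemma mpoly_eval_0: "mpoly_eval 0 ys = 0"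
  by (simp add: mpoly_eval_def)

lemma mpoly_eval_sum: "mpoly_eval (sum f A) ys = (\<Sum>a\<in>A. mpoly_eval (f a) ys)"
  by (induction A rule: infinite_finite_induct) (simp_all add: mpoly_eval_0 mpoly_eval_add)

lemma mpoly_eval_single: "mpoly_eval (Poly_Mapping.single k x) ys = x * monom_eval ys k"
  by (cases "x = 0") (simp_all add: mpoly_eval_alt)

lemma monom_eval_add: "monom_eval ys (k + l) = monom_eval ys k * monom_eval ys l"
  by (simp add: monom_eval_def lookup_add power_add prod.distrib)

lemma mpoly_eval_mult: "mpoly_eval (p * q) ys = mpoly_eval p ys * mpoly_eval q ys"
proof -
  let ?s = "\<lambda>p M. Poly_Mapping.single M (Poly_Mapping.lookup p M)"
  have "p * q = sum (?s p) (Poly_Mapping.keys p) * sum (?s q) (Poly_Mapping.keys q)"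
    by (simp flip: poly_mapping_sum_monomials)
  then have "mpoly_eval (p * q) ys = (\<Sum>M\<in>Poly_Mapping.keys p. \<Sum>N\<in>Poly_Mapping.keys q. mpoly_eval (?s p M * ?s q N) ys)"
    by (simp only: sum_product mpoly_eval_sum)
  also have "\<dots> = mpoly_eval p ys * mpoly_eval q ys"
    unfolding mpoly_eval_alt[of p] mpoly_eval_alt[of q] sum_product
    by (intro sum.cong refl) (simp add: mult_single mpoly_eval_single monom_eval_add mult_ac)
  finally show ?thesis .
qed

definition polyfun :: "nat \<Rightarrow> (complex list \<Rightarrow> complex) \<Rightarrow> bool" where
  "polyfun m g \<longleftrightarrow> (\<exists>N. \<forall>ys. length ys = m \<longrightarrow> mpoly_eval N ys = g ys)"

named_theorems polyfun_intros

lemma polyfun_const [polyfun_intros]: "polyfun m (\<lambda>_. x)"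
  unfolding polyfun_def
  by (rule exI[of _ "Poly_Mapping.single 0 x"]) (simp add: mpoly_eval_single monom_eval_def)

lemma polyfun_nth [polyfun_intros]:
  assumes "i < m"
  shows "polyfun m (\<lambda>ys. ys ! i)"
  unfolding polyfun_def
proof (rule exI[of _ "Poly_Mapping.single (Poly_Mapping.single i 1) 1"], intro allI impI)
  fix ys :: "complex list" assume ys: "length ys = m"
  have "monom_eval ys (Poly_Mapping.single i 1) = (\<Prod>j<length ys. if j = i then ys ! j else 1)"
    unfolding monom_eval_def by (intro prod.cong) (auto simp: lookup_single when_def)
  also have "\<dots> = ys ! i"
    using assms ys by (simp add: prod.delta)
  finally show "mpoly_eval (Poly_Mapping.single (Poly_Mapping.single i 1) 1) ys = ys ! i"
    by (simp add: mpoly_eval_single)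
qed

lemma polyfun_add [polyfun_intros]: "polyfun m f \<Longrightarrow> polyfun m g \<Longrightarrow> polyfun m (\<lambda>ys. f ys + g ys)"
  unfolding polyfun_def by (metis mpoly_eval_add)

lemma polyfun_mult [polyfun_intros]: "polyfun m f \<Longrightarrow> polyfun m g \<Longrightarrow> polyfun m (\<lambda>ys. f ys * g ys)"
  unfolding polyfun_def by (metis mpoly_eval_mult)

lemma polyfun_uminus [polyfun_intros]: "polyfun m f \<Longrightarrow> polyfun m (\<lambda>ys. - f ys)"
  using polyfun_mult[OF polyfun_const[of m "-1"]] by simp

lemma polyfun_diff [polyfun_intros]: "polyfun m f \<Longrightarrow> polyfun m g \<Longrightarrow> polyfun m (\<lambda>ys. f ys - g ys)"
  using polyfun_add[OF _ polyfun_uminus, of m f g] by simp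

lemma polyfun_power [polyfun_intros]: "polyfun m f \<Longrightarrow> polyfun m (\<lambda>ys. f ys ^ n)"
  by (induction n) (auto intro: polyfun_intros)

lemma polyfun_sum [polyfun_intros]: "(\<And>a. a \<in> A \<Longrightarrow> polyfun m (f a)) \<Longrightarrow> polyfun m (\<lambda>ys. \<Sum>a\<in>A. f a ys)"
  by (induction A rule: infinite_finite_induct) (auto intro: polyfun_intros)

lemma polyfun_prod [polyfun_intros]: "(\<And>a. a \<in> A \<Longrightarrow> polyfun m (f a)) \<Longrightarrow> polyfun m (\<lambda>ys. \<Prod>a\<in>A. f a ys)"
  by (induction A rule: infinite_finite_induct) (auto intro: polyfun_intros)

lemma polyfun_poly [polyfun_intros]: "polyfun m f \<Longrightarrow> polyfun m (\<lambda>ys. poly p (f ys))"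
  by (induction p) (auto intro!: polyfun_intros)

lemma polyfun_cong: "polyfun m f \<Longrightarrow> (\<And>ys. length ys = m \<Longrightarrow> f ys = g ys) \<Longrightarrow> polyfun m g"
  unfolding polyfun_def by metis

lemma polyfun_compose:
  assumes g: "polyfun (length hs) g" and h: "\<And>h. h \<in> set hs \<Longrightarrow> polyfun m h"
  shows "polyfun m (\<lambda>ys. g (map (\<lambda>h. h ys) hs))"
proof -
  obtain N where N: "\<And>ys. length ys = length hs \<Longrightarrow> mpoly_eval N ys = g ys"
    using g by (auto simp: polyfun_def)
  have "polyfun m (\<lambda>ys. \<Sum>k\<in>Poly_Mapping.keys N. Poly_Mapping.lookup N k * (\<Prod>i<length hs. (hs ! i) ys ^ Poly_Mapping.lookup k i))"
    by (intro polyfun_intros h) auto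
  then show ?thesis
    by (rule polyfun_cong) (simp add: mpoly_eval_def flip: N)
qed

lemma polyfun_del_nth:
  assumes "polyfun m g" "j < m"
  shows "polyfun (Suc m) (\<lambda>ys. g (hd ys # del_nth j (tl ys)))"
proof -
  define hs where "hs = map (\<lambda>i ys. ys ! i :: complex) (0 # del_nth j [1..<Suc m])"
  have len: "length hs = m"
    using assms(2) by (simp add: hs_def length_del_nth)
  have "polyfun (Suc m) (\<lambda>ys. g (map (\<lambda>h. h ys) hs))"
  proof (rule polyfun_compose)
    show "polyfun (length hs) g" using assms(1) len by simp
    fix h assume "h \<in> set hs"
    then show "polyfun (Suc m) h"
      using set_del_nth[of j "[1..<Suc m]"] by (auto simp: hs_def intro!: polyfun_nth)
  qed
  then show ?thesis
  proof (rule polyfun_cong)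
    fix ys :: "complex list" assume "length ys = Suc m"
    then obtain y0 ys' where ys: "ys = y0 # ys'" "length ys' = m" by (cases ys) auto
    have "map ((!) ys) [1..<Suc m] = ys'"
      by (rule nth_equalityI) (use ys in \<open>simp_all del: upt_Suc\<close>)
    then show "g (map (\<lambda>h. h ys) hs) = g (hd ys # del_nth j (tl ys))"
      using ys map_del_nth[of "(!) ys" j "[1..<Suc m]"] by (simp add: hs_def comp_def del: upt_Suc)
  qed
qed

lemma polyfun_pair:
  assumes "polyfun 2 g" "i < m" "j < m"
  shows "polyfun m (\<lambda>ys. g [ys ! i, ys ! j])"
  using polyfun_compose[of "[\<lambda>ys. ys ! i, \<lambda>ys. ys ! j]" g m] assms
  by (auto intro: polyfun_nth simp: numeral_2_eq_2)

lemma polyfun_analytic: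
  assumes "polyfun (Suc (length ys)) g"
  shows "(\<lambda>t. g (t # ys)) analytic_on A"
proof -
  obtain N where N: "\<And>zs. length zs = Suc (length ys) \<Longrightarrow> mpoly_eval N zs = g zs"
    using assms by (auto simp: polyfun_def)
  have "(\<lambda>t. mpoly_eval N (t # ys)) analytic_on A"
    unfolding mpoly_eval_def length_Cons prod.lessThan_Suc_shift
    by (auto intro!: analytic_intros)
  then show ?thesis
    by (simp add: N)
qed

section \<open>Expansions at a point\<close>

lemma sum_common_denominator:
  fixes t e c :: "'a \<Rightarrow> complex"
  assumes "finite J" "\<And>j. j \<in> J \<Longrightarrow> t j * e j = c j"
  shows "(\<Sum>j\<in>J. t j) * (\<Prod>j\<in>J. e j) = (\<Sum>j\<in>J. c j * (\<Prod>k\<in>J - {j}. e k))"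
  unfolding sum_distrib_right
proof (intro sum.cong refl)
  fix j assume j: "j \<in> J"
  have "t j * (\<Prod>j\<in>J. e j) = t j * e j * (\<Prod>k\<in>J - {j}. e k)"
    by (simp add: prod.remove[OF assms(1) j] mult.assoc)
  then show "t j * (\<Prod>j\<in>J. e j) = c j * (\<Prod>k\<in>J - {j}. e k)"
    using assms(2)[OF j] by simp
qed

text \<open>
  The numerator of the difference quotient is divisible by \<open>y - y1\<close>, so the denominator is unchanged and
  still does not vanish at \<open>y1\<close>.
\<close>

lemma fraction_divided_difference:
  fixes p q :: "complex poly"
  assumes "poly q y1 \<noteq> 0"
  obtains p' where "\<And>y. poly q y \<noteq> 0 \<Longrightarrow>
    poly p y / poly q y = poly p y1 / poly q y1 + (y - y1) * (poly p' y / poly q y)"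
proof -
  define k where "k = poly p y1 / poly q y1"
  have "poly (p - smult k q) y1 = 0"
    using assms by (simp add: k_def)
  then have "[:- y1, 1:] dvd p - smult k q"
    using poly_eq_0_iff_dvd by blast
  then obtain p' where "p - smult k q = [:- y1, 1:] * p'" ..
  then have "poly (p - smult k q) y = poly ([:- y1, 1:] * p') y" for y
    by simp
  then have *: "poly p y = k * poly q y + (y - y1) * poly p' y" for y
    by (simp add: algebra_simps)
  show ?thesis
  proof (rule that[of p'])
    fix y assume "poly q y \<noteq> 0"
    then show "poly p y / poly q y = poly p y1 / poly q y1 + (y - y1) * (poly p' y / poly q y)"
      unfolding k_def[symmetric] *[of y] by (simp add: add_divide_distrib)
  qed
qed

lemma second_order_expansion:
  assumes r: "r analytic_on {s}"
    and f: "\<forall>\<^sub>F t in nhds s. f t = k0 + (t - s) * k1 + (t - s)\<^sup>2 * r t"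
  shows "f analytic_on {s}" "deriv f s = k1" "(deriv ^^ 2) f s = 2 * r s"
proof -
  define g where "g = (\<lambda>t. k0 + (t - s) * k1 + (t - s)\<^sup>2 * r t)"
  have g: "g analytic_on {s}"
    unfolding g_def by (intro analytic_intros r)
  then show "f analytic_on {s}"
    using analytic_at_cong[of f g s s] f by (simp add: g_def)
  obtain S where S: "open S" "s \<in> S" "r holomorphic_on S"
    using r by (auto simp: analytic_at)
  have dr: "(r has_field_derivative deriv r t) (at t)" if "t \<in> S" for t
    by (rule holomorphic_derivI[OF S(3,1) that])
  have dg: "deriv g t = k1 + (2 * (t - s) * r t + (t - s)\<^sup>2 * deriv r t)" if "t \<in> S" for t
    unfolding g_def
    by (rule DERIV_imp_deriv) (auto intro!: derivative_eq_intros dr[OF that] simp: algebra_simps)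
  have "deriv f s = deriv g s"
    by (rule deriv_cong_ev) (use f in \<open>auto simp: g_def\<close>)
  then show "deriv f s = k1"
    using dg[OF S(2)] by simp
  have "\<forall>\<^sub>F t in nhds s. deriv g t = k1 + (2 * (t - s) * r t + (t - s)\<^sup>2 * deriv r t)"
    using eventually_nhds_in_open[OF S(1,2)] by eventually_elim (simp add: dg)
  then have "deriv (deriv g) s = deriv (\<lambda>t. k1 + (2 * (t - s) * r t + (t - s)\<^sup>2 * deriv r t)) s"
    by (rule deriv_cong_ev) simp
  also have "\<dots> = 2 * r s"
  proof (rule DERIV_imp_deriv)
    have "deriv r analytic_on {s}"
      using r by (rule analytic_deriv)
    then have ddr: "(deriv r has_field_derivative deriv (deriv r) s) (at s)"
      by (simp add: DERIV_deriv_iff_field_differentiable analytic_on_imp_differentiable_at)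
    show "((\<lambda>t. k1 + (2 * (t - s) * r t + (t - s)\<^sup>2 * deriv r t)) has_field_derivative 2 * r s) (at s)"
      by (auto intro!: derivative_eq_intros dr[OF S(2)] ddr)
  qed
  finally have "(deriv ^^ 2) g s = 2 * r s"
    by (simp add: numeral_2_eq_2)
  moreover have "(deriv ^^ 2) f s = (deriv ^^ 2) g s"
    by (rule higher_deriv_cong_ev) (use f in \<open>auto simp: g_def\<close>)
  ultimately show "(deriv ^^ 2) f s = 2 * r s" by simp
qed

lemma infinite_pline: "infinite (UNIV :: pline set)"
proof
  assume "finite (UNIV :: pline set)"
  then have "finite (range Fin)" by (rule rev_finite_subset) auto
  then have "finite (UNIV :: complex set)"
    by (rule finite_imageD) (auto simp: inj_def)
  then show False using infinite_UNIV_char_0 by blast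
qed

lemma cW_cancel: "a * b = 1 \<Longrightarrow> cW a * (cW b * w) = w"
  by (metis cW_simps(2,4) mult.assoc mult_1)

section \<open>Rational families of elements of the symmetric algebra\<close>

locale pointed_line = coordinate_line +
  fixes z1 :: pline
  assumes z1: "z1 \<noteq> P"
begin

text \<open>
  The point \<open>z\<close> is generic or equal to the limit point \<open>z1\<close>, and the points in \<open>X\<close> are generic and
  different from \<open>z\<close>.  The case \<open>z = z1\<close> is allowed even when \<open>z1 \<in> A\<close>.
\<close>

definition admissible :: "pline set \<Rightarrow> pline \<Rightarrow> pline set \<Rightarrow> bool" where
  "admissible A z X \<longleftrightarrow> (z = z1 \<or> z \<notin> A) \<and> X \<inter> A = {} \<and> z \<notin> X"

lemma admissible_mono: "admissible A z X \<Longrightarrow> B \<subseteq> A \<Longrightarrow> Y \<subseteq> X \<Longrightarrow> admissible B z Y"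
  by (auto simp: admissible_def)

text \<open>
  Rational functions of \<open>u z\<close> that are regular at \<open>z1\<close>.
\<close>

definition rational_scalar :: "(pline \<Rightarrow> complex) \<Rightarrow> bool" where
  "rational_scalar r \<longleftrightarrow> (\<exists>p q A. finite A \<and> poly q (u z1) \<noteq> 0 \<and>
     (\<forall>z. z = z1 \<or> z \<notin> A \<longrightarrow> r z * poly q (u z) = poly p (u z)))"

lemma rational_scalar_const: "rational_scalar (\<lambda>_. c)"
  unfolding rational_scalar_def by (rule exI[of _ "[:c:]"], rule exI[of _ 1], rule exI[of _ "{}"]) simp

lemma rational_scalar_uminus: "rational_scalar r \<Longrightarrow> rational_scalar (\<lambda>z. - r z)"
  unfolding rational_scalar_def by (elim exE) (metis minus_mult_left poly_minus)

text \<open>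
  Up to the factor \<open>m!\<close>, the component of degree \<open>m\<close> of \<open>F\<close> is \<open>n / d\<close>, without pole at \<open>z = z1\<close>.  As \<open>F z1\<close> is included, it is
  the limit.  The denominator is asked to be nonzero for all generic points, not merely not
  identically zero, so that products of denominators keep the property.
\<close>

definition represents ::
  "(pline \<Rightarrow> W) \<Rightarrow> nat \<Rightarrow> (complex list \<Rightarrow> complex) \<Rightarrow> (complex list \<Rightarrow> complex) \<Rightarrow> pline set \<Rightarrow> bool" where
  "represents F m n d A \<longleftrightarrow> finite A \<and> polyfun (Suc m) n \<and> polyfun (Suc m) d \<and>
     (\<forall>z xs. length xs = m \<longrightarrow> admissible A z (set xs) \<longrightarrow>
        F z \<in> W_reg (set xs) \<and> d (u z1 # map u xs) \<noteq> 0 \<and>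
        contract xs (F z) * d (u z # map u xs) = n (u z # map u xs))"

lemma representsI:
  assumes "finite A" "polyfun (Suc m) n" "polyfun (Suc m) d"
    "\<And>z xs. length xs = m \<Longrightarrow> admissible A z (set xs) \<Longrightarrow> F z \<in> W_reg (set xs)"
    "\<And>z xs. length xs = m \<Longrightarrow> admissible A z (set xs) \<Longrightarrow> d (u z1 # map u xs) \<noteq> 0"
    "\<And>z xs. length xs = m \<Longrightarrow> admissible A z (set xs) \<Longrightarrow> contract xs (F z) * d (u z # map u xs) = n (u z # map u xs)"
  shows "represents F m n d A"
  using assms unfolding represents_def by blast

lemma representsD:
  assumes "represents F m n d A"
  shows "finite A" "polyfun (Suc m) n" "polyfun (Suc m) d"
    "\<And>z xs. length xs = m \<Longrightarrow> admissible A z (set xs) \<Longrightarrow> F z \<in> W_reg (set xs)"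
    "\<And>z xs. length xs = m \<Longrightarrow> admissible A z (set xs) \<Longrightarrow> d (u z1 # map u xs) \<noteq> 0"
    "\<And>z xs. length xs = m \<Longrightarrow> admissible A z (set xs) \<Longrightarrow> contract xs (F z) * d (u z # map u xs) = n (u z # map u xs)"
  using assms unfolding represents_def by blast+

definition rational_family :: "(pline \<Rightarrow> W) \<Rightarrow> bool" where
  "rational_family F \<longleftrightarrow> (\<forall>m. \<exists>n d A. represents F m n d A)"

lemma rational_familyE:
  assumes "rational_family F"
  obtains n d A where "represents F m n d A"
  using assms unfolding rational_family_def by blast

lemma rational_familyI:
  assumes "\<And>m. \<exists>n d A. represents F m n d A"
  shows "rational_family F"
  using assms unfolding rational_family_def by blast

lemma rational_family_add:
  assumes "rational_family F" "rational_family G"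
  shows "rational_family (\<lambda>z. F z + G z)"
proof (rule rational_familyI)
  fix m
  obtain n d A where "represents F m n d A"
    using rational_familyE[OF assms(1)] by blast
  note F = representsD[OF this]
  obtain n' d' A' where "represents G m n' d' A'"
    using rational_familyE[OF assms(2)] by blast
  note G = representsD[OF this]
  have "represents (\<lambda>z. F z + G z) m (\<lambda>ys. n ys * d' ys + n' ys * d ys) (\<lambda>ys. d ys * d' ys) (A \<union> A')"
  proof (rule representsI)
    fix z xs assume xs: "length xs = m" and "admissible (A \<union> A') z (set xs)"
    then have adm: "admissible A z (set xs)" "admissible A' z (set xs)"
      by (auto intro: admissible_mono)
    show "F z + G z \<in> W_reg (set xs)"
      by (intro W_reg_add F(4) G(4) xs adm)
    show "d (u z1 # map u xs) * d' (u z1 # map u xs) \<noteq> 0"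
      using F(5)[OF xs adm(1)] G(5)[OF xs adm(2)] by simp
    show "contract xs (F z + G z) * (d (u z # map u xs) * d' (u z # map u xs)) =
       n (u z # map u xs) * d' (u z # map u xs) + n' (u z # map u xs) * d (u z # map u xs)"
      unfolding contract_add F(6)[OF xs adm(1), symmetric] G(6)[OF xs adm(2), symmetric]
      by (simp add: algebra_simps)
  qed (use F(1-3) G(1-3) in \<open>auto intro!: polyfun_intros\<close>)
  then show "\<exists>n d A. represents (\<lambda>z. F z + G z) m n d A" by blast
qed

lemma rational_family_scale:
  assumes "rational_scalar r" "rational_family F"
  shows "rational_family (\<lambda>z. cW (r z) * F z)"
proof (rule rational_familyI)
  fix m
  obtain n d A where "represents F m n d A"
    using rational_familyE[OF assms(2)] by blast
  note F = representsD[OF this]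
  obtain p q B where r: "finite B" "poly q (u z1) \<noteq> 0" "\<And>z. z = z1 \<or> z \<notin> B \<Longrightarrow> r z * poly q (u z) = poly p (u z)"
    using assms(1) unfolding rational_scalar_def by metis
  have "represents (\<lambda>z. cW (r z) * F z) m (\<lambda>ys. poly p (ys ! 0) * n ys) (\<lambda>ys. poly q (ys ! 0) * d ys) (A \<union> B)"
  proof (rule representsI)
    fix z xs assume xs: "length xs = m" and adm': "admissible (A \<union> B) z (set xs)"
    then have adm: "admissible A z (set xs)"
      by (auto intro: admissible_mono)
    have rz: "r z * poly q (u z) = poly p (u z)"
      using adm' by (intro r(3)) (auto simp: admissible_def)
    show "cW (r z) * F z \<in> W_reg (set xs)"
      by (intro W_reg_mult W_reg_cW F(4) xs adm)
    show "poly q ((u z1 # map u xs) ! 0) * d (u z1 # map u xs) \<noteq> 0"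
      using F(5)[OF xs adm] r(2) by simp
    show "contract xs (cW (r z) * F z) * (poly q ((u z # map u xs) ! 0) * d (u z # map u xs)) =
       poly p ((u z # map u xs) ! 0) * n (u z # map u xs)"
      unfolding contract_cW_mult F(6)[OF xs adm, symmetric] nth_Cons_0 rz[symmetric]
      by (simp add: algebra_simps)
  qed (use F(1-3) r(1) in \<open>auto intro!: polyfun_intros\<close>)
  then show "\<exists>n d A. represents (\<lambda>z. cW (r z) * F z) m n d A" by blast
qed

lemma rational_family_one: "rational_family (\<lambda>_. 1)"
proof (rule rational_familyI)
  fix m
  have "represents (\<lambda>_. 1) m (\<lambda>_. if m = 0 then 1 else 0) (\<lambda>_. 1) {}"
    by (rule representsI) (auto simp: contract_1 W_reg_1 intro: polyfun_const)
  then show "\<exists>n d A. represents (\<lambda>_. 1) m n d A" by blast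
qed

text \<open>
  Families of elements of degree 1 whose evaluation at \<open>x\<close> is a rational function of \<open>u z\<close> and \<open>u x\<close>
  without pole along \<open>z = z1\<close>.  They need not come from a single form for each \<open>z\<close>, which saves the
  construction of forms by addition.
\<close>

definition linear_family :: "(pline \<Rightarrow> W) \<Rightarrow> bool" where
  "linear_family \<omega> \<longleftrightarrow> (\<forall>z. aug (\<omega> z) = 0) \<and> (\<exists>n d A. finite A \<and> polyfun 2 n \<and> polyfun 2 d \<and>
     (\<forall>z X. admissible A z X \<longrightarrow> \<omega> z \<in> W_reg X) \<and>
     (\<forall>z x. admissible A z {x} \<longrightarrow> d [u z1, u x] \<noteq> 0 \<and>
        (\<exists>\<kappa>. der (value_at x) (\<omega> z) = cW \<kappa> \<and> \<kappa> * d [u z, u x] = n [u z, u x])))"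

lemma linear_familyI:
  assumes "\<And>z. aug (\<omega> z) = 0" "finite A" "polyfun 2 n" "polyfun 2 d"
    "\<And>z X. admissible A z X \<Longrightarrow> \<omega> z \<in> W_reg X"
    "\<And>z x. admissible A z {x} \<Longrightarrow> d [u z1, u x] \<noteq> 0"
    "\<And>z x. admissible A z {x} \<Longrightarrow> \<exists>\<kappa>. der (value_at x) (\<omega> z) = cW \<kappa> \<and> \<kappa> * d [u z, u x] = n [u z, u x]"
  shows "linear_family \<omega>"
  unfolding linear_family_def
  by (rule conjI[OF allI[OF assms(1)]], rule exI[of _ n], rule exI[of _ d], rule exI[of _ A])
    (use assms(2-) in auto)

text \<open>
  By the Leibniz rule the component of degree \<open>m\<close> of the product is a sum over \<open>j\<close> of products of the
  value of \<open>\<omega>\<close> at the \<open>j\<close>-th point and the component of degree \<open>m - 1\<close> of \<open>F\<close> at the other points; the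
  summands are brought to a common denominator.
\<close>

lemma rational_family_linear_family_mult:
  assumes "linear_family \<omega>" "rational_family F"
  shows "rational_family (\<lambda>z. \<omega> z * F z)"
proof (rule rational_familyI)
  fix m
  obtain n0 d0 A0 where "represents F m n0 d0 A0"
    using rational_familyE[OF assms(2)] by blast
  note F0 = representsD[OF this]
  obtain n d A where "represents F (m - 1) n d A"
    using rational_familyE[OF assms(2)] by blast
  note F = representsD[OF this]
  have aug: "aug (\<omega> z) = 0" for z
    using assms(1) by (simp add: linear_family_def)
  obtain n' d' B where w: "finite B" "polyfun 2 n'" "polyfun 2 d'"
     "\<And>z X. admissible B z X \<Longrightarrow> \<omega> z \<in> W_reg X"
     "\<And>z x. admissible B z {x} \<Longrightarrow> d' [u z1, u x] \<noteq> 0"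
     "\<And>z x. admissible B z {x} \<Longrightarrow> \<exists>\<kappa>. der (value_at x) (\<omega> z) = cW \<kappa> \<and> \<kappa> * d' [u z, u x] = n' [u z, u x]"
    using assms(1) unfolding linear_family_def by metis
  \<comment> \<open>Denominator and numerator of the summand in which the point with index \<open>j\<close> goes to \<open>\<omega>\<close>.\<close>
  define e where "e j ys = d' [ys ! 0, ys ! Suc j] * d (hd ys # del_nth j (tl ys))" for j ys
  define c where "c j ys = n' [ys ! 0, ys ! Suc j] * n (hd ys # del_nth j (tl ys))" for j ys
  have poly: "polyfun (Suc m) (e j)" "polyfun (Suc m) (c j)" if "j < m" for j
  proof -
    have "Suc (m - 1) = m" using that by simp
    then show "polyfun (Suc m) (e j)" "polyfun (Suc m) (c j)"
      unfolding e_def c_def using F(2,3) w(2,3) that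
      by (auto intro!: polyfun_mult polyfun_pair polyfun_del_nth)
  qed
  have "represents (\<lambda>z. \<omega> z * F z) m (\<lambda>ys. \<Sum>j<m. c j ys * (\<Prod>k\<in>{..<m} - {j}. e k ys)) (\<lambda>ys. \<Prod>j<m. e j ys) (A \<union> B \<union> A0)"
  proof (rule representsI)
    fix z xs assume xs: "length xs = m" and adm': "admissible (A \<union> B \<union> A0) z (set xs)"
    then have adm: "admissible B z (set xs)" "admissible A0 z (set xs)"
      by (auto intro: admissible_mono)
    show "\<omega> z * F z \<in> W_reg (set xs)"
      by (intro W_reg_mult w(4) F0(4) xs adm)
    have admB: "admissible B z {x}" if "x \<in> set xs" for x
      by (rule admissible_mono[OF adm(1)]) (use that in auto)
    have len: "length (del_nth j xs) = m - 1" and admA: "admissible A z (set (del_nth j xs))" if "j < m" for j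
    proof -
      show "length (del_nth j xs) = m - 1" using that xs by (simp add: length_del_nth)
      show "admissible A z (set (del_nth j xs))"
        by (rule admissible_mono[OF adm']) (use set_del_nth[of j xs] in auto)
    qed
    have e_eq: "e j (u y # map u xs) = d' [u y, u (xs ! j)] * d (u y # map u (del_nth j xs))"
      and c_eq: "c j (u y # map u xs) = n' [u y, u (xs ! j)] * n (u y # map u (del_nth j xs))" if "j < m" for j y
      using that xs by (simp_all add: e_def c_def map_del_nth)
    show "(\<Prod>j<m. e j (u z1 # map u xs)) \<noteq> 0"
      using w(5)[OF admB] F(5)[OF len admA] xs by (simp add: e_eq)
    have "\<forall>x\<in>set xs. \<exists>\<kappa>. der (value_at x) (\<omega> z) = cW \<kappa> \<and> \<kappa> * d' [u z, u x] = n' [u z, u x]"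
      using w(6)[OF admB] by blast
    then obtain \<kappa> where \<kappa>: "\<And>x. x \<in> set xs \<Longrightarrow> der (value_at x) (\<omega> z) = cW (\<kappa> x)"
      "\<And>x. x \<in> set xs \<Longrightarrow> \<kappa> x * d' [u z, u x] = n' [u z, u x]"
      by metis
    have "contract xs (\<omega> z * F z) = (\<Sum>j<m. \<kappa> (xs ! j) * contract (del_nth j xs) (F z))"
      using contract_mult_linear[of xs "\<omega> z" \<kappa> "F z"] \<kappa>(1) aug xs by simp
    moreover have "(\<Sum>j<m. \<kappa> (xs ! j) * contract (del_nth j xs) (F z)) * (\<Prod>j<m. e j (u z # map u xs)) =
        (\<Sum>j<m. c j (u z # map u xs) * (\<Prod>k\<in>{..<m} - {j}. e k (u z # map u xs)))"
    proof (rule sum_common_denominator)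
      fix j assume "j \<in> {..<m}"
      then have j: "j < m" by simp
      then have "xs ! j \<in> set xs" using xs by simp
      then show "\<kappa> (xs ! j) * contract (del_nth j xs) (F z) * e j (u z # map u xs) = c j (u z # map u xs)"
        unfolding e_eq[OF j] c_eq[OF j] F(6)[OF len[OF j] admA[OF j], symmetric]
        by (simp flip: \<kappa>(2))
    qed auto
    ultimately show "contract xs (\<omega> z * F z) * (\<Prod>j<m. e j (u z # map u xs)) =
        (\<Sum>j<m. c j (u z # map u xs) * (\<Prod>k\<in>{..<m} - {j}. e k (u z # map u xs)))"
      by simp
  qed (use F(1) w(1) F0(1) poly in \<open>auto intro!: polyfun_intros\<close>)
  then show "\<exists>n d A. represents (\<lambda>z. \<omega> z * F z) m n d A" by blast
qed

lemma linear_family_iota: "linear_family (\<lambda>_. iota \<alpha>)"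
proof -
  obtain n q where nq: "\<And>z. z \<noteq> P \<Longrightarrow> regular \<alpha> z \<Longrightarrow> poly q (u z) \<noteq> 0"
    "\<And>z. z \<noteq> P \<Longrightarrow> regular \<alpha> z \<Longrightarrow> coef u \<alpha> z = poly n (u z) / poly q (u z)"
    using ucoef_rational[of \<alpha>] by metis
  show ?thesis
  proof (rule linear_familyI[where n = "\<lambda>ys. poly n (ys ! 1)" and d = "\<lambda>ys. poly q (ys ! 1)"
      and A = "insert P {p. \<not> regular \<alpha> p}"])
    fix z x assume "admissible (insert P {p. \<not> regular \<alpha> p}) z {x}"
    then have x: "x \<noteq> P" "regular \<alpha> x" by (auto simp: admissible_def)
    show "poly q ([u z1, u x] ! 1) \<noteq> 0"
      using nq(1)[OF x] by simp
    show "\<exists>\<kappa>. der (value_at x) (iota \<alpha>) = cW \<kappa> \<and> \<kappa> * poly q ([u z, u x] ! 1) = poly n ([u z, u x] ! 1)"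
      using nq[OF x] by (auto simp: der_iota[OF linear_value_at] value_at_regular x)
  qed (auto simp: finite_not_regular aug_simps admissible_def intro!: polyfun_intros W_reg_iota)
qed

lemma rational_family_const: "rational_family (\<lambda>_. w)"
proof -
  obtain A where "\<And>B. B \<inter> A = {} \<Longrightarrow> w \<in> W_reg B" using W_reg_cofinite[of w] by blast
  then have "w \<in> W_reg {}" by blast
  then show ?thesis
    by (induction rule: W_reg_induct)
      (auto intro: rational_family_one rational_family_add rational_family_scale[OF rational_scalar_const] rational_family_linear_family_mult[OF linear_family_iota])
qed

lemma linear_family_e: "linear_family (\<lambda>z. iota (e_form u z))"
proof (rule linear_familyI[where n = "\<lambda>ys. - 1" and d = "\<lambda>ys. (ys ! 1 - ys ! 0)\<^sup>2" and A = "{P, z1}"])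
  fix z X assume "admissible {P, z1} z X"
  then have "z \<noteq> P" "P \<notin> X" "z \<notin> X" using z1 by (auto simp: admissible_def)
  then show "iota (e_form u z) \<in> W_reg X"
    by (intro W_reg_iota e_form(1)) auto
next
  fix z x assume "admissible {P, z1} z {x}"
  then have x: "x \<noteq> P" "x \<noteq> z1" "x \<noteq> z" "z \<noteq> P" using z1 by (auto simp: admissible_def)
  then have ne: "u x \<noteq> u z1" "u x \<noteq> u z" using coordinate_inj z1 by auto
  then show "([u z1, u x] ! 1 - [u z1, u x] ! 0)\<^sup>2 \<noteq> 0" by simp
  have "der (value_at x) (iota (e_form u z)) = cW (- 1 / (u x - u z)\<^sup>2)"
    using x by (simp add: der_iota[OF linear_value_at] value_at_regular e_form)
  then show "\<exists>\<kappa>. der (value_at x) (iota (e_form u z)) = cW \<kappa> \<and> \<kappa> * ([u z, u x] ! 1 - [u z, u x] ! 0)\<^sup>2 = - 1"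
    using ne by (intro exI[of _ "- 1 / (u x - u z)\<^sup>2"]) simp
qed (auto simp: aug_simps intro!: polyfun_intros)

lemma rational_family_e: "rational_family F \<Longrightarrow> rational_family (\<lambda>z. iota (e_form u z) * F z)"
  by (rule rational_family_linear_family_mult[OF linear_family_e])

lemma rational_family_const_mult: "rational_family F \<Longrightarrow> rational_family (\<lambda>z. w * F z)"
proof -
  assume F: "rational_family F"
  obtain A where "\<And>B. B \<inter> A = {} \<Longrightarrow> w \<in> W_reg B" using W_reg_cofinite[of w] by blast
  then have "w \<in> W_reg {}" by blast
  then show ?thesis
  proof (induction rule: W_reg_induct)
    case one
    then show ?case using F by simp
  next
    case (scale c w)
    then show ?case using rational_family_scale[OF rational_scalar_const, of "\<lambda>z. w * F z" c] by (simp add: mult.assoc)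
  next
    case (add v w)
    then show ?case using rational_family_add by (simp add: distrib_right)
  next
    case (mult \<alpha> w)
    then show ?case using rational_family_linear_family_mult[OF linear_family_iota, of "\<lambda>z. w * F z" \<alpha>] by (simp add: mult.assoc)
  qed
qed

text \<open>
  Two divided differences at \<open>u z1\<close>.
\<close>

lemma value_at_expansion:
  assumes "regular \<alpha> z1"
  obtains r1 r2 A where "rational_scalar r2" "finite A"
    "\<And>z. z = z1 \<or> z \<notin> A \<Longrightarrow> value_at z \<alpha> = value_at z1 \<alpha> + (u z - u z1) * r1 + (u z - u z1)\<^sup>2 * r2 z"
proof -
  obtain n q where nq: "\<And>z. z \<noteq> P \<Longrightarrow> regular \<alpha> z \<Longrightarrow> poly q (u z) \<noteq> 0"
    "\<And>z. z \<noteq> P \<Longrightarrow> regular \<alpha> z \<Longrightarrow> coef u \<alpha> z = poly n (u z) / poly q (u z)"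
    using ucoef_rational[of \<alpha>] by metis
  have q1: "poly q (u z1) \<noteq> 0" using nq(1)[OF z1 assms] .
  obtain n1 where n1: "\<And>y. poly q y \<noteq> 0 \<Longrightarrow>
      poly n y / poly q y = poly n (u z1) / poly q (u z1) + (y - u z1) * (poly n1 y / poly q y)"
    using fraction_divided_difference[OF q1] by blast
  obtain n2 where n2: "\<And>y. poly q y \<noteq> 0 \<Longrightarrow>
      poly n1 y / poly q y = poly n1 (u z1) / poly q (u z1) + (y - u z1) * (poly n2 y / poly q y)"
    using fraction_divided_difference[OF q1] by blast
  define A where "A = insert P {p. \<not> regular \<alpha> p}"
  have reg: "z \<noteq> P" "regular \<alpha> z" if "z = z1 \<or> z \<notin> A" for z
    using that z1 assms by (auto simp: A_def)
  show ?thesis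
  proof (rule that[of "\<lambda>z. poly n2 (u z) / poly q (u z)" A "poly n1 (u z1) / poly q (u z1)"])
    show "rational_scalar (\<lambda>z. poly n2 (u z) / poly q (u z))"
      unfolding rational_scalar_def
    proof (rule exI[of _ n2], rule exI[of _ q], rule exI[of _ A], intro conjI allI impI)
      show "finite A" by (simp add: A_def finite_not_regular)
      show "poly q (u z1) \<noteq> 0" by (rule q1)
      show "poly n2 (u z) / poly q (u z) * poly q (u z) = poly n2 (u z)" if "z = z1 \<or> z \<notin> A" for z
        using nq(1)[OF reg[OF that]] by simp
    qed
    show "finite A" by (simp add: A_def finite_not_regular)
    fix z assume z: "z = z1 \<or> z \<notin> A"
    have "poly q (u z) \<noteq> 0" using nq(1) reg[OF z] by blast
    then have "value_at z \<alpha> = poly n (u z1) / poly q (u z1) + (u z - u z1) * (poly n1 (u z1) / poly q (u z1) + (u z - u z1) * (poly n2 (u z) / poly q (u z)))"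
      using n1[of "u z"] n2[of "u z"] by (simp add: value_at_regular reg[OF z] nq)
    also have "poly n (u z1) / poly q (u z1) = value_at z1 \<alpha>"
      by (simp add: value_at_regular z1 assms nq)
    finally show "value_at z \<alpha> = value_at z1 \<alpha> + (u z - u z1) * (poly n1 (u z1) / poly q (u z1)) + (u z - u z1)\<^sup>2 * (poly n2 (u z) / poly q (u z))"
      by (simp only: power2_eq_square ring_distribs mult.assoc add.assoc)
  qed
qed

lemma rational_scalar_value_at:
  assumes "regular \<alpha> z1"
  shows "rational_scalar (\<lambda>z. value_at z \<alpha>)"
proof -
  obtain n q where nq: "\<And>z. z \<noteq> P \<Longrightarrow> regular \<alpha> z \<Longrightarrow> poly q (u z) \<noteq> 0"
    "\<And>z. z \<noteq> P \<Longrightarrow> regular \<alpha> z \<Longrightarrow> coef u \<alpha> z = poly n (u z) / poly q (u z)"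
    using ucoef_rational[of \<alpha>] by metis
  show ?thesis
    unfolding rational_scalar_def
    by (rule exI[of _ n], rule exI[of _ q], rule exI[of _ "insert P {p. \<not> regular \<alpha> p}"])
      (use nq z1 assms in \<open>auto simp: finite_not_regular value_at_regular\<close>)
qed

text \<open>
  By induction on \<open>w\<close>: the derivation property expresses both families on \<open>\<alpha> w\<close> through those on \<open>w\<close>
  and the rational function \<open>value_at z \<alpha>\<close>.
\<close>

lemma rational_family_ins:
  assumes "w \<in> W_reg {z1}"
  shows "rational_family (\<lambda>z. ins z w)" "rational_family (\<lambda>z. ins z (ins z w))"
proof -
  have zero: "rational_family (\<lambda>_. 0)" by (rule rational_family_const)
  have "rational_family (\<lambda>z. ins z w) \<and> rational_family (\<lambda>z. ins z (ins z w))"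
    using assms
  proof (induction rule: W_reg_induct)
    case one
    then show ?case by (simp add: ins_simps zero)
  next
    case (scale c w)
    then show ?case by (simp add: ins_simps rational_family_const_mult)
  next
    case (add v w)
    then show ?case by (simp add: ins_simps rational_family_add)
  next
    case (mult \<alpha> w)
    then have r: "rational_scalar (\<lambda>z. - value_at z \<alpha>)"
      by (intro rational_scalar_uminus rational_scalar_value_at) auto
    have "ins z (iota \<alpha> * w) = cW (- value_at z \<alpha>) * w + iota \<alpha> * ins z w"
      "ins z (ins z (iota \<alpha> * w)) = (cW (- value_at z \<alpha>) * ins z w + cW (- value_at z \<alpha>) * ins z w) + iota \<alpha> * ins z (ins z w)" for z
      by (simp_all add: ins_simps)
    moreover have "rational_family (\<lambda>z. cW (- value_at z \<alpha>) * w + iota \<alpha> * ins z w)"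
      using mult by (intro rational_family_add rational_family_scale[OF r] rational_family_const rational_family_const_mult[of _ "iota \<alpha>"]) auto
    moreover have "rational_family (\<lambda>z. (cW (- value_at z \<alpha>) * ins z w + cW (- value_at z \<alpha>) * ins z w) + iota \<alpha> * ins z (ins z w))"
      using mult by (intro rational_family_add rational_family_scale[OF r] rational_family_const_mult[of _ "iota \<alpha>"]) auto
    ultimately show ?case by simp
  qed
  then show "rational_family (\<lambda>z. ins z w)" "rational_family (\<lambda>z. ins z (ins z w))" by auto
qed

section \<open>Second order jets\<close>

text \<open>
  A second order Taylor expansion at \<open>z1\<close> in the variable \<open>u z\<close> whose remainder is rational without pole
  at \<open>z1\<close>.  It yields both the derivatives and the cancellation of the poles.
\<close>

definition jet :: "(pline \<Rightarrow> W) \<Rightarrow> W \<Rightarrow> (pline \<Rightarrow> W) \<Rightarrow> bool" where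
  "jet F G R \<longleftrightarrow> rational_family R \<and> (\<exists>A. finite A \<and> (\<forall>z. z = z1 \<or> z \<notin> A \<longrightarrow>
     F z = F z1 + cW (u z - u z1) * G + cW ((u z - u z1)\<^sup>2) * R z))"

lemma jetI:
  assumes "rational_family R" "finite A"
    "\<And>z. z = z1 \<or> z \<notin> A \<Longrightarrow> F z = F z1 + cW (u z - u z1) * G + cW ((u z - u z1)\<^sup>2) * R z"
  shows "jet F G R"
  using assms unfolding jet_def by blast

lemma jetE:
  assumes "jet F G R"
  obtains A where "rational_family R" "finite A"
    "\<And>z. z = z1 \<or> z \<notin> A \<Longrightarrow> F z = F z1 + cW (u z - u z1) * G + cW ((u z - u z1)\<^sup>2) * R z"
  using assms unfolding jet_def by blast

lemma jet_add:
  assumes "jet F G R" "jet F' G' R'"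
  shows "jet (\<lambda>z. F z + F' z) (G + G') (\<lambda>z. R z + R' z)"
proof -
  obtain A where A: "rational_family R" "finite A"
    "\<And>z. z = z1 \<or> z \<notin> A \<Longrightarrow> F z = F z1 + cW (u z - u z1) * G + cW ((u z - u z1)\<^sup>2) * R z"
    using jetE[OF assms(1)] by blast
  obtain A' where A': "rational_family R'" "finite A'"
    "\<And>z. z = z1 \<or> z \<notin> A' \<Longrightarrow> F' z = F' z1 + cW (u z - u z1) * G' + cW ((u z - u z1)\<^sup>2) * R' z"
    using jetE[OF assms(2)] by blast
  show ?thesis
  proof (rule jetI[of _ "A \<union> A'"])
    fix z assume "z = z1 \<or> z \<notin> A \<union> A'"
    then have "F z = F z1 + cW (u z - u z1) * G + cW ((u z - u z1)\<^sup>2) * R z"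
      "F' z = F' z1 + cW (u z - u z1) * G' + cW ((u z - u z1)\<^sup>2) * R' z"
      using A(3)[of z] A'(3)[of z] by blast+
    then have "F z + F' z = (F z1 + cW (u z - u z1) * G + cW ((u z - u z1)\<^sup>2) * R z) +
       (F' z1 + cW (u z - u z1) * G' + cW ((u z - u z1)\<^sup>2) * R' z)"
      by (rule arg_cong2[where f = "(+)"])
    then show "F z + F' z = F z1 + F' z1 + cW (u z - u z1) * (G + G') + cW ((u z - u z1)\<^sup>2) * (R z + R' z)"
      by (simp only: distrib_left add_ac)
  qed (auto simp: A A' intro: rational_family_add)
qed

lemma jet_const_mult:
  assumes "jet F G R"
  shows "jet (\<lambda>z. w * F z) (w * G) (\<lambda>z. w * R z)"
proof -
  obtain A where A: "rational_family R" "finite A"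
    "\<And>z. z = z1 \<or> z \<notin> A \<Longrightarrow> F z = F z1 + cW (u z - u z1) * G + cW ((u z - u z1)\<^sup>2) * R z"
    using jetE[OF assms(1)] by blast
  show ?thesis
  proof (rule jetI[of _ A])
    fix z assume "z = z1 \<or> z \<notin> A"
    from A(3)[OF this] have "w * F z = w * (F z1 + cW (u z - u z1) * G + cW ((u z - u z1)\<^sup>2) * R z)"
      by (rule arg_cong)
    then show "w * F z = w * F z1 + cW (u z - u z1) * (w * G) + cW ((u z - u z1)\<^sup>2) * (w * R z)"
      by (simp only: distrib_left mult.left_commute)
  qed (auto simp: A intro: rational_family_const_mult)
qed

lemma jet_value_at:
  assumes "regular \<alpha> z1"
  shows "\<exists>G R. jet (\<lambda>z. cW (value_at z \<alpha>) * w) G R"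
proof -
  obtain r1 r2 A where r: "rational_scalar r2" "finite A"
    "\<And>z. z = z1 \<or> z \<notin> A \<Longrightarrow> value_at z \<alpha> = value_at z1 \<alpha> + (u z - u z1) * r1 + (u z - u z1)\<^sup>2 * r2 z"
    using value_at_expansion[OF assms] by metis
  have "jet (\<lambda>z. cW (value_at z \<alpha>) * w) (cW r1 * w) (\<lambda>z. cW (r2 z) * w)"
  proof (rule jetI[of _ A])
    fix z assume "z = z1 \<or> z \<notin> A"
    from r(3)[OF this] have "cW (value_at z \<alpha>) = cW (value_at z1 \<alpha>) + cW (u z - u z1) * cW r1 + cW ((u z - u z1)\<^sup>2) * cW (r2 z)"
      by (simp only: flip: cW_simps)
    then show "cW (value_at z \<alpha>) * w = cW (value_at z1 \<alpha>) * w + cW (u z - u z1) * (cW r1 * w) + cW ((u z - u z1)\<^sup>2) * (cW (r2 z) * w)"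
      by (simp only: distrib_right mult.assoc)
  qed (auto intro: r rational_family_scale rational_family_const)
  then show ?thesis by blast
qed

lemma jet_ins:
  assumes "w \<in> W_reg {z1}"
  shows "\<exists>G R. jet (\<lambda>z. ins z w) G R"
  using assms
proof (induction rule: W_reg_induct)
  case one
  have "jet (\<lambda>z. 0) 0 (\<lambda>z. 0)" by (rule jetI[of _ "{}"]) (auto intro: rational_family_const)
  then show ?case by (auto simp: ins_simps)
next
  case (scale c w)
  then obtain G R where "jet (\<lambda>z. ins z w) G R" by blast
  from jet_const_mult[OF this, of "cW c"] show ?case by (auto simp: ins_simps)
next
  case (add v w)
  then show ?case using jet_add by (simp add: ins_simps) blast
next
  case (mult \<alpha> w)
  then have "regular \<alpha> z1" by auto
  from jet_value_at[OF this, of w] obtain G R where "jet (\<lambda>z. cW (value_at z \<alpha>) * w) G R" by blast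
  from jet_const_mult[OF this, of "- 1"] have 1: "jet (\<lambda>z. cW (- value_at z \<alpha>) * w) (- G) (\<lambda>z. - R z)"
    by (simp add: cW_simps)
  from mult obtain G' R' where "jet (\<lambda>z. ins z w) G' R'" by blast
  from jet_add[OF 1 jet_const_mult[OF this, of "iota \<alpha>"]] show ?case
    by (auto simp: ins_simps)
qed

text \<open>
  The form \<open>- du / (u - e)\<^sup>2\<close> has at \<open>e = u z1\<close> the derivatives \<open>- 2 du / (u - e) ^ 3\<close> and
  \<open>- 6 du / (u - e) ^ 4\<close> with respect to \<open>e\<close>; half of the latter is the value of the remainder at \<open>z1\<close>.
\<close>

definition e_remainder :: "pline \<Rightarrow> W" where
  "e_remainder z = (if z = z1 then iota (pform (-3) 4 (u z1)) else
     cW (1 / (u z - u z1)\<^sup>2) * (iota (e_form u z) - iota (e_form u z1) - cW (u z - u z1) * iota (pform (-2) 3 (u z1))))"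

text \<open>
  The remainder of \<open>- 1 / (s - h)\<^sup>2\<close> at \<open>h = 0\<close>, where \<open>s\<close> stands for \<open>u x - u z1\<close> and \<open>h\<close> for
  \<open>u z - u z1\<close>: the factor \<open>h\<^sup>2\<close> cancels.
\<close>

lemma e_remainder_kernel:
  fixes s h :: complex
  assumes "s \<noteq> 0" "h \<noteq> 0" "s \<noteq> h"
  shows "1 / h\<^sup>2 * (- 1 / (s - h)\<^sup>2 - - 1 / s\<^sup>2 - h * (- 2 / s ^ 3)) * (s ^ 3 * (s - h)\<^sup>2) = - (3 * s - 2 * h)"
proof -
  define k where "k = s - h"
  have "k \<noteq> 0" using assms by (simp add: k_def)
  have "1 / h\<^sup>2 * (- 1 / k\<^sup>2 - - 1 / s\<^sup>2 - h * (- 2 / s ^ 3)) * (s ^ 3 * k\<^sup>2) =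
     (- (s ^ 3) + s * k\<^sup>2 + 2 * h * k\<^sup>2) / h\<^sup>2"
  proof -
    have "(- 1 / k\<^sup>2 - - 1 / s\<^sup>2 - h * (- 2 / s ^ 3)) * (s ^ 3 * k\<^sup>2) =
        - (1 / k\<^sup>2 * (s ^ 3 * k\<^sup>2)) + 1 / s\<^sup>2 * (s ^ 3 * k\<^sup>2) + h * (2 / s ^ 3 * (s ^ 3 * k\<^sup>2))"
      by (simp add: ring_distribs)
    also have "1 / k\<^sup>2 * (s ^ 3 * k\<^sup>2) = s ^ 3"
      using \<open>k \<noteq> 0\<close> by simp
    also have "1 / s\<^sup>2 * (s ^ 3 * k\<^sup>2) = s * k\<^sup>2"
      using assms(1) by (simp add: power2_eq_square power3_eq_cube)
    also have "2 / s ^ 3 * (s ^ 3 * k\<^sup>2) = 2 * k\<^sup>2"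
      using assms(1) by simp
    finally show ?thesis
      by (simp add: mult.assoc mult.left_commute)
  qed
  also have "- (s ^ 3) + s * k\<^sup>2 + 2 * h * k\<^sup>2 = - (3 * s - 2 * h) * h\<^sup>2"
    by (simp add: k_def algebra_simps power2_eq_square power3_eq_cube)
  finally show ?thesis
    using assms by (simp add: k_def)
qed

lemma linear_family_e_remainder: "linear_family e_remainder"
proof (rule linear_familyI[where n = "\<lambda>ys. - (3 * (ys ! 1 - u z1) - 2 * (ys ! 0 - u z1))"
    and d = "\<lambda>ys. (ys ! 1 - u z1) ^ 3 * (ys ! 1 - ys ! 0)\<^sup>2" and A = "{P, z1}"])
  show "aug (e_remainder z) = 0" for z
    by (simp add: e_remainder_def aug_simps)
next
  fix z X assume "admissible {P, z1} z X"
  then have *: "z \<noteq> P" "P \<notin> X" "z \<notin> X" "z1 \<notin> X" using z1 by (auto simp: admissible_def)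
  then have "u x \<noteq> u z1" if "x \<in> X" for x
    using that coordinate_inj z1 by metis
  with * show "e_remainder z \<in> W_reg X"
    unfolding e_remainder_def using z1 by (auto intro!: W_reg_intros e_form(1) pform(1))
next
  fix z x assume "admissible {P, z1} z {x}"
  then have x: "x \<noteq> P" "x \<noteq> z1" "x \<noteq> z" "z \<noteq> P" using z1 by (auto simp: admissible_def)
  then have ne: "u x \<noteq> u z1" "u x \<noteq> u z" using coordinate_inj z1 by auto
  then show "([u z1, u x] ! 1 - u z1) ^ 3 * ([u z1, u x] ! 1 - [u z1, u x] ! 0)\<^sup>2 \<noteq> 0" by simp
  have val: "value_at x (pform (-3) 4 (u z1)) = - 3 / (u x - u z1) ^ 4"
    "value_at x (pform (-2) 3 (u z1)) = - 2 / (u x - u z1) ^ 3"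
    "value_at x (e_form u z) = - 1 / (u x - u z)\<^sup>2"
    "value_at x (e_form u z1) = - 1 / (u x - u z1)\<^sup>2"
    using x ne z1 by (simp_all add: value_at_regular pform e_form)
  show "\<exists>\<kappa>. der (value_at x) (e_remainder z) = cW \<kappa> \<and>
     \<kappa> * (([u z, u x] ! 1 - u z1) ^ 3 * ([u z, u x] ! 1 - [u z, u x] ! 0)\<^sup>2) =
     - (3 * ([u z, u x] ! 1 - u z1) - 2 * ([u z, u x] ! 0 - u z1))"
  proof (cases "z = z1")
    case True
    have "der (value_at x) (e_remainder z) = cW (- 3 / (u x - u z1) ^ 4)"
      using True by (simp add: e_remainder_def der_iota[OF linear_value_at] val)
    moreover have "- 3 / (u x - u z1) ^ 4 * ((u x - u z1) ^ 3 * (u x - u z1)\<^sup>2) = - (3 * (u x - u z1))"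
    proof -
      have "- 3 / s ^ 4 * (s ^ 3 * s\<^sup>2) = - (3 * s)" if "s \<noteq> 0" for s :: complex
        using that by (simp add: field_simps eval_nat_numeral)
      then show ?thesis using ne by simp
    qed
    ultimately show ?thesis
      using True by (intro exI[of _ "- 3 / (u x - u z1) ^ 4"]) simp
  next
    case False
    define h where "h = u z - u z1"
    define s where "s = u x - u z1"
    have "h \<noteq> 0" "s \<noteq> 0" "s \<noteq> h" "u x - u z = s - h"
      using False x ne coordinate_inj z1 by (auto simp: h_def s_def)
    note sh = this
    have "der (value_at x) (e_remainder z) = cW (1 / h\<^sup>2) * (der (value_at x) (iota (e_form u z))
       - der (value_at x) (iota (e_form u z1)) - cW h * der (value_at x) (iota (pform (-2) 3 (u z1))))"
    proof -
      have diff: "der (value_at x) (v - w) = der (value_at x) v - der (value_at x) w" for v w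
        using der_add[OF linear_value_at, of x "v - w" w] by (simp add: algebra_simps)
      show ?thesis
        using False by (simp add: e_remainder_def diff der_cW_mult[OF linear_value_at] h_def)
    qed
    also have "\<dots> = cW (1 / h\<^sup>2 * (- 1 / (s - h)\<^sup>2 - - 1 / s\<^sup>2 - h * (- 2 / s ^ 3)))"
      unfolding der_iota[OF linear_value_at] val sh(4) s_def[symmetric] cW_simps ..
    finally have "der (value_at x) (e_remainder z) = cW (1 / h\<^sup>2 * (- 1 / (s - h)\<^sup>2 - - 1 / s\<^sup>2 - h * (- 2 / s ^ 3)))" .
    moreover note e_remainder_kernel[OF sh(2,1,3)]
    ultimately show ?thesis
      unfolding nth_Cons_0 One_nat_def nth_Cons_Suc sh(4) s_def[symmetric] h_def[symmetric] by blast
  qed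
qed (auto intro!: polyfun_intros)

lemma jet_e: "jet (\<lambda>z. iota (e_form u z) * w) (iota (pform (-2) 3 (u z1)) * w) (\<lambda>z. e_remainder z * w)"
proof (rule jetI[of _ "{P}"])
  fix z assume z: "z = z1 \<or> z \<notin> {P}"
  show "iota (e_form u z) * w = iota (e_form u z1) * w + cW (u z - u z1) * (iota (pform (-2) 3 (u z1)) * w)
     + cW ((u z - u z1)\<^sup>2) * (e_remainder z * w)"
  proof (cases "z = z1")
    case False
    then have "(u z - u z1)\<^sup>2 * (1 / (u z - u z1)\<^sup>2) = 1"
      using z coordinate_inj z1 by auto
    then have "cW ((u z - u z1)\<^sup>2) * e_remainder z = 
        iota (e_form u z) - iota (e_form u z1) - cW (u z - u z1) * iota (pform (-2) 3 (u z1))"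
      unfolding e_remainder_def if_not_P[OF False] by (rule cW_cancel)
    then have "cW ((u z - u z1)\<^sup>2) * (e_remainder z * w) =
        (iota (e_form u z) - iota (e_form u z1) - cW (u z - u z1) * iota (pform (-2) 3 (u z1))) * w"
      by (simp only: flip: mult.assoc)
    then show ?thesis
      by (simp add: algebra_simps)
  qed (simp add: cW_simps)
qed (auto intro: rational_family_linear_family_mult linear_family_e_remainder rational_family_const)

end

lemma cW_2: "cW 2 = 2"
  using cW_simps(3)[of 1 1] by (simp add: cW_simps(2))

context pointed_line
begin

lemma eventually_point_at:
  assumes "finite A"
  shows "\<forall>\<^sub>F t in nhds (u z1). point_at u P t = z1 \<or> point_at u P t \<notin> A"
proof -
  have "\<forall>\<^sub>F t in at (u z1). t \<notin> u ` A"
    using islimpt_finite[OF finite_imageI[OF assms]] islimpt_iff_eventually by blast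
  then have "\<forall>\<^sub>F t in at (u z1). point_at u P t = z1 \<or> point_at u P t \<notin> A"
    by eventually_elim (metis coordinate_point_at(1) image_eqI)
  then show ?thesis
    by (simp add: eventually_nhds_conv_at point_at_coordinate z1)
qed

text \<open>
  At fixed generic points, the expansion of the family becomes an expansion of its component as a
  function of \<open>t = u z\<close>, with remainder analytic at \<open>u z1\<close>.
\<close>

lemma jet_polydiff:
  assumes "jet F G R"
  shows "\<exists>A. finite A \<and> (\<forall>xs. length xs = m \<and> set xs \<inter> A = {} \<longrightarrow>
     G \<in> W_reg (set xs) \<and> R z1 \<in> W_reg (set xs) \<and>
     (\<forall>\<^sub>F t in nhds (u z1). F (point_at u P t) \<in> W_reg (set xs)) \<and>
     (\<exists>r. r analytic_on {u z1} \<and> r (u z1) = polydiff u (R z1) xs \<and>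
       (\<forall>\<^sub>F t in nhds (u z1). polydiff u (F (point_at u P t)) xs =
          polydiff u (F z1) xs + (t - u z1) * polydiff u G xs + (t - u z1)\<^sup>2 * r t)))"
proof -
  obtain A where R: "rational_family R" and A: "finite A"
    "\<And>z. z = z1 \<or> z \<notin> A \<Longrightarrow> F z = F z1 + cW (u z - u z1) * G + cW ((u z - u z1)\<^sup>2) * R z"
    using jetE[OF assms] by blast
  obtain n d B where "represents R m n d B"
    using rational_familyE[OF R] by blast
  note B = representsD[OF this]
  obtain A1 where A1: "finite A1" "\<And>X. X \<inter> A1 = {} \<Longrightarrow> G \<in> W_reg X"
    using W_reg_cofinite[of G] by blast
  obtain A2 where A2: "finite A2" "\<And>X. X \<inter> A2 = {} \<Longrightarrow> F z1 \<in> W_reg X"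
    using W_reg_cofinite[of "F z1"] by blast
  define C where "C = A \<union> B \<union> A1 \<union> A2 \<union> {P, z1}"
  have fin: "finite C" by (simp add: C_def A B(1) A1 A2)
  have reg: "G \<in> W_reg (set xs)" "F z1 \<in> W_reg (set xs)" "P \<notin> set xs" if "set xs \<inter> C = {}" for xs
    using that A1(2)[of "set xs"] A2(2)[of "set xs"] by (auto simp: C_def)
  have adm: "admissible B z (set xs)" if "set xs \<inter> C = {}" "z = z1 \<or> z \<notin> C \<union> set xs" for xs z
    using that by (auto simp: admissible_def C_def)
  have Fz: "F z = F z1 + cW (u z - u z1) * G + cW ((u z - u z1)\<^sup>2) * R z" if "z = z1 \<or> z \<notin> C \<union> set xs" for z xs
    by (rule A(2)) (use that in \<open>auto simp: C_def\<close>)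
  have F_reg: "F z \<in> W_reg (set xs)" if "length xs = m" "set xs \<inter> C = {}" "z = z1 \<or> z \<notin> C \<union> set xs" for z xs
    unfolding Fz[OF that(3)] by (intro W_reg_add W_reg_mult W_reg_cW reg[OF that(2)] B(4) that(1) adm that(2,3))
  have ev: "\<forall>\<^sub>F t in nhds (u z1). point_at u P t = z1 \<or> point_at u P t \<notin> C \<union> set xs" for xs
    by (rule eventually_point_at) (use fin in auto)
  show ?thesis
  proof (rule exI[of _ C], intro conjI allI impI)
    show "finite C" by (rule fin)
    fix xs assume "length xs = m \<and> set xs \<inter> C = {}"
    then have xs: "length xs = m" "set xs \<inter> C = {}" by auto
    show "G \<in> W_reg (set xs)" "R z1 \<in> W_reg (set xs)"
      using reg[OF xs(2)] B(4)[OF xs(1) adm[OF xs(2)]] by blast+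
    show "\<forall>\<^sub>F t in nhds (u z1). F (point_at u P t) \<in> W_reg (set xs)"
      using ev[of xs]
    proof eventually_elim
      case (elim t)
      then show ?case by (rule F_reg[OF xs])
    qed
    define r where "r t = n (t # map u xs) / (d (t # map u xs) * fact m)" for t
    have dan: "(\<lambda>t. d (t # map u xs)) analytic_on {u z1}" and nan: "(\<lambda>t. n (t # map u xs)) analytic_on {u z1}"
      by (rule polyfun_analytic, use B(2,3) xs(1) in simp)+
    have d1: "d (u z1 # map u xs) \<noteq> 0"
      using B(5)[OF xs(1) adm[OF xs(2)]] by blast
    have dev: "\<forall>\<^sub>F t in nhds (u z1). d (t # map u xs) \<noteq> 0"
      by (rule isCont_imp_eventually_nonzero) (use dan d1 analytic_at_imp_isCont in auto)
    have r: "r analytic_on {u z1}"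
      unfolding r_def by (intro analytic_intros dan nan) (use d1 in auto)
    have R_r: "polydiff u (R z) xs = r (u z)" if "z = z1 \<or> z \<notin> C \<union> set xs" "d (u z # map u xs) \<noteq> 0" for z
      using B(4,6)[OF xs(1) adm[OF xs(2) that(1)]] that(2) xs(1)
      by (simp add: polydiff_eq_contract reg[OF xs(2)] r_def field_simps)
    have "\<forall>\<^sub>F t in nhds (u z1). polydiff u (F (point_at u P t)) xs =
          polydiff u (F z1) xs + (t - u z1) * polydiff u G xs + (t - u z1)\<^sup>2 * r t"
      using ev[of xs] dev
    proof eventually_elim
      case (elim t)
      let ?z = "point_at u P t"
      have t: "u ?z = t" by (rule coordinate_point_at)
      have "contract xs (F ?z) = contract xs (F z1) + (t - u z1) * contract xs G + (t - u z1)\<^sup>2 * contract xs (R ?z)"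
        unfolding Fz[OF elim(1)] t by (simp add: contract_add contract_cW_mult)
      moreover have "polydiff u (F ?z) xs = contract xs (F ?z) / fact m" "polydiff u (F z1) xs = contract xs (F z1) / fact m"
        "polydiff u G xs = contract xs G / fact m" "polydiff u (R ?z) xs = contract xs (R ?z) / fact m"
        using polydiff_eq_contract F_reg[OF xs elim(1)] B(4)[OF xs(1) adm[OF xs(2) elim(1)]] reg[OF xs(2)] xs(1)
        by simp_all
      moreover have "polydiff u (R ?z) xs = r t"
        using R_r[OF elim(1)] elim(2) t by simp
      ultimately show ?case
        by (simp add: add_divide_distrib)
    qed
    moreover have "r (u z1) = polydiff u (R z1) xs"
      using R_r[of z1] d1 by simp
    ultimately show "\<exists>r. r analytic_on {u z1} \<and> r (u z1) = polydiff u (R z1) xs \<and>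
       (\<forall>\<^sub>F t in nhds (u z1). polydiff u (F (point_at u P t)) xs =
          polydiff u (F z1) xs + (t - u z1) * polydiff u G xs + (t - u z1)\<^sup>2 * r t)"
      using r by blast
  qed
qed

theorem jet_has_W_deriv:
  assumes "jet F G R"
  shows "has_W_deriv u P 1 F z1 G" "has_W_deriv u P 2 F z1 (2 * R z1)"
proof -
  have *: "\<exists>A. finite A \<and> (\<forall>xs. length xs = m \<and> set xs \<inter> A = {} \<longrightarrow>
      G \<in> W_reg (set xs) \<and> 2 * R z1 \<in> W_reg (set xs) \<and>
      (\<forall>\<^sub>F t in nhds (u z1). F (point_at u P t) \<in> W_reg (set xs)) \<and>
      (\<lambda>t. polydiff u (F (point_at u P t)) xs) analytic_on {u z1} \<and>
      (deriv ^^ 1) (\<lambda>t. polydiff u (F (point_at u P t)) xs) (u z1) = polydiff u G xs \<and>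
      (deriv ^^ 2) (\<lambda>t. polydiff u (F (point_at u P t)) xs) (u z1) = polydiff u (2 * R z1) xs)" for m
  proof -
    obtain A where A: "finite A" "\<forall>xs. length xs = m \<and> set xs \<inter> A = {} \<longrightarrow>
     G \<in> W_reg (set xs) \<and> R z1 \<in> W_reg (set xs) \<and>
     (\<forall>\<^sub>F t in nhds (u z1). F (point_at u P t) \<in> W_reg (set xs)) \<and>
     (\<exists>r. r analytic_on {u z1} \<and> r (u z1) = polydiff u (R z1) xs \<and>
       (\<forall>\<^sub>F t in nhds (u z1). polydiff u (F (point_at u P t)) xs =
          polydiff u (F z1) xs + (t - u z1) * polydiff u G xs + (t - u z1)\<^sup>2 * r t))"
      using jet_polydiff[OF assms, of m] by blast
    show ?thesis
    proof (rule exI[of _ "insert P A"], intro conjI allI impI)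
      show "finite (insert P A)" using A(1) by simp
      fix xs assume "length xs = m \<and> set xs \<inter> insert P A = {}"
      then have xs: "length xs = m" "set xs \<inter> A = {}" "P \<notin> set xs" by auto
      have R: "R z1 \<in> W_reg (set xs)" using A(2) xs by blast
      show "G \<in> W_reg (set xs)" using A(2) xs by blast
      show R2: "2 * R z1 \<in> W_reg (set xs)" by (intro W_reg_mult W_reg_numeral R)
      show "\<forall>\<^sub>F t in nhds (u z1). F (point_at u P t) \<in> W_reg (set xs)" using A(2) xs by blast
      obtain r where r: "r analytic_on {u z1}" "r (u z1) = polydiff u (R z1) xs"
        "\<forall>\<^sub>F t in nhds (u z1). polydiff u (F (point_at u P t)) xs =
            polydiff u (F z1) xs + (t - u z1) * polydiff u G xs + (t - u z1)\<^sup>2 * r t"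
        using A(2) xs by blast
      note deriv = second_order_expansion[OF r(1,3)]
      show "(\<lambda>t. polydiff u (F (point_at u P t)) xs) analytic_on {u z1}"
        by (rule deriv)
      show "(deriv ^^ 1) (\<lambda>t. polydiff u (F (point_at u P t)) xs) (u z1) = polydiff u G xs"
        using deriv(2) by simp
      have "contract xs (2 * R z1) = 2 * contract xs (R z1)"
        using contract_add[of xs "R z1" "R z1"] by simp
      then have "polydiff u (2 * R z1) xs = 2 * polydiff u (R z1) xs"
        by (simp add: polydiff_eq_contract R R2 xs(3))
      then show "(deriv ^^ 2) (\<lambda>t. polydiff u (F (point_at u P t)) xs) (u z1) = polydiff u (2 * R z1) xs"
        using deriv(3) r(2) by simp
    qed
  qed
  show "has_W_deriv u P 1 F z1 G"
    unfolding has_W_deriv_def using * by (meson)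
  show "has_W_deriv u P 2 F z1 (2 * R z1)"
    unfolding has_W_deriv_def using * by (meson)
qed

text \<open>
  The derivative is chosen by a Hilbert operator; its components at generic points do not depend on the
  choice, which is all that a limit of components sees.
\<close>

lemma has_W_deriv_unique:
  assumes "has_W_deriv u P k F z1 G" "has_W_deriv u P k F z1 G'"
  obtains A where "finite A" "\<And>xs. length xs = m \<Longrightarrow> set xs \<inter> A = {} \<Longrightarrow>
     G \<in> W_reg (set xs) \<and> G' \<in> W_reg (set xs) \<and> contract xs G = contract xs G'"
proof -
  obtain A where A: "finite A" "\<And>xs. length xs = m \<Longrightarrow> set xs \<inter> A = {} \<Longrightarrow> G \<in> W_reg (set xs) \<and>
      (deriv ^^ k) (\<lambda>t. polydiff u (F (point_at u P t)) xs) (u z1) = polydiff u G xs"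
    using assms(1) unfolding has_W_deriv_def by meson
  obtain A' where A': "finite A'" "\<And>xs. length xs = m \<Longrightarrow> set xs \<inter> A' = {} \<Longrightarrow> G' \<in> W_reg (set xs) \<and>
      (deriv ^^ k) (\<lambda>t. polydiff u (F (point_at u P t)) xs) (u z1) = polydiff u G' xs"
    using assms(2) unfolding has_W_deriv_def by meson
  show ?thesis
  proof (rule that[of "A \<union> A' \<union> {P}"])
    fix xs :: "pline list" assume "length xs = m" "set xs \<inter> (A \<union> A' \<union> {P}) = {}"
    then have xs: "length xs = m" "set xs \<inter> A = {}" "set xs \<inter> A' = {}" "P \<notin> set xs" by auto
    have "G \<in> W_reg (set xs)" "G' \<in> W_reg (set xs)" "polydiff u G xs = polydiff u G' xs"
      using A(2)[OF xs(1,2)] A'(2)[OF xs(1,3)] by auto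
    then show "G \<in> W_reg (set xs) \<and> G' \<in> W_reg (set xs) \<and> contract xs G = contract xs G'"
      by (simp add: polydiff_eq_contract xs(4))
  qed (use A A' in auto)
qed

section \<open>The operator product\<close>

text \<open>
  The part of \<open>2 T(z) b(z1) v\<close> in which \<open>i(z)\<close> is not applied to \<open>e(z1)\<close>.
\<close>

definition ope_regular :: "W \<Rightarrow> pline \<Rightarrow> W" where
  "ope_regular v z = (let e = iota (e_form u z); e1 = iota (e_form u z1); w = ins z1 v in
     (ins z (ins z w) + e * (e * w) + 2 * (e * ins z w)) +
     e1 * (ins z (ins z v) + e * (e * v) + 2 * (e * ins z v)))"

lemma ope_regular_rational_family:
  assumes "v \<in> W_reg {z1}"
  shows "rational_family (ope_regular v)"
proof -
  have w: "ins z1 v \<in> W_reg {z1}" by (rule ins_W_reg[OF assms])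
  show ?thesis
    unfolding ope_regular_def Let_def
    by (intro rational_family_add rational_family_const_mult rational_family_e rational_family_ins rational_family_const assms w)
qed

lemma b_hat_eq:
  assumes "z \<noteq> P" "v \<in> W_reg {z}"
  shows "b_hat u z v = ins z v + iota (e_form u z) * v"
  by (simp add: b_hat_def e_hat_def i_hat_eq_ins assms)

text \<open>
  Binomial expansion: at \<open>z = z1\<close> the terms \<open>2 T i\<close> and \<open>e (2 T)\<close>, with \<open>e\<close> to the left of \<open>i\<close>, add up
  to \<open>(e + i)\<^sup>3\<close> in normal order.
\<close>

lemma S_hat_eq_ope_regular:
  assumes "v \<in> W_reg {z1}"
  shows "S_hat u z1 v = ope_regular v z1"
proof -
  have reg: "ins z1 v \<in> W_reg {z1}" "ins z1 (ins z1 v) \<in> W_reg {z1}"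
    by (intro ins_W_reg assms)+
  show ?thesis
    by (simp add: S_hat_def ope_regular_def e_hat_def eval_nat_numeral i_hat_eq_ins z1 assms reg Let_def algebra_simps)
qed

text \<open>
  The only contraction is \<open>i(z) e(z1) = 1 / (u z - u z1)\<^sup>2\<close>, a constant.  It arises once from the term
  \<open>2 e i\<close> of \<open>2 T\<close> and in two ways from the term \<open>i i\<close>.  These contributions are \<open>2 (i(z) + e(z)) v\<close>
  times the constant, that is, a multiple of \<open>b(z) v\<close>.
\<close>

lemma T_hat_b_hat_eq:
  assumes z: "z \<noteq> P" "z \<noteq> z1" and v: "v \<in> W_reg {z1}" "v \<in> W_reg {z}"
  shows "2 * T_hat u z (b_hat u z1 v) = ope_regular v z + cW (2 / (u z - u z1)\<^sup>2) * b_hat u z v"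
proof -
  let ?e = "iota (e_form u z)" and ?e1 = "iota (e_form u z1)" and ?w = "ins z1 v"
  define c where "c = cW (1 / (u z - u z1)\<^sup>2)"
  have b1: "b_hat u z1 v = ?w + ?e1 * v"
    by (rule b_hat_eq[OF z1 v(1)])
  have reg: "?w + ?e1 * v \<in> W_reg {z}"
    using z z1 v(2) by (auto intro!: W_reg_add W_reg_mult W_reg_iota ins_W_reg e_form(1))
  have "value_at z (e_form u z1) = - 1 / (u z - u z1)\<^sup>2"
    using z z1 by (simp add: value_at_regular e_form)
  then have ins_e1: "ins z ?e1 = c"
    by (simp add: ins_simps c_def)
  have ins_c: "ins z c = 0"
    by (simp add: c_def ins_simps)
  have one: "ins z (?w + ?e1 * v) = ins z ?w + (c * v + ?e1 * ins z v)"
    by (simp only: ins_simps(1,2) ins_e1)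
  have two: "ins z (ins z (?w + ?e1 * v)) = ins z (ins z ?w) + (2 * (c * ins z v) + ?e1 * ins z (ins z v))"
    unfolding one by (simp only: ins_simps(1,2) ins_e1 ins_c) (simp add: algebra_simps)
  have half: "2 * (cW (1 / 2) * w) = w" for w
    using cW_cancel[of 2 "1 / 2" w] by (simp add: cW_2)
  have c2: "cW (2 / (u z - u z1)\<^sup>2) = 2 * c"
    using cW_simps(4)[of 2 "1 / (u z - u z1)\<^sup>2"] by (simp add: c_def cW_2)
  have "2 * T_hat u z (b_hat u z1 v) = ins z (ins z (?w + ?e1 * v)) + ?e * (?e * (?w + ?e1 * v)) + 2 * (?e * ins z (?w + ?e1 * v))"
    unfolding T_hat_def half b1 e_hat_def
    by (simp add: i_hat_eq_ins z(1) reg ins_W_reg[OF reg])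
  also have "\<dots> = ope_regular v z + 2 * c * (ins z v + ?e * v)"
    unfolding two unfolding one ope_regular_def Let_def by (simp add: algebra_simps)
  finally show ?thesis
    unfolding c2 b_hat_eq[OF z(1) v(2)] .
qed

theorem b_hat_jet:
  assumes "v \<in> W_reg {z1}"
  shows "\<exists>G R. jet (\<lambda>z. b_hat u z v) G R"
proof -
  obtain G R where "jet (\<lambda>z. ins z v) G R" using jet_ins[OF assms] by blast
  from jet_add[OF this jet_e[of v]] obtain G R where "jet (\<lambda>z. ins z v + iota (e_form u z) * v) G R" by blast
  then obtain A where A: "rational_family R" "finite A" "\<And>z. z = z1 \<or> z \<notin> A \<Longrightarrow> ins z v + iota (e_form u z) * v =
      ins z1 v + iota (e_form u z1) * v + cW (u z - u z1) * G + cW ((u z - u z1)\<^sup>2) * R z"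
    using jetE by blast
  obtain B where B: "finite B" "\<And>X. X \<inter> B = {} \<Longrightarrow> v \<in> W_reg X"
    using W_reg_cofinite[of v] by blast
  have "jet (\<lambda>z. b_hat u z v) G R"
  proof (rule jetI[OF A(1), of "A \<union> B \<union> {P}"])
    fix z assume z: "z = z1 \<or> z \<notin> A \<union> B \<union> {P}"
    have "z \<noteq> P" "v \<in> W_reg {z}" using z z1 assms B(2)[of "{z}"] by auto
    then show "b_hat u z v = b_hat u z1 v + cW (u z - u z1) * G + cW ((u z - u z1)\<^sup>2) * R z"
      using A(3)[of z] z by (auto simp: b_hat_eq z1 assms)
  qed (use A(2) B(1) in auto)
  then show ?thesis by blast
qed

text \<open>
  In \<open>2 T(z) b(z1) v\<close> the singular term is \<open>2 / h\<^sup>2\<close> times \<open>b(z) v\<close>, where \<open>h = u z - u z1\<close>.  The subtracted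
  terms are its Taylor polynomial of order 1, so twice the remainder of the jet of \<open>b(z) v\<close> survives; at
  \<open>z1\<close> this is the second derivative.
\<close>

theorem operator_product_expansion:
  assumes v: "v \<in> W_reg {z1}"
  shows "W_tendsto u
    (\<lambda>z2. 2 * T_hat u z2 (b_hat u z1 v)
       - cW (2 / (u z2 - u z1)\<^sup>2) * b_hat u z1 v
       - cW (2 / (u z2 - u z1)) * b_hat_deriv u P 1 z1 v)
    z1
    (S_hat u z1 v + b_hat_deriv u P 2 z1 v)"
proof -
  obtain G R where jet: "jet (\<lambda>z. b_hat u z v) G R" using b_hat_jet[OF v] by blast
  define G1 where "G1 = b_hat_deriv u P 1 z1 v"
  define G2 where "G2 = b_hat_deriv u P 2 z1 v"
  have G1: "has_W_deriv u P 1 (\<lambda>z. b_hat u z v) z1 G1"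
    unfolding G1_def b_hat_deriv_def W_deriv_def using jet_has_W_deriv(1)[OF jet] by (rule someI)
  have G2: "has_W_deriv u P 2 (\<lambda>z. b_hat u z v) z1 G2"
    unfolding G2_def b_hat_deriv_def W_deriv_def using jet_has_W_deriv(2)[OF jet] by (rule someI)
  obtain A where R: "rational_family R" and A: "finite A"
    "\<And>z. z = z1 \<or> z \<notin> A \<Longrightarrow> b_hat u z v = b_hat u z1 v + cW (u z - u z1) * G + cW ((u z - u z1)\<^sup>2) * R z"
    using jetE[OF jet] by blast
  obtain B where B: "finite B" "\<And>X. X \<inter> B = {} \<Longrightarrow> v \<in> W_reg X"
    using W_reg_cofinite[of v] by blast
  define E where "E z = ope_regular v z + 2 * R z" for z
  define F where "F z = 2 * T_hat u z (b_hat u z1 v) - cW (2 / (u z - u z1)\<^sup>2) * b_hat u z1 v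
       - cW (2 / (u z - u z1)) * G1" for z
  have E: "rational_family E"
    unfolding E_def by (intro rational_family_add rational_family_const_mult ope_regular_rational_family v R)
  have F_E: "F z = E z + cW (2 / (u z - u z1)) * (G - G1)" if z: "z \<notin> A \<union> B \<union> {P, z1}" for z
  proof -
    define h where "h = u z - u z1"
    have h: "h \<noteq> 0" using z coordinate_inj z1 by (auto simp: h_def)
    have "2 * T_hat u z (b_hat u z1 v) = ope_regular v z + cW (2 / h\<^sup>2) * b_hat u z v"
      unfolding h_def by (rule T_hat_b_hat_eq) (use z v B(2)[of "{z}"] in auto)
    also have "b_hat u z v = b_hat u z1 v + cW h * G + cW (h\<^sup>2) * R z"
      unfolding h_def by (rule A(2)) (use z in auto)
    also have "cW (2 / h\<^sup>2) * (b_hat u z1 v + cW h * G + cW (h\<^sup>2) * R z) =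
        cW (2 / h\<^sup>2) * b_hat u z1 v + cW (2 / h\<^sup>2 * h) * G + cW (2 / h\<^sup>2 * h\<^sup>2) * R z"
      by (simp only: distrib_left cW_simps mult.assoc)
    also have "2 / h\<^sup>2 * h\<^sup>2 = 2" using h by simp
    also have "2 / h\<^sup>2 * h = 2 / h" using h by (simp add: power2_eq_square)
    finally show ?thesis
      unfolding F_def E_def cW_2 by (simp add: algebra_simps flip: h_def)
  qed
  have "\<exists>N D A. finite A \<and>
        (\<exists>ys. length ys = m \<and> mpoly_eval D (u z1 # ys) \<noteq> 0) \<and>
        (\<forall>z2 xs. z2 \<notin> A \<and> length xs = m \<and> set xs \<inter> insert z2 A = {} \<longrightarrow>
           F z2 \<in> W_reg (set xs) \<and>
           polydiff u (F z2) xs * mpoly_eval D (u z2 # map u xs) = mpoly_eval N (u z2 # map u xs)) \<and>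
        (\<forall>xs. length xs = m \<and> set xs \<inter> A = {} \<longrightarrow>
           S_hat u z1 v + G2 \<in> W_reg (set xs) \<and>
           polydiff u (S_hat u z1 v + G2) xs * mpoly_eval D (u z1 # map u xs) = mpoly_eval N (u z1 # map u xs))" for m
  proof -
    obtain A1 where A1: "finite A1" "\<And>xs. length xs = m \<Longrightarrow> set xs \<inter> A1 = {} \<Longrightarrow>
       G \<in> W_reg (set xs) \<and> G1 \<in> W_reg (set xs) \<and> contract xs G = contract xs G1"
      using has_W_deriv_unique[OF jet_has_W_deriv(1)[OF jet] G1, of m] by metis
    obtain A2 where A2: "finite A2" "\<And>xs. length xs = m \<Longrightarrow> set xs \<inter> A2 = {} \<Longrightarrow>
       2 * R z1 \<in> W_reg (set xs) \<and> G2 \<in> W_reg (set xs) \<and> contract xs (2 * R z1) = contract xs G2"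
      using has_W_deriv_unique[OF jet_has_W_deriv(2)[OF jet] G2, of m] by metis
    obtain A3 where A3: "finite A3" "\<And>X. X \<inter> A3 = {} \<Longrightarrow> S_hat u z1 v \<in> W_reg X"
      using W_reg_cofinite[of "S_hat u z1 v"] by blast
    obtain n d C where "represents E m n d C"
      using rational_familyE[OF E] by blast
    note C = representsD[OF this]
    \<comment> \<open>The factor accounts for the normalisation of the polydifferential.\<close>
    have "polyfun (Suc m) (\<lambda>ys. fact m * d ys)"
      by (intro polyfun_intros C)
    then obtain N D where ND: "\<And>ys. length ys = Suc m \<Longrightarrow> mpoly_eval N ys = n ys"
        "\<And>ys. length ys = Suc m \<Longrightarrow> mpoly_eval D ys = fact m * d ys"
      using C(2) unfolding polyfun_def by metis
    define H where "H = A \<union> B \<union> C \<union> A1 \<union> A2 \<union> A3 \<union> {P, z1}"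
    have fin: "finite H" by (simp add: H_def A(1) B(1) C(1) A1(1) A2(1) A3(1))
    show ?thesis
    proof (rule exI[of _ N], rule exI[of _ D], rule exI[of _ H], intro conjI allI impI)
      show "finite H" by (rule fin)
      obtain x where x: "x \<notin> H" using ex_new_if_finite[OF infinite_pline fin] by blast
      define xs where "xs = replicate m x"
      have "length xs = m" "admissible C z1 (set xs)"
        using x by (auto simp: xs_def admissible_def H_def)
      from C(5)[OF this] have "mpoly_eval D (u z1 # map u xs) \<noteq> 0"
        by (simp add: ND xs_def)
      then show "\<exists>ys. length ys = m \<and> mpoly_eval D (u z1 # ys) \<noteq> 0"
        by (intro exI[of _ "map u xs"]) (simp add: xs_def)
    next
      fix z xs assume *: "z \<notin> H \<and> length xs = m \<and> set xs \<inter> insert z H = {}"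
      then have xs: "length xs = m" and P: "P \<notin> set xs" by (auto simp: H_def)
      have adm: "admissible C z (set xs)"
        using * by (auto simp: admissible_def H_def)
      have z: "z \<notin> A \<union> B \<union> {P, z1}" using * by (auto simp: H_def)
      have G: "G \<in> W_reg (set xs)" "G1 \<in> W_reg (set xs)" "contract xs G = contract xs G1"
        using A1(2)[OF xs] * by (auto simp: H_def)
      show reg: "F z \<in> W_reg (set xs)"
        unfolding F_E[OF z] by (intro W_reg_add W_reg_mult W_reg_diff W_reg_cW G C(4) xs adm)
      have "contract xs (F z) = contract xs (E z)"
        unfolding F_E[OF z] by (simp add: contract_add contract_cW_mult contract_diff G)
      then show "polydiff u (F z) xs * mpoly_eval D (u z # map u xs) = mpoly_eval N (u z # map u xs)"
        using C(6)[OF xs adm] by (simp add: polydiff_eq_contract reg P ND xs)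
    next
      fix xs assume *: "length xs = m \<and> set xs \<inter> H = {}"
      then have xs: "length xs = m" and P: "P \<notin> set xs" by (auto simp: H_def)
      have adm: "admissible C z1 (set xs)"
        using * by (auto simp: admissible_def H_def)
      have G: "G2 \<in> W_reg (set xs)" "contract xs (2 * R z1) = contract xs G2"
        using A2(2)[OF xs] * by (auto simp: H_def)
      have S: "S_hat u z1 v \<in> W_reg (set xs)"
        by (rule A3) (use * in \<open>auto simp: H_def\<close>)
      show reg: "S_hat u z1 v + G2 \<in> W_reg (set xs)"
        by (intro W_reg_add S G)
      have "contract xs (S_hat u z1 v + G2) = contract xs (E z1)"
        by (simp add: contract_add G(2)[symmetric] E_def S_hat_eq_ope_regular v)
      then show "polydiff u (S_hat u z1 v + G2) xs * mpoly_eval D (u z1 # map u xs) = mpoly_eval N (u z1 # map u xs)"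
        using C(6)[OF xs adm] by (simp add: polydiff_eq_contract reg P ND xs)
    qed
  qed
  then show ?thesis
    unfolding W_tendsto_def F_def G1_def G2_def by blast
qed

end

theorem proposition4p3:
  fixes u :: "pline \<Rightarrow> complex" and P z1 :: pline and v :: W
  assumes "coordinate u P"
    and "z1 \<noteq> P"
    and "v \<in> W_reg {z1}"
  shows "W_tendsto u
    (\<lambda>z2. 2 * T_hat u z2 (b_hat u z1 v)
       - cW (2 / (u z2 - u z1)\<^sup>2) * b_hat u z1 v
       - cW (2 / (u z2 - u z1)) * b_hat_deriv u P 1 z1 v)
    z1
    (S_hat u z1 v + b_hat_deriv u P 2 z1 v)"
proof -
  interpret pointed_line u P z1
    by unfold_locales (use assms in auto)
  show ?thesis by (rule operator_product_expansion[OF assms(3)])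
qed

end
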